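(* Let $n\ge 2$ and let $\lambda$ be a strict partition with at most $n$ parts. Then the operators $e_{\overline 1},e_1,\dots,e_{n-1}$ and $f_{\overline 1},f_1,\dots,f_{n-1}$ defined below are well-defined maps $\mathsf{SetDecTab}_n(\lambda)\to\mathsf{SetDecTab}_n(\lambda)\sqcup\{0\}$ (in particular, whenever case (b) of the definition of $e_i$ or $f_i$ is reached, the box $(a,b)$ described there exists), and with the weight map $\operatorname{wt}$ they make $\mathsf{SetDecTab}_n(\lambda)$ into a $\mathfrak{q}_n$-crystal that is seminormal as a $\mathfrak{gl}_n$-crystal.
   Context: Tableaux. A strict partition is $\lambda=(\lambda_1>\dots>\lambda_\ell>0)$; its shifted diagram is $\mathsf{SD}_\lambda=\{(r,r+j-1): r\in[\ell], j\in[\lambda_r]\}$, box $(r,c)$ being in row $r$, column $c$. A hook word is a finite sequence $w_1\cdots w_k$ of positive integers with $w_1\ge\dots\ge w_m<w_{m+1}<\dots<w_k$ for some $m\in[k]$. A decomposition tableau of shape $\lambda$ is a map $T:\mathsf{SD}_\lambda\to\mathbb{Z}_{>0}$ such that, writing $\rho_r$ for row $r$ read in increasing column order, each $\rho_r$ is a hook word and for each $r\in[\ell-1]$, $\rho_r$ is a hook subword of maximal length in $\rho_{r+1}\rho_r$. A set-valued decomposition tableau of shape $\lambda$ assigns to each box $(r,c)$ a finite nonempty set $T_{rc}\subseteq\mathbb{Z}_{>0}$ such that every distribution (choice of one element from each box) is a decomposition tableau; $\mathsf{SetDecTab}_n(\lambda)$ is the set of those with all entries in $[n]$. The reverse row reading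 order reads row $1$ right to left, then row $2$ right to left, etc.; $\mathsf{revrow}(T)$ lists the boxes in this order, writing each box's elements in decreasing order. $\operatorname{wt}(T)\in\mathbb{N}^n$ has $k$-th entry the number of boxes containing $k$. For $i\in[n-1]$, replace each $i$ in $\mathsf{revrow}(T)$ by ")" and each $i+1$ by "(" and match parentheses in the usual way; a letter equal to $i$ or $i+1$ is $i$-unpaired if it is not in a matched pair. Operators $e_i$ ($i\in[n-1]$): if no $i$-unpaired letter equals $i+1$, $e_i(T)=0$. Otherwise let $(x,y)$ be the box containing the first $i$-unpaired $i+1$. (a) If replacing $i+1$ by $i$ in $T_{xy}$ gives a set-valued decomposition tableau, this is $e_i(T)$. (b) Otherwise, let $(a,b)$ be the last box preceding $(x,y)$ in reverse row reading order with $\{i,i+1\}\subseteq T_{ab}$; $e_i(T)$ is obtained by removing $i+1$ from $T_{ab}$ and adding $i$ to $T_{xy}$. Operators $f_i$: if no $i$-unpaired letter equals $i$, $f_i(T)=0$. Otherwise let $(x,y)$ be the box containing the last $i$-unpaired $i$. (a) If replacing $i$ by $i+1$ in $T_{xy}$ gives a set-valued decomposition tableau, this is $f_i(T)$. (b) Otherwise let $(a,b)$ be the first box following $(x,y)$ in reverse row reading order with $\{i,i+1\}\subseteq T_{ab}$; $f_i(T)$ is obtained by removing $i$ from $T_{ab}$ and adding $i+1$ to $T_{xy}$. Operators $e_{\overline 1},f_{\overline 1}$: let $(r,c)$ be the first box in reverse row reading order whose entry contains $1$ or $2$ (if none, both are $0$). $e_{\overline 1}(T)$ is obtained by replacing $2$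 by $1$ in $T_{rc}$ if $2\in T_{rc}$ and $1\notin T_{rc}$, and $e_{\overline 1}(T)=0$ otherwise. $f_{\overline 1}(T)$ is obtained by replacing $1$ by $2$ in $T_{rc}$ if $1\in T_{rc}$ and $2\notin T_{rc}$, and $f_{\overline 1}(T)=0$ otherwise. Crystals. A $\mathfrak{gl}_n$-crystal is a set $\mathcal{B}$ with $\operatorname{wt}:\mathcal{B}\to\mathbb{Z}^n$ and maps $e_i,f_i:\mathcal{B}\to\mathcal{B}\sqcup\{0\}$ ($i\in[n-1]$, $0\notin\mathcal{B}$) such that $e_i(b)=c$ iff $f_i(c)=b$, in which case $\operatorname{wt}(c)=\operatorname{wt}(b)+\mathbf{e}_i-\mathbf{e}_{i+1}$ (standard basis vectors). Set $\varepsilon_i(b)=\sup\{k\ge0: e_i^k(b)\ne0\}$, $\varphi_i(b)=\sup\{k\ge0:f_i^k(b)\ne0\}$. It is seminormal if these are always finite and $\varphi_i(b)-\varepsilon_i(b)=\operatorname{wt}(b)_i-\operatorname{wt}(b)_{i+1}$. A $\mathfrak{q}_n$-crystal is a $\mathfrak{gl}_n$-crystal with extra maps $e_{\overline 1},f_{\overline 1}:\mathcal{B}\to\mathcal{B}\sqcup\{0\}$ such that (a) for all $3\le i\le n-1$, $e_{\overline 1},f_{\overline 1}$ commute with $e_i,f_i$ (with all maps sending $0$ to $0$) and preserve $\varepsilon_i,\varphi_i$ (i.e. $\varepsilon_i(e_{\overline1}(b))=\varepsilon_i(b)$ whenever $e_{\overline 1}(b)\ne0$, and similarly); (b) $e_{\overline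 1}(b)=c$ iff $f_{\overline 1}(c)=b$, in which case $\operatorname{wt}(c)=\operatorname{wt}(b)+\mathbf{e}_1-\mathbf{e}_2$. *)

theory Defs
  imports
    Main
    "HOL-Library.FuncSet"
    "HOL-Library.Sublist"
    "HOL-Library.Extended_Nat"
begin

section \<open>Shifted diagrams and decomposition tableaux\<close>

text \<open>
  Boxes are pairs (row, column), numbered from 1. A partition is the list of its parts, so its
  \<open>r\<close>-th part is \<open>lam ! (r - 1)\<close>.
\<close>

type_synonym box = "nat \<times> nat"

definition strict_partition :: "nat list \<Rightarrow> bool" where
  "strict_partition lam \<longleftrightarrow> sorted_wrt (>) lam \<and> (\<forall>x\<in>set lam. 0 < x)"

definition SD :: "nat list \<Rightarrow> box set" where
  "SD lam = {(r, r + j - 1) | r j. r \<in> {1..length lam} \<and> j \<in> {1..lam ! (r - 1)}}"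

text \<open>
  The letter in (1-based) position \<open>m\<close> is both the last letter of \<open>take m w\<close> and the first letter
  of \<open>drop (m - 1) w\<close>. In particular a hook word is nonempty.
\<close>

definition hook_word :: "nat list \<Rightarrow> bool" where
  "hook_word w \<longleftrightarrow> (\<forall>x\<in>set w. 0 < x) \<and>
     (\<exists>m\<in>{1..length w}. sorted_wrt (\<ge>) (take m w) \<and> sorted_wrt (<) (drop (m - 1) w))"

text \<open>Subwords are subsequences; they need not be contiguous.\<close>

definition max_hook_subword :: "nat list \<Rightarrow> nat list \<Rightarrow> bool" where
  "max_hook_subword u w \<longleftrightarrow> hook_word u \<and> subseq u w \<and>
     (\<forall>v. hook_word v \<and> subseq v w \<longrightarrow> length v \<le> length u)"

definition row_word :: "nat list \<Rightarrow> (box \<Rightarrow> nat) \<Rightarrow> nat \<Rightarrow> nat list" where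
  "row_word lam D r = map (\<lambda>c. D (r, c)) [r..<r + lam ! (r - 1)]"

definition dec_tableau :: "nat list \<Rightarrow> (box \<Rightarrow> nat) \<Rightarrow> bool" where
  "dec_tableau lam D \<longleftrightarrow> D \<in> SD lam \<rightarrow>\<^sub>E {0<..} \<and>
     (\<forall>r\<in>{1..length lam}. hook_word (row_word lam D r)) \<and>
     (\<forall>r\<in>{1..<length lam}.
        max_hook_subword (row_word lam D r) (row_word lam D (r + 1) @ row_word lam D r))"

text \<open>
  A set-valued filling is a total function with value \<open>{}\<close> outside the diagram, so that equality
  of fillings is equality of functions.
\<close>

definition setval_dec_tableau :: "nat list \<Rightarrow> (box \<Rightarrow> nat set) \<Rightarrow> bool" where
  "setval_dec_tableau lam T \<longleftrightarrow>
     (\<forall>b\<in>SD lam. finite (T b) \<and> T b \<noteq> {} \<and> T b \<subseteq> {0<..}) \<and>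
     (\<forall>b. b \<notin> SD lam \<longrightarrow> T b = {}) \<and>
     (\<forall>D \<in> Pi\<^sub>E (SD lam) T. dec_tableau lam D)"

definition SetDecTab :: "nat \<Rightarrow> nat list \<Rightarrow> (box \<Rightarrow> nat set) set" where
  "SetDecTab n lam = {T. setval_dec_tableau lam T \<and> (\<forall>b\<in>SD lam. T b \<subseteq> {1..n})}"

section \<open>Reading words, weights, and parenthesis matching\<close>

definition revrow_boxes :: "nat list \<Rightarrow> box list" where
  "revrow_boxes lam =
     concat (map (\<lambda>r. rev (map (\<lambda>c. (r, c)) [r..<r + lam ! (r - 1)])) [1..<length lam + 1])"

text \<open>The reverse row reading word, each letter paired with the box that it comes from.\<close>

definition boxed_revrow :: "nat list \<Rightarrow> (box \<Rightarrow> nat set) \<Rightarrow> (box \<times> nat) list" where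
  "boxed_revrow lam T =
     concat (map (\<lambda>b. map (\<lambda>x. (b, x)) (rev (sorted_list_of_set (T b)))) (revrow_boxes lam))"

definition revrow :: "nat list \<Rightarrow> (box \<Rightarrow> nat set) \<Rightarrow> nat list" where
  "revrow lam T = map snd (boxed_revrow lam T)"

definition tab_wt :: "nat \<Rightarrow> nat list \<Rightarrow> (box \<Rightarrow> nat set) \<Rightarrow> nat \<Rightarrow> int" where
  "tab_wt n lam T k = (if k \<in> {1..n} then int (card {b \<in> SD lam. k \<in> T b}) else 0)"

text \<open>
  A letter \<open>i + 1\<close> is an opening and a letter \<open>i\<close> a closing parenthesis; all other letters are
  ignored. Positions in words are counted from 0.
\<close>

inductive balanced :: "nat \<Rightarrow> nat list \<Rightarrow> bool" for i :: nat where
  Nil: "balanced i []"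
| other: "x \<noteq> i \<Longrightarrow> x \<noteq> i + 1 \<Longrightarrow> balanced i [x]"
| enclose: "balanced i w \<Longrightarrow> balanced i ((i + 1) # w @ [i])"
| append: "balanced i v \<Longrightarrow> balanced i w \<Longrightarrow> balanced i (v @ w)"

definition matched :: "nat \<Rightarrow> nat list \<Rightarrow> nat \<Rightarrow> nat \<Rightarrow> bool" where
  "matched i w p q \<longleftrightarrow> p < q \<and> q < length w \<and> w ! p = i + 1 \<and> w ! q = i \<and>
     balanced i (take (q - p - 1) (drop (p + 1) w))"

definition unpaired :: "nat \<Rightarrow> nat list \<Rightarrow> nat \<Rightarrow> bool" where
  "unpaired i w p \<longleftrightarrow> p < length w \<and> w ! p \<in> {i, i + 1} \<and>
     \<not> (\<exists>q. matched i w p q \<or> matched i w q p)"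

section \<open>The crystal operators on set-valued decomposition tableaux\<close>

text \<open>The value 0 of an operator is represented by \<^const>\<open>None\<close>.\<close>

definition e_active :: "nat list \<Rightarrow> nat \<Rightarrow> (box \<Rightarrow> nat set) \<Rightarrow> bool" where
  "e_active lam i T \<longleftrightarrow> (\<exists>p. unpaired i (revrow lam T) p \<and> revrow lam T ! p = i + 1)"

definition e_box :: "nat list \<Rightarrow> nat \<Rightarrow> (box \<Rightarrow> nat set) \<Rightarrow> box" where
  "e_box lam i T =
     fst (boxed_revrow lam T ! (LEAST p. unpaired i (revrow lam T) p \<and> revrow lam T ! p = i + 1))"

definition e_replace :: "nat list \<Rightarrow> nat \<Rightarrow> (box \<Rightarrow> nat set) \<Rightarrow> box \<Rightarrow> nat set" where
  "e_replace lam i T =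
     (let xy = e_box lam i T in T(xy := insert i (T xy - {i + 1})))"

text \<open>
  The boxes before the distinguished box that contain both \<open>i\<close> and \<open>i + 1\<close>, in reading order.
  Case (b) of the definition of the operator uses the last one; if the list were empty, the value
  of the operator would be arbitrary.
\<close>

definition e_partners :: "nat list \<Rightarrow> nat \<Rightarrow> (box \<Rightarrow> nat set) \<Rightarrow> box list" where
  "e_partners lam i T =
     filter (\<lambda>b. {i, i + 1} \<subseteq> T b) (takeWhile (\<lambda>b. b \<noteq> e_box lam i T) (revrow_boxes lam))"

definition e_op :: "nat list \<Rightarrow> nat \<Rightarrow> (box \<Rightarrow> nat set) \<Rightarrow> (box \<Rightarrow> nat set) option" where
  "e_op lam i T =
     (if \<not> e_active lam i T then None
      else if setval_dec_tableau lam (e_replace lam i T) then Some (e_replace lam i T)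
      else let xy = e_box lam i T; ab = last (e_partners lam i T)
           in Some (T(ab := T ab - {i + 1}, xy := insert i (T xy))))"

definition f_active :: "nat list \<Rightarrow> nat \<Rightarrow> (box \<Rightarrow> nat set) \<Rightarrow> bool" where
  "f_active lam i T \<longleftrightarrow> (\<exists>p. unpaired i (revrow lam T) p \<and> revrow lam T ! p = i)"

definition f_box :: "nat list \<Rightarrow> nat \<Rightarrow> (box \<Rightarrow> nat set) \<Rightarrow> box" where
  "f_box lam i T =
     fst (boxed_revrow lam T ! (GREATEST p. unpaired i (revrow lam T) p \<and> revrow lam T ! p = i))"

definition f_replace :: "nat list \<Rightarrow> nat \<Rightarrow> (box \<Rightarrow> nat set) \<Rightarrow> box \<Rightarrow> nat set" where
  "f_replace lam i T =
     (let xy = f_box lam i T in T(xy := insert (i + 1) (T xy - {i})))"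

definition f_partners :: "nat list \<Rightarrow> nat \<Rightarrow> (box \<Rightarrow> nat set) \<Rightarrow> box list" where
  "f_partners lam i T =
     filter (\<lambda>b. {i, i + 1} \<subseteq> T b) (tl (dropWhile (\<lambda>b. b \<noteq> f_box lam i T) (revrow_boxes lam)))"

definition f_op :: "nat list \<Rightarrow> nat \<Rightarrow> (box \<Rightarrow> nat set) \<Rightarrow> (box \<Rightarrow> nat set) option" where
  "f_op lam i T =
     (if \<not> f_active lam i T then None
      else if setval_dec_tableau lam (f_replace lam i T) then Some (f_replace lam i T)
      else let xy = f_box lam i T; ab = hd (f_partners lam i T)
           in Some (T(ab := T ab - {i}, xy := insert (i + 1) (T xy))))"

definition ebar_op :: "nat list \<Rightarrow> (box \<Rightarrow> nat set) \<Rightarrow> (box \<Rightarrow> nat set) option" where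
  "ebar_op lam T =
     (case List.find (\<lambda>b. 1 \<in> T b \<or> 2 \<in> T b) (revrow_boxes lam) of
        None \<Rightarrow> None
      | Some b \<Rightarrow> if 2 \<in> T b \<and> 1 \<notin> T b then Some (T(b := insert 1 (T b - {2}))) else None)"

definition fbar_op :: "nat list \<Rightarrow> (box \<Rightarrow> nat set) \<Rightarrow> (box \<Rightarrow> nat set) option" where
  "fbar_op lam T =
     (case List.find (\<lambda>b. 1 \<in> T b \<or> 2 \<in> T b) (revrow_boxes lam) of
        None \<Rightarrow> None
      | Some b \<Rightarrow> if 1 \<in> T b \<and> 2 \<notin> T b then Some (T(b := insert 2 (T b - {1}))) else None)"

section \<open>Crystals\<close>

definition with_zero :: "'b set \<Rightarrow> 'b option set" where
  "with_zero B = insert None (Some ` B)"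

text \<open>Integer vectors of length \<open>n\<close> are functions that vanish outside the index set \<open>{1..n}\<close>.\<close>

definition int_vectors :: "nat \<Rightarrow> (nat \<Rightarrow> int) set" where
  "int_vectors n = {v. \<forall>k. k \<notin> {1..n} \<longrightarrow> v k = 0}"

definition basis_vec :: "nat \<Rightarrow> nat \<Rightarrow> int" where
  "basis_vec i k = (if k = i then 1 else 0)"

definition iterate_op :: "('b \<Rightarrow> 'b option) \<Rightarrow> nat \<Rightarrow> 'b \<Rightarrow> 'b option" where
  "iterate_op g k b = ((\<lambda>x. Option.bind x g) ^^ k) (Some b)"

text \<open>
  For \<open>g = e i\<close> this is the string length \<open>\<epsilon>\<^sub>i\<close>, for \<open>g = f i\<close> it is \<open>\<phi>\<^sub>i\<close>. The supremum may be
  infinite.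
\<close>

definition string_len :: "('b \<Rightarrow> 'b option) \<Rightarrow> 'b \<Rightarrow> enat" where
  "string_len g b = (SUP k\<in>{k. iterate_op g k b \<noteq> None}. enat k)"

locale gl_crystal =
  fixes n :: nat
    and B :: "'b set"
    and wt :: "'b \<Rightarrow> nat \<Rightarrow> int"
    and e f :: "nat \<Rightarrow> 'b \<Rightarrow> 'b option"
  assumes wt_closed: "wt \<in> B \<rightarrow> int_vectors n"
    and e_closed: "i \<in> {1..<n} \<Longrightarrow> e i \<in> B \<rightarrow> with_zero B"
    and f_closed: "i \<in> {1..<n} \<Longrightarrow> f i \<in> B \<rightarrow> with_zero B"
    and e_iff_f: "\<lbrakk>i \<in> {1..<n}; b \<in> B; c \<in> B\<rbrakk> \<Longrightarrow> e i b = Some c \<longleftrightarrow> f i c = Some b"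
    and wt_e: "\<lbrakk>i \<in> {1..<n}; b \<in> B; c \<in> B; e i b = Some c\<rbrakk>
                 \<Longrightarrow> wt c = (\<lambda>k. wt b k + basis_vec i k - basis_vec (i + 1) k)"

locale seminormal_gl_crystal = gl_crystal n B wt e f
  for n :: nat
    and B :: "'b set"
    and wt :: "'b \<Rightarrow> nat \<Rightarrow> int"
    and e f :: "nat \<Rightarrow> 'b \<Rightarrow> 'b option" +
  assumes eps_finite: "\<lbrakk>i \<in> {1..<n}; b \<in> B\<rbrakk> \<Longrightarrow> string_len (e i) b \<noteq> \<infinity>"
    and phi_finite: "\<lbrakk>i \<in> {1..<n}; b \<in> B\<rbrakk> \<Longrightarrow> string_len (f i) b \<noteq> \<infinity>"
    and phi_minus_eps: "\<lbrakk>i \<in> {1..<n}; b \<in> B\<rbrakk> \<Longrightarrow>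
          int (the_enat (string_len (f i) b)) - int (the_enat (string_len (e i) b))
            = wt b i - wt b (i + 1)"

definition commute_on :: "'b set \<Rightarrow> ('b \<Rightarrow> 'b option) \<Rightarrow> ('b \<Rightarrow> 'b option) \<Rightarrow> bool" where
  "commute_on B g h \<longleftrightarrow> (\<forall>b\<in>B. Option.bind (g b) h = Option.bind (h b) g)"

definition preserves_on :: "'b set \<Rightarrow> ('b \<Rightarrow> 'b option) \<Rightarrow> ('b \<Rightarrow> 'c) \<Rightarrow> bool" where
  "preserves_on B g s \<longleftrightarrow> (\<forall>b\<in>B. \<forall>c. g b = Some c \<longrightarrow> s c = s b)"

locale q_crystal = gl_crystal n B wt e f
  for n :: nat
    and B :: "'b set"
    and wt :: "'b \<Rightarrow> nat \<Rightarrow> int"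
    and e f :: "nat \<Rightarrow> 'b \<Rightarrow> 'b option" +
  fixes ebar fbar :: "'b \<Rightarrow> 'b option"
  assumes ebar_closed: "ebar \<in> B \<rightarrow> with_zero B"
    and fbar_closed: "fbar \<in> B \<rightarrow> with_zero B"
    and ebar_commutes: "\<lbrakk>3 \<le> i; i \<le> n - 1\<rbrakk>
          \<Longrightarrow> commute_on B ebar (e i) \<and> commute_on B ebar (f i)"
    and fbar_commutes: "\<lbrakk>3 \<le> i; i \<le> n - 1\<rbrakk>
          \<Longrightarrow> commute_on B fbar (e i) \<and> commute_on B fbar (f i)"
    and ebar_preserves: "\<lbrakk>3 \<le> i; i \<le> n - 1\<rbrakk>
          \<Longrightarrow> preserves_on B ebar (string_len (e i)) \<and> preserves_on B ebar (string_len (f i))"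
    and fbar_preserves: "\<lbrakk>3 \<le> i; i \<le> n - 1\<rbrakk>
          \<Longrightarrow> preserves_on B fbar (string_len (e i)) \<and> preserves_on B fbar (string_len (f i))"
    and ebar_iff_fbar: "\<lbrakk>b \<in> B; c \<in> B\<rbrakk> \<Longrightarrow> ebar b = Some c \<longleftrightarrow> fbar c = Some b"
    and wt_ebar: "\<lbrakk>b \<in> B; c \<in> B; ebar b = Some c\<rbrakk>
          \<Longrightarrow> wt c = (\<lambda>k. wt b k + basis_vec 1 k - basis_vec 2 k)"

end

theory Submission
  imports Defs
begin

text \<open>
  A filling is a set-valued decomposition tableau iff it avoids four families of patterns in at
  most three boxes of one row or two adjacent rows. Record a word of parentheses that reduces to
  \<open>a\<close> closing followed by \<open>b\<close> opening ones as the pair \<open>(a, b)\<close>, multiplied as in the bicyclic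
  monoid; a box containing both \<open>i\<close> and \<open>i + 1\<close> contributes the unit. Suppose that moving the
  letter \<open>i + 1\<close> of the first unpaired box \<open>X\<close> to \<open>i\<close> creates a forbidden pattern. Since \<open>X\<close> is
  unpaired, each such pattern must use the letter \<open>i + 1\<close> of a box \<open>A\<close> that contains both \<open>i\<close> and
  \<open>i + 1\<close> and is separated from \<open>X\<close> only by boxes with neither letter. Hence \<open>A\<close> is unique, removing
  \<open>i + 1\<close> from it destroys all patterns, and in the result the same patterns obstruct the plain
  replacement at \<open>A\<close>, so that \<open>f\<^sub>i\<close> undoes the move. The argument for \<open>f\<^sub>i\<close> is analogous.
\<close>


section \<open>Parenthesis matching\<close>

text \<open>The pivot property is used as a supply of letters. An \<open>i\<close> read after
  \<open>X\<close> is preceded, still after \<open>X\<close>, by an \<open>i + 1\<close> or shares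
  its box with one; an \<open>i + 1\<close> read before \<open>X\<close> is followed by an
  \<open>i\<close> in the same sense. Usually this additional letter completes a pattern already
  present in the filling, or both letters are forced into one box, which is the partner. Two
  configurations resist: lowering with \<open>X\<close> in the upper row of a \<open>lower\<close>
  pattern, and raising with \<open>X\<close> in the lower row and an \<open>i + 1\<close> in the row
  above. There letters have to be counted along two rows. Patterns are examined after adding the new
  letter to \<open>X\<close> without removing the old one, because the plain replacement and the
  result of case (b) both lie inside that filling. The patterns express that a row fails to be a
  hook word, or one of three ways in which a hook subword of two adjacent rows outgrows the upper
  row by one letter. For the odd operators no 1 or 2 is read before the chosen box, so most new
  patterns would need a small letter where there is none.\<close>

text \<open>
  The pair \<open>(a, b)\<close> stands for the reduced word of \<open>a\<close> closing followed by \<open>b\<close> opening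
  parentheses. Truncated subtraction counts the parentheses that survive a concatenation.
\<close>

definition bmul :: "nat \<times> nat \<Rightarrow> nat \<times> nat \<Rightarrow> nat \<times> nat" where
  "bmul x y = (fst x + (fst y - snd x), snd y + (snd x - fst y))"

lemma bmul_assoc: "bmul (bmul x y) z = bmul x (bmul y z)"
  by (auto simp: bmul_def)

lemma bmul_zero [simp]: "bmul (0, 0) x = x" "bmul x (0, 0) = x"
  by (auto simp: bmul_def)

primrec sig :: "('a \<Rightarrow> nat \<times> nat) \<Rightarrow> 'a list \<Rightarrow> nat \<times> nat" where
  "sig g [] = (0, 0)"
| "sig g (x # xs) = bmul (g x) (sig g xs)"

lemma sig_append: "sig g (u @ v) = bmul (sig g u) (sig g v)"
  by (induction u) (auto simp: bmul_assoc)

lemma sig_cong: "(\<And>x. x \<in> set u \<Longrightarrow> g x = h x) \<Longrightarrow> sig g u = sig h u"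
  by (induction u) auto

lemma sig_zero: "(\<And>x. x \<in> set u \<Longrightarrow> g x = (0, 0)) \<Longrightarrow> sig g u = (0, 0)"
  by (induction u) auto

lemma sig_concat_map: "(\<And>b. b \<in> set bs \<Longrightarrow> sig g (F b) = h b) \<Longrightarrow> sig g (concat (map F bs)) = sig h bs"
  by (induction bs) (auto simp: sig_append)

definition paren :: "nat \<Rightarrow> nat \<Rightarrow> nat \<times> nat" where
  "paren i x = (if x = i then (1, 0) else if x = i + 1 then (0, 1) else (0, 0))"

lemma paren_simps [simp]: "paren i i = (1, 0)" "paren i (Suc i) = (0, 1)"
  by (auto simp: paren_def)

text \<open>Induction from the right finds the shortest prefix with a surviving closing letter.
  Nothing closing survives before its last letter, and as that letter itself survives, nothing
  opening does either. \<open>sig_paren_opening\<close> is the mirror image.\<close>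

lemma sig_paren_closing:
  "0 < fst (sig (paren i) w) \<Longrightarrow> \<exists>u v. w = u @ i # v \<and> sig (paren i) u = (0, 0)"
proof (induction w rule: rev_induct)
  case (snoc x w)
  show ?case
  proof (cases "0 < fst (sig (paren i) w)")
    case True
    then show ?thesis using snoc.IH by fastforce
  next
    case False
    then have "x = i" "sig (paren i) w = (0, 0)"
      using snoc.prems
      by (auto simp: sig_append bmul_def paren_def[of i x] prod_eq_iff split: if_splits)
    then show ?thesis by auto
  qed
qed simp

lemma sig_paren_opening:
  "0 < snd (sig (paren i) w) \<Longrightarrow> \<exists>u v. w = u @ (i + 1) # v \<and> sig (paren i) v = (0, 0)"
proof (induction w)
  case (Cons x w)
  show ?case
  proof (cases "0 < snd (sig (paren i) w)")
    case True
    then obtain u v where "w = u @ (i + 1) # v" "sig (paren i) v = (0, 0)"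
      using Cons.IH by auto
    then show ?thesis by (intro exI[of _ "x # u"] exI[of _ v]) auto
  next
    case False
    then have "x = i + 1" "sig (paren i) w = (0, 0)"
      using Cons.prems
      by (auto simp: sig_append bmul_def paren_def[of i x] prod_eq_iff split: if_splits)
    then show ?thesis by auto
  qed
qed simp

text \<open>For the converse, a word reducing to the unit cannot start with a closing letter. If it
  starts with an opening one, the first surviving closing letter of the rest is its partner, and
  this cuts the word into two shorter words that reduce to the unit.\<close>

lemma balanced_iff_sig: "balanced i w \<longleftrightarrow> sig (paren i) w = (0, 0)"
proof
  assume "balanced i w"
  then show "sig (paren i) w = (0, 0)"
    by induction (auto simp: sig_append paren_def bmul_def)
next
  assume "sig (paren i) w = (0, 0)"
  then show "balanced i w"
  proof (induction "length w" arbitrary: w rule: less_induct)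
    case less
    show ?case
    proof (cases w)
      case Nil
      then show ?thesis by (simp add: balanced.Nil)
    next
      case (Cons x w')
      consider "x = i" | "x = i + 1" | "x \<noteq> i" "x \<noteq> i + 1" by blast
      then show ?thesis
      proof cases
        case 1
        then show ?thesis using less.prems Cons by (auto simp: bmul_def)
      next
        case 2
        then have w': "fst (sig (paren i) w') = 1" "snd (sig (paren i) w') = 0"
          using less.prems Cons by (auto simp: bmul_def)
        then obtain u v where uv: "w' = u @ i # v" "sig (paren i) u = (0, 0)"
          using sig_paren_closing[of i w'] by auto
        then have "sig (paren i) v = (0, 0)"
          using w' by (auto simp: sig_append bmul_def prod_eq_iff)
        then have "balanced i u" "balanced i v"
          using less.hyps uv Cons by auto
        then have "balanced i (((i + 1) # u @ [i]) @ v)"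
          by (intro balanced.append balanced.enclose)
        then show ?thesis using uv Cons 2 by simp
      next
        case 3
        then have "sig (paren i) w' = (0, 0)"
          using less.prems Cons by (auto simp: paren_def)
        then have "balanced i ([x] @ w')"
          using 3 less.hyps Cons by (intro balanced.append balanced.other) auto
        then show ?thesis using Cons by simp
      qed
    qed
  qed
qed

text \<open>Positions are traded for a factorization, so that later arguments multiply reduced words
  instead of computing with \<open>take\<close> and \<open>drop\<close>.\<close>

lemma matched_iff_split:
  "matched i w p q \<longleftrightarrow>
     (\<exists>u m v. w = u @ (i + 1) # m @ i # v \<and> length u = p \<and> q = p + 1 + length m \<and>
        sig (paren i) m = (0, 0))"
proof
  assume "matched i w p q"
  then have pq: "p < q" "q < length w" "w ! p = i + 1" "w ! q = i"
    "sig (paren i) (take (q - p - 1) (drop (p + 1) w)) = (0, 0)"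
    by (auto simp: matched_def balanced_iff_sig)
  have "w = take p w @ w ! p # drop (p + 1) w"
    using pq id_take_nth_drop[of p w] by simp
  moreover have "drop (p + 1) w = take (q - p - 1) (drop (p + 1) w) @ w ! q # drop (q + 1) w"
  proof -
    have "drop (p + 1) w = take (q - p - 1) (drop (p + 1) w)
      @ (drop (p + 1) w) ! (q - p - 1) # drop (Suc (q - p - 1)) (drop (p + 1) w)"
      using pq by (intro id_take_nth_drop) auto
    then show ?thesis using pq by auto
  qed
  ultimately show "\<exists>u m v. w = u @ (i + 1) # m @ i # v \<and> length u = p \<and> q = p + 1 + length m \<and>
        sig (paren i) m = (0, 0)"
    using pq
    by (intro exI[of _ "take p w"] exI[of _ "take (q - p - 1) (drop (p + 1) w)"]
          exI[of _ "drop (q + 1) w"]) auto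
next
  assume "\<exists>u m v. w = u @ (i + 1) # m @ i # v \<and> length u = p \<and> q = p + 1 + length m \<and>
        sig (paren i) m = (0, 0)"
  then show "matched i w p q"
    by (auto simp: matched_def balanced_iff_sig nth_append)
qed

text \<open>An opening letter can be matched only to its right, and its partner is the first closing
  letter that survives in \<open>v\<close>. The lemma for closing letters is the mirror
  image.\<close>

lemma unpaired_opening_iff:
  "unpaired i (u @ (i + 1) # v) (length u) \<longleftrightarrow> fst (sig (paren i) v) = 0"
proof -
  let ?w = "u @ (i + 1) # v"
  have "\<not> matched i ?w q (length u)" for q
    by (auto simp: matched_def)
  moreover have "(\<exists>q. matched i ?w (length u) q) \<longleftrightarrow> 0 < fst (sig (paren i) v)"
  proof
    assume "\<exists>q. matched i ?w (length u) q"
    then obtain m v' where "v = m @ i # v'" "sig (paren i) m = (0, 0)"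
      by (auto simp: matched_iff_split append_eq_append_conv)
    then show "0 < fst (sig (paren i) v)" by (simp add: sig_append bmul_def)
  next
    assume "0 < fst (sig (paren i) v)"
    then show "\<exists>q. matched i ?w (length u) q"
      using sig_paren_closing[of i v] by (fastforce simp: matched_iff_split)
  qed
  ultimately show ?thesis by (auto simp: unpaired_def)
qed

lemma unpaired_closing_iff:
  "unpaired i (u @ i # v) (length u) \<longleftrightarrow> snd (sig (paren i) u) = 0"
proof -
  let ?w = "u @ i # v"
  have "\<not> matched i ?w (length u) q" for q
    by (auto simp: matched_def)
  moreover have "(\<exists>q. matched i ?w q (length u)) \<longleftrightarrow> 0 < snd (sig (paren i) u)"
  proof
    assume "\<exists>q. matched i ?w q (length u)"
    then obtain u' m v' where "u @ i # v = (u' @ (i + 1) # m) @ i # v'"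
      "length u = length (u' @ (i + 1) # m)" "sig (paren i) m = (0, 0)"
      by (auto simp: matched_iff_split)
    then have "u = u' @ (i + 1) # m" "sig (paren i) m = (0, 0)"
      by (metis append_eq_append_conv)+
    then show "0 < snd (sig (paren i) u)" by (simp add: sig_append bmul_def)
  next
    assume "0 < snd (sig (paren i) u)"
    then obtain u' m where "u = u' @ (i + 1) # m" "sig (paren i) m = (0, 0)"
      using sig_paren_opening[of i u] by blast
    then have "matched i ?w (length u') (length u)"
      unfolding matched_iff_split by (intro exI[of _ u'] exI[of _ m] exI[of _ v]) auto
    then show "\<exists>q. matched i ?w q (length u)" ..
  qed
  ultimately show ?thesis by (auto simp: unpaired_def)
qed

section \<open>The parenthesis word read box by box\<close>

definition box_paren :: "nat \<Rightarrow> (box \<Rightarrow> nat set) \<Rightarrow> box \<Rightarrow> nat \<times> nat" where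
  "box_paren i T b = (if i \<in> T b \<longleftrightarrow> i + 1 \<in> T b then (0, 0) else if i \<in> T b then (1, 0) else (0, 1))"

abbreviation box_sig :: "nat \<Rightarrow> (box \<Rightarrow> nat set) \<Rightarrow> box list \<Rightarrow> nat \<times> nat" where
  "box_sig i T \<equiv> sig (box_paren i T)"

text \<open>In a strictly decreasing word \<open>i + 1\<close> is directly followed by
  \<open>i\<close> if both occur, so the two cancel. The decreasing order inside a box is what makes
  a box with both letters a unit.\<close>

lemma sig_paren_decreasing:
  "sorted_wrt (>) ds \<Longrightarrow> sig (paren i) ds =
     (if i \<in> set ds \<longleftrightarrow> i + 1 \<in> set ds then (0, 0) else if i \<in> set ds then (1, 0) else (0, 1))"
proof (induction ds)
  case (Cons x ds)
  consider "x = i" | "x = i + 1" | "x \<noteq> i" "x \<noteq> i + 1" by blast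
  then show ?case
    using Cons by cases (auto simp: bmul_def paren_def)
qed simp

definition box_letters :: "(box \<Rightarrow> nat set) \<Rightarrow> box \<Rightarrow> nat list" where
  "box_letters T b = rev (sorted_list_of_set (T b))"

lemma box_letters_decreasing: "sorted_wrt (>) (box_letters T b)"
  using sorted_list_of_set.strict_sorted_key_list_of_set[of "T b"]
  by (simp add: box_letters_def sorted_wrt_rev)

lemma sig_box_letters: "finite (T b) \<Longrightarrow> sig (paren i) (box_letters T b) = box_paren i T b"
  unfolding sig_paren_decreasing[OF box_letters_decreasing]
  by (simp add: box_letters_def box_paren_def)

lemma revrow_eq: "revrow lam T = concat (map (box_letters T) (revrow_boxes lam))"
  by (simp add: revrow_def boxed_revrow_def map_concat o_def box_letters_def[abs_def])

lemma sig_revrow: "\<forall>b. finite (T b) \<Longrightarrow> sig (paren i) (revrow lam T) = box_sig i T (revrow_boxes lam)"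
  unfolding revrow_eq by (intro sig_concat_map) (auto simp: sig_box_letters)

section \<open>From positions in the reading word to boxes\<close>

lemma nth_concat_split:
  assumes "p < length (concat (map F bs))"
  obtains P X Q L x R where "bs = P @ X # Q" "F X = L @ x # R"
    "concat (map F bs) = (concat (map F P) @ L) @ x # R @ concat (map F Q)"
    "p = length (concat (map F P) @ L)"
  using assms
proof (induction bs arbitrary: p thesis)
  case (Cons b bs)
  show ?case
  proof (cases "p < length (F b)")
    case True
    show ?thesis
      by (rule Cons.prems(1)[of "[]" b bs "take p (F b)" "F b ! p" "drop (Suc p) (F b)"])
        (use True id_take_nth_drop[OF True] in auto)
  next
    case False
    then have "p - length (F b) < length (concat (map F bs))" using Cons.prems(2) by auto
    then obtain P X Q L x R where PQ: "bs = P @ X # Q" "F X = L @ x # R"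
      "concat (map F bs) = (concat (map F P) @ L) @ x # R @ concat (map F Q)"
      "p - length (F b) = length (concat (map F P) @ L)"
      using Cons.IH by blast
    show ?thesis
      by (rule Cons.prems(1)[of "b # P" X Q L x R]) (use PQ False in auto)
  qed
qed simp

lemma revrow_nth_split:
  assumes "p < length (revrow lam T)"
  obtains P X Q L x R where "revrow_boxes lam = P @ X # Q" "box_letters T X = L @ x # R"
    "revrow lam T = (concat (map (box_letters T) P) @ L) @ x # R @ concat (map (box_letters T) Q)"
    "p = length (concat (map (box_letters T) P) @ L)" "boxed_revrow lam T ! p = (X, x)"
proof -
  define F where "F = (\<lambda>b. map (Pair b) (box_letters T b))"
  have B: "boxed_revrow lam T = concat (map F (revrow_boxes lam))"
    by (simp add: boxed_revrow_def F_def box_letters_def)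
  have snd_F: "map snd (F b) = box_letters T b" for b
    by (simp add: F_def o_def)
  have snd_concat: "map snd (concat (map F l)) = concat (map (box_letters T) l)" for l
    by (simp add: map_concat o_def snd_F)
  have "p < length (concat (map F (revrow_boxes lam)))"
    using assms by (simp add: revrow_def B)
  then obtain P X Q L z R where PQ: "revrow_boxes lam = P @ X # Q" "F X = L @ z # R"
    "concat (map F (revrow_boxes lam)) = (concat (map F P) @ L) @ z # R @ concat (map F Q)"
    "p = length (concat (map F P) @ L)"
    by (rule nth_concat_split)
  have z: "z = (X, snd z)"
  proof -
    have "z \<in> set (F X)" using PQ(2) by simp
    then show ?thesis by (auto simp: F_def)
  qed
  have len: "length (concat (map F P)) = length (concat (map (box_letters T) P))"
    by (metis length_map snd_concat)
  show ?thesis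
  proof (rule that[of P X Q "map snd L" "snd z" "map snd R"])
    show "box_letters T X = map snd L @ snd z # map snd R"
      using PQ(2) snd_F[of X] by simp
    show "revrow lam T = (concat (map (box_letters T) P) @ map snd L) @ snd z # map snd R
        @ concat (map (box_letters T) Q)"
      unfolding revrow_def B PQ(3) by (simp add: snd_concat)
    show "boxed_revrow lam T ! p = (X, snd z)"
      unfolding B PQ(3) using PQ(4) z by simp
  qed (use PQ len in auto)
qed

text \<open>
  Without matched parentheses a word is a string of closing ones followed by opening ones. The
  two letters at the break are the last unpaired \<open>i\<close> and the first unpaired \<open>i + 1\<close>, so the boxes
  of \<open>e\<^sub>i\<close> and \<open>f\<^sub>i\<close> satisfy the same condition on the words before and after them.
\<close>

definition pivot :: "nat \<Rightarrow> nat list \<Rightarrow> (box \<Rightarrow> nat set) \<Rightarrow> box \<Rightarrow> bool" where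
  "pivot i lam T X \<longleftrightarrow> (\<exists>P Q. revrow_boxes lam = P @ X # Q \<and>
     snd (box_sig i T P) = 0 \<and> fst (box_sig i T Q) = 0)"

lemma pivot_cong:
  assumes "\<And>b. i \<in> T' b \<longleftrightarrow> i \<in> T b" "\<And>b. i + 1 \<in> T' b \<longleftrightarrow> i + 1 \<in> T b"
  shows "pivot i lam T' X \<longleftrightarrow> pivot i lam T X"
proof -
  have "box_paren i T' = box_paren i T" using assms by (simp add: box_paren_def fun_eq_iff)
  then show ?thesis by (simp add: pivot_def)
qed

definition opens :: "nat \<Rightarrow> nat list \<Rightarrow> (box \<Rightarrow> nat set) \<Rightarrow> box \<Rightarrow> bool" where
  "opens i lam T X \<longleftrightarrow> pivot i lam T X \<and> i + 1 \<in> T X \<and> i \<notin> T X"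

definition closes :: "nat \<Rightarrow> nat list \<Rightarrow> (box \<Rightarrow> nat set) \<Rightarrow> box \<Rightarrow> bool" where
  "closes i lam T X \<longleftrightarrow> pivot i lam T X \<and> i \<in> T X \<and> i + 1 \<notin> T X"

lemma append_Cons_eq_cases:
  assumes "P @ X # Q = P' @ X' # Q'"
  obtains "P = P'" "X = X'" "Q = Q'"
  | R where "P' = P @ X # R" "Q = R @ X' # Q'"
  | R where "P = P' @ X' # R" "Q' = R @ X # Q"
proof -
  consider us where "P = P' @ us" "us @ X # Q = X' # Q'" | us where "P' = P @ us" "X # Q = us @ X' # Q'"
    using assms unfolding append_eq_append_conv2 by blast
  then show thesis
  proof cases
    case 1
    then show thesis using that by (cases us) auto
  next
    case 2
    then show thesis using that by (cases us) auto
  qed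
qed

text \<open>If \<open>X\<close> were read before \<open>X'\<close>, its opening letter would have to
  be cancelled before \<open>X'\<close>, so a closing letter would survive in the word strictly
  between them; but none survives in the word after \<open>X\<close>... and that word begins with
  the part between.\<close>

lemma opens_unique:
  assumes "opens i lam T X" "opens i lam T X'" shows "X = X'"
proof -
  have no_overlap: False
    if "snd (box_sig i T (P @ X # R)) = 0" "fst (box_sig i T (R @ Y # Q)) = 0"
      "i + 1 \<in> T X" "i \<notin> T X" for P X R Y Q
    using that by (auto simp: sig_append bmul_def box_paren_def split: if_splits)
  obtain P Q where PQ: "revrow_boxes lam = P @ X # Q"
    "snd (box_sig i T P) = 0" "fst (box_sig i T Q) = 0"
    using assms(1) by (auto simp: opens_def pivot_def)
  obtain P' Q' where PQ': "revrow_boxes lam = P' @ X' # Q'"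
    "snd (box_sig i T P') = 0" "fst (box_sig i T Q') = 0"
    using assms(2) by (auto simp: opens_def pivot_def)
  have "P @ X # Q = P' @ X' # Q'" using PQ(1) PQ'(1) by simp
  then show ?thesis
  proof (cases rule: append_Cons_eq_cases)
    case (2 R)
    then show ?thesis using no_overlap[of P X R X' Q'] PQ PQ' assms by (simp add: opens_def)
  next
    case (3 R)
    then show ?thesis using no_overlap[of P' X' R X Q] PQ PQ' assms by (simp add: opens_def)
  qed
qed

lemma closes_unique:
  assumes "closes i lam T X" "closes i lam T X'" shows "X = X'"
proof -
  have no_overlap: False
    if "snd (box_sig i T (P @ X # R)) = 0" "fst (box_sig i T (R @ Y # Q)) = 0"
      "i \<in> T Y" "i + 1 \<notin> T Y" for P X R Y Q
    using that by (auto simp: sig_append bmul_def box_paren_def split: if_splits)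
  obtain P Q where PQ: "revrow_boxes lam = P @ X # Q"
    "snd (box_sig i T P) = 0" "fst (box_sig i T Q) = 0"
    using assms(1) by (auto simp: closes_def pivot_def)
  obtain P' Q' where PQ': "revrow_boxes lam = P' @ X' # Q'"
    "snd (box_sig i T P') = 0" "fst (box_sig i T Q') = 0"
    using assms(2) by (auto simp: closes_def pivot_def)
  have "P @ X # Q = P' @ X' # Q'" using PQ(1) PQ'(1) by simp
  then show ?thesis
  proof (cases rule: append_Cons_eq_cases)
    case (2 R)
    then show ?thesis using no_overlap[of P X R X' Q'] PQ PQ' assms by (simp add: closes_def)
  next
    case (3 R)
    then show ?thesis using no_overlap[of P' X' R X Q] PQ PQ' assms by (simp add: closes_def)
  qed
qed

lemma e_box_opens:
  assumes fin: "\<forall>b. finite (T b)" and act: "e_active lam i T"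
  shows "opens i lam T (e_box lam i T)"
proof -
  let ?w = "revrow lam T"
  define p where "p = (LEAST p. unpaired i ?w p \<and> ?w ! p = i + 1)"
  have p: "unpaired i ?w p" "?w ! p = i + 1"
    using act LeastI_ex[of "\<lambda>p. unpaired i ?w p \<and> ?w ! p = i + 1"]
    by (auto simp: e_active_def p_def)
  then have "p < length ?w" by (simp add: unpaired_def)
  then obtain P X Q L x R where PQ: "revrow_boxes lam = P @ X # Q" "box_letters T X = L @ x # R"
    "?w = (concat (map (box_letters T) P) @ L) @ x # R @ concat (map (box_letters T) Q)"
    "p = length (concat (map (box_letters T) P) @ L)" "boxed_revrow lam T ! p = (X, x)"
    by (rule revrow_nth_split)
  have x: "x = i + 1" using p(2) unfolding PQ(3) using PQ(4) by simp
  define U where "U = concat (map (box_letters T) P) @ L"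
  define V where "V = R @ concat (map (box_letters T) Q)"
  have w: "?w = U @ (i + 1) # V" and pU: "p = length U" using PQ x by (auto simp: U_def V_def)
  have V: "fst (sig (paren i) V) = 0" using p(1) unfolding w pU unpaired_opening_iff .
  \<comment> \<open>The last surviving opening letter of \<open>U\<close> would be an unpaired
    \<open>i + 1\<close> at a position smaller than \<open>p\<close>.\<close>
  have U: "snd (sig (paren i) U) = 0"
  proof (rule ccontr)
    assume "snd (sig (paren i) U) \<noteq> 0"
    then obtain u v where uv: "U = u @ (i + 1) # v" "sig (paren i) v = (0, 0)"
      using sig_paren_opening[of i U] by auto
    then have w': "?w = u @ (i + 1) # v @ (i + 1) # V" using w by simp
    have "unpaired i ?w (length u)"
      unfolding w' unpaired_opening_iff using uv V by (auto simp: sig_append bmul_def)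
    moreover have "?w ! length u = i + 1" unfolding w' by simp
    ultimately have "p \<le> length u" unfolding p_def by (intro Least_le) simp
    then show False using pU uv by simp
  qed
  have dec: "sorted_wrt (>) (L @ (i + 1) # R)" using box_letters_decreasing[of T X] PQ(2) x by simp
  have L: "sig (paren i) L = (0, 0)"
    using dec unfolding sorted_wrt_append by (intro sig_zero) (auto simp: paren_def)
  \<comment> \<open>An \<open>i\<close> in the same box would follow \<open>i + 1\<close> and close
    it, so that \<open>p\<close> would be paired.\<close>
  have "i \<notin> set R"
  proof
    assume "i \<in> set R"
    moreover have "i + 1 \<notin> set R" "sorted_wrt (>) R" using dec by (auto simp: sorted_wrt_append)
    ultimately have "sig (paren i) R = (1, 0)" using sig_paren_decreasing[of R i] by simp
    then show False using V by (auto simp: V_def sig_append bmul_def)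
  qed
  then have TX: "i + 1 \<in> T X" "i \<notin> T X"
  proof -
    have "finite (T X)" using fin by blast
    then have "T X = set (L @ (i + 1) # R)" unfolding PQ(2)[unfolded x, symmetric] by (simp add: box_letters_def)
    moreover have "i \<notin> set L" using dec by (auto simp: sorted_wrt_append)
    ultimately show "i + 1 \<in> T X" "i \<notin> T X" using \<open>i \<notin> set R\<close> by auto
  qed
  have "sig (paren i) R = (0, 0)"
    using sig_paren_decreasing[of R i] dec \<open>i \<notin> set R\<close> by (auto simp: sorted_wrt_append)
  moreover have "sig (paren i) (concat (map (box_letters T) l)) = box_sig i T l" for l
    using fin by (intro sig_concat_map sig_box_letters) blast
  ultimately have "snd (box_sig i T P) = 0" "fst (box_sig i T Q) = 0"
    using U V L by (simp_all add: U_def V_def sig_append)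
  moreover have "e_box lam i T = X" using PQ(5) by (simp add: e_box_def p_def)
  ultimately show ?thesis using PQ(1) TX by (auto simp: opens_def pivot_def)
qed

lemma f_box_closes:
  assumes fin: "\<forall>b. finite (T b)" and act: "f_active lam i T"
  shows "closes i lam T (f_box lam i T)"
proof -
  let ?w = "revrow lam T"
  define p where "p = (GREATEST p. unpaired i ?w p \<and> ?w ! p = i)"
  \<comment> \<open>\<open>GREATEST\<close> on natural numbers is meaningful only for a bounded
    nonempty set; the length of the word serves as the bound.\<close>
  have bound: "q \<le> length ?w" if "unpaired i ?w q \<and> ?w ! q = i" for q
    using that by (simp add: unpaired_def)
  have p: "unpaired i ?w p" "?w ! p = i"
    using act GreatestI_ex_nat[of "\<lambda>p. unpaired i ?w p \<and> ?w ! p = i" "length ?w"] bound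
    by (auto simp: f_active_def p_def)
  then have "p < length ?w" by (simp add: unpaired_def)
  then obtain P X Q L x R where PQ: "revrow_boxes lam = P @ X # Q" "box_letters T X = L @ x # R"
    "?w = (concat (map (box_letters T) P) @ L) @ x # R @ concat (map (box_letters T) Q)"
    "p = length (concat (map (box_letters T) P) @ L)" "boxed_revrow lam T ! p = (X, x)"
    by (rule revrow_nth_split)
  have x: "x = i" using p(2) unfolding PQ(3) using PQ(4) by simp
  define U where "U = concat (map (box_letters T) P) @ L"
  define V where "V = R @ concat (map (box_letters T) Q)"
  have w: "?w = U @ i # V" and pU: "p = length U" using PQ x by (auto simp: U_def V_def)
  have U: "snd (sig (paren i) U) = 0" using p(1) unfolding w pU unpaired_closing_iff .
  have V: "fst (sig (paren i) V) = 0"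
  proof (rule ccontr)
    assume "fst (sig (paren i) V) \<noteq> 0"
    then obtain u v where uv: "V = u @ i # v" "sig (paren i) u = (0, 0)"
      using sig_paren_closing[of i V] by auto
    then have w': "?w = (U @ i # u) @ i # v" using w by simp
    have "unpaired i ?w (length (U @ i # u))"
      unfolding w' unpaired_closing_iff using uv U by (auto simp: sig_append bmul_def)
    moreover have "?w ! length (U @ i # u) = i" unfolding w' by (simp add: nth_append)
    ultimately have "length (U @ i # u) \<le> p" unfolding p_def
      using bound by (intro Greatest_le_nat[where b = "length ?w"]) auto
    then show False using pU uv by simp
  qed
  have dec: "sorted_wrt (>) (L @ i # R)" using box_letters_decreasing[of T X] PQ(2) x by simp
  have R: "sig (paren i) R = (0, 0)"
    using dec unfolding sorted_wrt_append by (intro sig_zero) (auto simp: paren_def)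
  have "i + 1 \<notin> set L"
  proof
    assume "i + 1 \<in> set L"
    moreover have "i \<notin> set L" "sorted_wrt (>) L" using dec by (auto simp: sorted_wrt_append)
    ultimately have "sig (paren i) L = (0, 1)" using sig_paren_decreasing[of L i] by simp
    then show False using U by (auto simp: U_def sig_append bmul_def)
  qed
  then have TX: "i \<in> T X" "i + 1 \<notin> T X"
  proof -
    have "finite (T X)" using fin by blast
    then have "T X = set (L @ (i) # R)" unfolding PQ(2)[unfolded x, symmetric] by (simp add: box_letters_def)
    moreover have "i + 1 \<notin> set R" using dec by (auto simp: sorted_wrt_append)
    ultimately show "i \<in> T X" "i + 1 \<notin> T X" using \<open>i + 1 \<notin> set L\<close> by auto
  qed
  have "sig (paren i) L = (0, 0)"
    using sig_paren_decreasing[of L i] dec \<open>i + 1 \<notin> set L\<close> by (auto simp: sorted_wrt_append)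
  moreover have "sig (paren i) (concat (map (box_letters T) l)) = box_sig i T l" for l
    using fin by (intro sig_concat_map sig_box_letters) blast
  ultimately have "snd (box_sig i T P) = 0" "fst (box_sig i T Q) = 0"
    using U V R by (simp_all add: U_def V_def sig_append)
  moreover have "f_box lam i T = X" using PQ(5) by (simp add: f_box_def p_def)
  ultimately show ?thesis using PQ(1) TX by (auto simp: closes_def pivot_def)
qed

lemma e_active_iff:
  assumes "\<forall>b. finite (T b)"
  shows "e_active lam i T \<longleftrightarrow> 0 < snd (box_sig i T (revrow_boxes lam))"
proof
  assume "e_active lam i T"
  then have "opens i lam T (e_box lam i T)" using assms by (simp add: e_box_opens)
  then show "0 < snd (box_sig i T (revrow_boxes lam))"
    by (auto simp: opens_def pivot_def sig_append bmul_def box_paren_def)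
next
  assume "0 < snd (box_sig i T (revrow_boxes lam))"
  then obtain u v where uv: "revrow lam T = u @ (i + 1) # v" "sig (paren i) v = (0, 0)"
    using sig_paren_opening[of i "revrow lam T"] sig_revrow[OF assms, of i lam] by auto
  then have "unpaired i (revrow lam T) (length u)"
    using unpaired_opening_iff[of i u v] by simp
  then show "e_active lam i T" using uv by (auto simp: e_active_def)
qed

lemma f_active_iff:
  assumes "\<forall>b. finite (T b)"
  shows "f_active lam i T \<longleftrightarrow> 0 < fst (box_sig i T (revrow_boxes lam))"
proof
  assume "f_active lam i T"
  then have "closes i lam T (f_box lam i T)" using assms by (simp add: f_box_closes)
  then show "0 < fst (box_sig i T (revrow_boxes lam))"
    by (auto simp: closes_def pivot_def sig_append bmul_def box_paren_def)
next
  assume "0 < fst (box_sig i T (revrow_boxes lam))"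
  then obtain u v where uv: "revrow lam T = u @ i # v" "sig (paren i) u = (0, 0)"
    using sig_paren_closing[of i "revrow lam T"] sig_revrow[OF assms, of i lam] by auto
  then have "unpaired i (revrow lam T) (length u)"
    using unpaired_closing_iff[of i u v] by simp
  then show "f_active lam i T" using uv by (auto simp: f_active_def)
qed

text \<open>By uniqueness, any box found to have this property is the one selected by
  \<open>LEAST\<close>; later arguments never return to positions in the word.\<close>

lemma e_box_eqI:
  assumes "\<forall>b. finite (T b)" "opens i lam T X"
  shows "e_active lam i T" "e_box lam i T = X"
proof -
  show "e_active lam i T"
    using assms by (auto simp: e_active_iff opens_def pivot_def sig_append bmul_def box_paren_def)
  then show "e_box lam i T = X" using assms e_box_opens opens_unique by blast
qed

lemma f_box_eqI:
  assumes "\<forall>b. finite (T b)" "closes i lam T X"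
  shows "f_active lam i T" "f_box lam i T = X"
proof -
  show "f_active lam i T"
    using assms by (auto simp: f_active_iff closes_def pivot_def sig_append bmul_def box_paren_def)
  then show "f_box lam i T = X" using assms f_box_closes closes_unique by blast
qed

section \<open>Forbidden patterns\<close>

lemma hook_word_pattern:
  assumes "hook_word w" "j < k" "k < l" "l < length w" "w ! j < w ! k"
  shows "w ! k < w ! l"
proof -
  obtain m where m: "m \<in> {1..length w}" "sorted_wrt (\<ge>) (take m w)" "sorted_wrt (<) (drop (m - 1) w)"
    using assms(1) by (auto simp: hook_word_def)
  have "\<not> k < m"
    using m(2) assms by (fastforce simp: sorted_wrt_iff_nth_less)
  then have "drop (m - 1) w ! (k - (m - 1)) < drop (m - 1) w ! (l - (m - 1))"
    using m assms by (intro sorted_wrt_nth_less[OF m(3)]) auto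
  then show ?thesis using \<open>\<not> k < m\<close> assms m(1) by simp
qed

lemma hook_word_Cons:
  assumes "hook_word w" "hd w \<le> x" shows "hook_word (x # w)"
proof -
  obtain m where m: "m \<in> {1..length w}" "sorted_wrt (\<ge>) (take m w)" "sorted_wrt (<) (drop (m - 1) w)"
    using assms(1) by (auto simp: hook_word_def)
  obtain y w' where w: "w = y # w'" using m(1) by (cases w) auto
  obtain m' where m': "m = Suc m'" using m(1) by (cases m) auto
  have "sorted_wrt (\<ge>) (take (m + 1) (x # w))"
    using m(2) assms(2) by (auto simp: w m')
  moreover have "sorted_wrt (<) (drop (m + 1 - 1) (x # w))"
    using m(1,3) by (auto simp: m')
  moreover have "0 < x" using assms by (auto simp: hook_word_def w)
  ultimately show ?thesis
    using assms m(1) unfolding hook_word_def by (auto intro!: bexI[of _ "m + 1"])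
qed

lemma hook_word_append_decreasing:
  "sorted_wrt (\<ge>) xs \<Longrightarrow> hook_word ys \<Longrightarrow> \<forall>x\<in>set xs. hd ys \<le> x \<Longrightarrow> hook_word (xs @ ys)"
proof (induction xs)
  case (Cons x xs)
  then have "hook_word (xs @ ys)" by simp
  moreover have "hd (xs @ ys) \<le> x" using Cons.prems by (cases xs) auto
  ultimately show ?case by (simp add: hook_word_Cons)
qed simp

lemma hook_word_append_increasing:
  assumes "hook_word xs" "sorted_wrt (<) ys" "\<forall>y\<in>set ys. last xs < y"
  shows "hook_word (xs @ ys)"
proof -
  obtain m where m: "m \<in> {1..length xs}" "sorted_wrt (\<ge>) (take m xs)" "sorted_wrt (<) (drop (m - 1) xs)"
    using assms(1) by (auto simp: hook_word_def)
  define t where "t = drop (m - 1) xs"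
  have t: "t \<noteq> []" "last t = last xs" "sorted_wrt (<) t" using m by (auto simp: t_def)
  have "x \<le> last t" if "x \<in> set t" for x
    using that t(3) by (induction t) (auto split: if_splits intro: less_imp_le)
  then have "sorted_wrt (<) (t @ ys)"
    using assms(2,3) t by (fastforce simp: sorted_wrt_append)
  then have "sorted_wrt (<) (drop (m - 1) (xs @ ys))"
    using m(1) by (simp add: t_def)
  moreover have "sorted_wrt (\<ge>) (take m (xs @ ys))" using m by simp
  moreover have "0 < y" if "y \<in> set ys" for y using assms(3) that by fastforce
  ultimately show ?thesis
    using assms(1) m(1) unfolding hook_word_def by (auto intro!: bexI[of _ m])
qed

text \<open>If the first letter ascends to its neighbour, the condition on three letters makes the
  whole word strictly increasing; otherwise the first letter extends the descending part of the
  remaining hook word.\<close>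

lemma hook_word_iff_pattern:
  "hook_word w \<longleftrightarrow> w \<noteq> [] \<and> (\<forall>x\<in>set w. 0 < x) \<and>
     (\<forall>j k l. j < k \<longrightarrow> k < l \<longrightarrow> l < length w \<longrightarrow> w ! j < w ! k \<longrightarrow> w ! k < w ! l)"
    (is "_ \<longleftrightarrow> ?R w")
proof
  assume "hook_word w"
  then show "?R w" using hook_word_pattern by (auto simp: hook_word_def)
next
  assume "?R w"
  then show "hook_word w"
  proof (induction w)
    case (Cons x w)
    show ?case
    proof (cases "w = [] \<or> \<not> x < hd w")
      case True
      have "hook_word w" if "w \<noteq> []"
      proof (rule Cons.IH, intro conjI allI impI)
        fix j k l assume "j < k" "k < l" "l < length w" "w ! j < w ! k"
        then show "w ! k < w ! l"
          using Cons.prems[THEN conjunct2, THEN conjunct2, rule_format, of "Suc j" "Suc k" "Suc l"] by simp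
      qed (use that Cons.prems in auto)
      moreover have "hook_word [x]" using Cons.prems by (auto simp: hook_word_def)
      ultimately show ?thesis using True hook_word_Cons by fastforce
    next
      case False
      let ?w = "x # w"
      have *: "?w ! k < ?w ! l" if "j < k" "k < l" "l < length ?w" "?w ! j < ?w ! k" for j k l
        using that Cons.prems by blast
      have 1: "?w ! 0 < ?w ! k" if "0 < k" "k < length ?w" for k
      proof -
        have "?w ! 0 < ?w ! 1" using False by (cases w) auto
        moreover from this have "?w ! 1 < ?w ! k" if "1 < k" using *[of 0 1 k] that \<open>k < length ?w\<close> by simp
        ultimately show ?thesis using that by (cases "k = 1") auto
      qed
      have "sorted_wrt (<) ?w"
        unfolding sorted_wrt_iff_nth_less
      proof (intro allI impI)
        fix k l assume kl: "k < l" "l < length ?w"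
        show "?w ! k < ?w ! l"
        proof (cases k)
          case 0 then show ?thesis using 1 kl by blast
        next
          case (Suc k')
          then show ?thesis using kl 1[of k] *[of 0 k l] by fastforce
        qed
      qed
      then show ?thesis using Cons.prems unfolding hook_word_def
        by (intro conjI bexI[of _ 1]) auto
    qed
  qed simp
qed

lemma hook_word_drop:
  assumes "hook_word w" "m < length w" shows "hook_word (drop m w)"
  unfolding hook_word_iff_pattern
proof (intro conjI allI impI)
  fix j k l assume "j < k" "k < l" "l < length (drop m w)" "drop m w ! j < drop m w ! k"
  then show "drop m w ! k < drop m w ! l"
    using hook_word_pattern[OF assms(1), of "m + j" "m + k" "m + l"] by simp
qed (use assms in \<open>auto simp: hook_word_def dest: in_set_dropD\<close>)

lemma hook_word_take:
  assumes "hook_word w" "0 < m" shows "hook_word (take m w)"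
  using assms unfolding hook_word_iff_pattern by (auto dest: in_set_takeD)

section \<open>Longest hook subwords of two adjacent rows\<close>

lemma subseq_indices:
  assumes "subseq xs ys"
  obtains f where "\<And>i. i < length xs \<Longrightarrow> f i < length ys" "\<And>i. i < length xs \<Longrightarrow> xs ! i = ys ! f i"
    "\<And>i j. i < j \<Longrightarrow> j < length xs \<Longrightarrow> f i < f j"
proof -
  have "\<exists>f. (\<forall>i<length xs. f i < length ys \<and> xs ! i = ys ! f i) \<and>
    (\<forall>i j. i < j \<longrightarrow> j < length xs \<longrightarrow> f i < f j)"
    using assms
  proof induction
    case (list_emb_Cons xs ys y)
    then obtain f where "\<forall>i<length xs. f i < length ys \<and> xs ! i = ys ! f i"
      "\<forall>i j. i < j \<longrightarrow> j < length xs \<longrightarrow> f i < f j" by blast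
    then show ?case by (intro exI[of _ "\<lambda>i. Suc (f i)"]) auto
  next
    case (list_emb_Cons2 x y xs ys)
    then obtain f where f: "\<forall>i<length xs. f i < length ys \<and> xs ! i = ys ! f i"
      "\<forall>i j. i < j \<longrightarrow> j < length xs \<longrightarrow> f i < f j" by blast
    show ?case
      by (intro exI[of _ "\<lambda>i. case i of 0 \<Rightarrow> 0 | Suc i \<Rightarrow> Suc (f i)"])
        (use f list_emb_Cons2 in \<open>auto simp: less_Suc_eq_0_disj split: nat.splits\<close>)
  qed auto
  then show thesis using that by blast
qed

text \<open>Strictly increasing indices advance by at least one per step. This converts lengths of
  subwords into bounds on positions in the full word.\<close>

lemma increasing_indices_bound:
  fixes f :: "nat \<Rightarrow> nat"
  assumes "\<And>i j. i < j \<Longrightarrow> j < m \<Longrightarrow> f i < f j" "k + d < m"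
  shows "f k + d \<le> f (k + d)"
  using assms(2) by (induction d) (auto simp: Suc_le_eq intro: assms(1) le_less_trans)

text \<open>
  The three conditions on \<open>u\<close> and \<open>v\<close> are \<open>diagonal\<close>, \<open>lower\<close> and \<open>upper\<close> below: in the shifted
  diagram the letter \<open>v ! j\<close> lies under \<open>u ! Suc j\<close>.
\<close>

lemma max_hook_subword_append_iff:
  assumes hook: "hook_word u" "hook_word v" and len: "length v < length u"
  shows "max_hook_subword u (v @ u) \<longleftrightarrow>
    (\<forall>j<length v. v ! j < u ! 0) \<and>
    (\<forall>j k. j < k \<longrightarrow> k < length v \<longrightarrow> \<not> (u ! Suc j \<le> v ! k \<and> v ! k \<le> v ! j)) \<and>
    (\<forall>a j. a \<le> j \<longrightarrow> j < length v \<longrightarrow> \<not> (v ! j < u ! a \<and> u ! a < u ! Suc j))"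
    (is "_ \<longleftrightarrow> ?A \<and> ?B \<and> ?C")
proof
  assume max: "max_hook_subword u (v @ u)"
  then have max: "length s \<le> length u" if "hook_word s" "subseq s (v @ u)" for s
    using that by (auto simp: max_hook_subword_def)
  note patu = hook_word_pattern[OF hook(1)] and patv = hook_word_pattern[OF hook(2)]
  \<comment> \<open>Each condition is necessary because its failure yields a hook subword with one
    letter more than \<open>u\<close>. Here this is \<open>v ! j\<close> followed by all of
    \<open>u\<close>.\<close>
  have ?A
  proof (intro allI impI, rule ccontr)
    fix j assume j: "j < length v" "\<not> v ! j < u ! 0"
    have "u \<noteq> []" using len by auto
    then have "hook_word (v ! j # u)"
      using hook(1) j by (intro hook_word_Cons) (auto simp: hd_conv_nth)
    moreover have "subseq ([v ! j] @ u) (v @ u)"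
      using j by (intro list_emb_append_mono) (auto simp: subseq_singleton_left)
    ultimately show False using max[of "[v ! j] @ u"] by simp
  qed
  moreover have ?B
  proof (intro allI impI notI)
    fix j k assume jk: "j < k" "k < length v" "u ! Suc j \<le> v ! k \<and> v ! k \<le> v ! j"
    \<comment> \<open>The \<open>j + 2\<close> letters of \<open>?xs\<close> descend and replace the
      first \<open>j + 1\<close> letters of \<open>u\<close>.\<close>
    let ?xs = "take (Suc j) v @ [v ! k]" and ?ys = "drop (Suc j) u"
    have vj: "v ! j \<le> v ! a" if "a \<le> j" for a
      using patv[of a j k] that jk by (cases "a = j") fastforce+
    have dec: "v ! b \<le> v ! a" if "a < b" "b \<le> j" for a b
      using patv[of a b j] patv[of b j k] vj[of a] vj[of b] that jk by (cases "b = j") fastforce+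
    have "sorted_wrt (\<ge>) (take (Suc j) v)"
      using dec jk by (auto simp: sorted_wrt_iff_nth_less)
    moreover have vk: "\<forall>x\<in>set (take (Suc j) v). v ! k \<le> x"
      using vj jk by (auto simp: in_set_conv_nth) (metis le_trans less_Suc_eq_le)
    ultimately have "sorted_wrt (\<ge>) ?xs" by (auto simp: sorted_wrt_append)
    moreover have "hook_word ?ys" using hook(1) jk len by (intro hook_word_drop) auto
    moreover have "hd ?ys = u ! Suc j" using jk len by (simp add: hd_drop_conv_nth)
    ultimately have "hook_word (?xs @ ?ys)"
      using jk vk by (intro hook_word_append_decreasing) auto
    moreover have "v ! k \<in> set (drop (Suc j) v)"
      using jk by (auto simp: in_set_conv_nth intro!: exI[of _ "k - Suc j"])
    then have "subseq ?xs (take (Suc j) v @ drop (Suc j) v)"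
      by (intro list_emb_append_mono) (auto simp: subseq_singleton_left)
    then have "subseq (?xs @ ?ys) (v @ u)"
      by (intro list_emb_append_mono) (auto intro: suffix_imp_subseq suffix_drop)
    ultimately have "length (?xs @ ?ys) \<le> length u" by (rule max)
    then show False using jk len by simp
  qed
  moreover have ?C
  proof (intro allI impI notI)
    fix a j assume aj: "a \<le> j" "j < length v" "v ! j < u ! a \<and> u ! a < u ! Suc j"
    \<comment> \<open>The surplus letter is now \<open>u ! a\<close>: the first \<open>j + 1\<close>
      letters of \<open>v\<close> take the place of those of \<open>u\<close>, and from
      \<open>v ! j\<close> through \<open>u ! a\<close> into the rest of \<open>u\<close> the word
      ascends.\<close>
    let ?xs = "take (Suc j) v" and ?ys = "u ! a # drop (Suc j) u"
    have ua: "u ! a < u ! k" if "Suc j \<le> k" "k < length u" for k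
    proof (cases "k = Suc j")
      case False
      then show ?thesis using patu[of a "Suc j" k] that aj by simp
    qed (use aj in simp)
    have inc: "u ! k < u ! l" if "Suc j \<le> k" "k < l" "l < length u" for k l
      using patu[of a k l] ua[of k] that aj by auto
    have "sorted_wrt (<) (drop (Suc j) u)"
      using inc by (auto simp: sorted_wrt_iff_nth_less)
    moreover have "\<forall>y\<in>set (drop (Suc j) u). u ! a < y"
      using ua by (auto simp: in_set_conv_nth)
    moreover have "hook_word ?xs" using hook(2) by (intro hook_word_take) auto
    moreover have "last ?xs = v ! j" using aj by (simp add: take_Suc_conv_app_nth)
    ultimately have "hook_word (?xs @ ?ys)"
      using aj by (intro hook_word_append_increasing) auto
    moreover have "u ! a \<in> set (take (Suc j) u)"
      using aj len by (auto simp: in_set_conv_nth intro!: exI[of _ a])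
    then have "subseq ([u ! a] @ drop (Suc j) u) (take (Suc j) u @ drop (Suc j) u)"
      by (intro list_emb_append_mono) (auto simp: subseq_singleton_left)
    then have "subseq (?xs @ ?ys) (v @ u)"
      by (intro list_emb_append_mono) (auto intro: prefix_imp_subseq take_is_prefix)
    ultimately have "length (?xs @ ?ys) \<le> length u" by (rule max)
    then show False using aj len by simp
  qed
  ultimately show "?A \<and> ?B \<and> ?C" by blast
next
  assume R: "?A \<and> ?B \<and> ?C"
  note patu = hook_word_pattern[OF hook(1)] and patv = hook_word_pattern[OF hook(2)]
  have "length s \<le> length u" if s: "hook_word s" "subseq s (v @ u)" for s
  proof (rule ccontr)
    assume long: "\<not> length s \<le> length u"
    note pats = hook_word_pattern[OF s(1)]
    obtain s1 s2 where s12: "s = s1 @ s2" "subseq s1 v" "subseq s2 u"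
      using s(2) by (auto elim: subseq_appendE)
    obtain f where f: "\<And>i. i < length s1 \<Longrightarrow> f i < length v"
      "\<And>i. i < length s1 \<Longrightarrow> s1 ! i = v ! f i"
      "\<And>i j. i < j \<Longrightarrow> j < length s1 \<Longrightarrow> f i < f j"
      using subseq_indices[OF s12(2)] by blast
    obtain g where g: "\<And>i. i < length s2 \<Longrightarrow> g i < length u"
      "\<And>i. i < length s2 \<Longrightarrow> s2 ! i = u ! g i"
      "\<And>i j. i < j \<Longrightarrow> j < length s2 \<Longrightarrow> g i < g j"
      using subseq_indices[OF s12(3)] by blast
    have le: "length s1 \<le> length v" "length s2 \<le> length u"
      using s12 by (auto dest: list_emb_length)
    define t where "t = length s1 - 1"
    have t: "length s1 = Suc t" and s2: "0 < length s2" using long le len s12(1) by (auto simp: t_def)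
    \<comment> \<open>\<open>k\<close> is the position in \<open>v\<close> of the last letter that
      \<open>s\<close> takes from there, and \<open>b\<close> the position in \<open>u\<close> of
      the first letter that it takes from \<open>u\<close>.\<close>
    define k b where "k = f t" and "b = g 0"
    have k: "k < length v" "t \<le> k" "s ! t = v ! k"
      using f(1)[of t] f(2)[of t] increasing_indices_bound[of "Suc t" f 0 t] f(3)
      by (auto simp: k_def t s12(1) nth_append)
    have b: "b < length u" "s ! Suc t = u ! b"
      using g(1)[of 0] g(2)[of 0] s2 by (auto simp: b_def s12(1) nth_append t)
    have "b + (length s2 - 1) < length u"
      using increasing_indices_bound[of "length s2" g 0 "length s2 - 1"] g(3) g(1)[of "length s2 - 1"] s2
      by (auto simp: b_def intro: le_less_trans)
    \<comment> \<open>The letters of \<open>s2\<close> fit into \<open>u\<close> from position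
      \<open>b\<close> on, so a word longer than \<open>u\<close> must take more than
      \<open>b\<close> letters from \<open>v\<close>.\<close>
    then have tb: "b \<le> t" using long t s12(1) by simp
    show False
    proof (cases "u ! b \<le> v ! k")
      case True
      show False
      proof (cases b)
        case 0
        then show False using R True k by fastforce
      next
        case (Suc j)
        obtain t' where t': "t = Suc t'" using tb Suc by (cases t) auto
        define k' where "k' = f t'"
        have k': "k' < k" "t' \<le> k'" "s ! t' = v ! k'"
          using f(3)[of t' t] f(2)[of t'] increasing_indices_bound[of "Suc t" f 0 t'] f(3)
          by (auto simp: k_def k'_def t s12(1) nth_append t')
        have "v ! k \<le> v ! k'"
          using pats[of t' t "Suc t"] k' k b True t t' s2 s12(1) by fastforce
        moreover have "v ! k' \<le> v ! j" if "j < k'"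
          using patv[of j k' k] calculation k' k(1) that by fastforce
        moreover have "j \<le> k'" using tb Suc t' k'(2) by simp
        ultimately have "v ! k \<le> v ! j" by (cases "j = k'") auto
        then show False using R True Suc \<open>j \<le> k'\<close> k'(1) k(1) by fastforce
      qed
    next
      case False
      have two: "Suc 0 < length s2" using long t s12(1) le k(1,2) len by (cases "length s2") auto
      define b' where "b' = g 1"
      have b': "b < b'" "b' < length u" "s ! Suc (Suc t) = u ! b'"
        using g(3)[of 0 1] g(1)[of 1] g(2)[of 1] two by (auto simp: b_def b'_def s12(1) nth_append t)
      have ub': "u ! b < u ! b'"
        using pats[of t "Suc t" "Suc (Suc t)"] False k b b' two t s12(1) by simp
      show False
      proof (cases "b' \<le> Suc k")
        case True
        then have "u ! b < u ! Suc k"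
          using patu[of b b' "Suc k"] b' ub' k(1) len by (cases "b' = Suc k") auto
        then show False using R False True b' k(1) by fastforce
      next
        \<comment> \<open>With the second letter of \<open>s2\<close> beyond position
          \<open>Suc k\<close>, too few positions of \<open>u\<close> remain for \<open>s\<close> to
          be longer than \<open>u\<close>.\<close>
        case b'k: False
        have "g 1 + (length s2 - 2) \<le> g (1 + (length s2 - 2))"
          by (rule increasing_indices_bound[of "length s2"]) (use g(3) two in auto)
        also have "\<dots> < length u" using two by (intro g(1)) simp
        finally have "b' + (length s2 - 2) < length u" by (simp add: b'_def)
        then show False using long t s12(1) b'k k(2) two by simp
      qed
    qed
  qed
  then show "max_hook_subword u (v @ u)"
    using hook by (auto simp: max_hook_subword_def)
qed

section \<open>Forbidden patterns in the shifted diagram\<close>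

lemma SD_iff: "(r, c) \<in> SD lam \<longleftrightarrow> 1 \<le> r \<and> r \<le> length lam \<and> r \<le> c \<and> c < r + lam ! (r - 1)"
proof
  assume "1 \<le> r \<and> r \<le> length lam \<and> r \<le> c \<and> c < r + lam ! (r - 1)"
  then show "(r, c) \<in> SD lam" unfolding SD_def by (intro CollectI exI[of _ r] exI[of _ "c - r + 1"]) auto
qed (auto simp: SD_def)

lemma SD_above:
  assumes "strict_partition lam" "(Suc r, c) \<in> SD lam" "r \<noteq> 0" shows "(r, c) \<in> SD lam"
proof -
  have "lam ! r < lam ! (r - 1)"
    using assms by (auto simp: SD_iff strict_partition_def sorted_wrt_iff_nth_less)
  then show ?thesis using assms by (auto simp: SD_iff)
qed

text \<open>A pattern is a set of pairs of a box and a letter, and it occurs in a filling if it is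
  contained in the graph \<open>Sigma UNIV T\<close>. Occurrence is then monotone in
  \<open>T\<close>, and one can ask which letter a pattern uses in a given box. The diagram need not
  be mentioned in the clauses because fillings are empty outside it.\<close>

inductive bad_pattern :: "(box \<times> nat) set \<Rightarrow> bool" where
  row: "j < k \<Longrightarrow> k < l \<Longrightarrow> x < y \<Longrightarrow> z \<le> y \<Longrightarrow>
    bad_pattern {((r, j), x), ((r, k), y), ((r, l), z)}"
| diagonal: "x \<le> y \<Longrightarrow> bad_pattern {((r, r), x), ((Suc r, d), y)}"
| lower: "c < d \<Longrightarrow> x \<le> y \<Longrightarrow> y \<le> z \<Longrightarrow>
    bad_pattern {((r, c), x), ((Suc r, d), y), ((Suc r, c), z)}"
| upper: "a < c \<Longrightarrow> y < x \<Longrightarrow> x < z \<Longrightarrow>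
    bad_pattern {((r, a), x), ((r, c), z), ((Suc r, c), y)}"

definition avoids :: "(box \<Rightarrow> nat set) \<Rightarrow> bool" where
  "avoids T \<longleftrightarrow> (\<forall>V. bad_pattern V \<longrightarrow> \<not> V \<subseteq> Sigma UNIV T)"

lemma avoids_iff:
  "avoids T \<longleftrightarrow>
     (\<forall>r j k l x y z. j < k \<longrightarrow> k < l \<longrightarrow> x < y \<longrightarrow> x \<in> T (r, j) \<longrightarrow> y \<in> T (r, k) \<longrightarrow> z \<in> T (r, l) \<longrightarrow> y < z) \<and>
     (\<forall>r d x y. x \<in> T (r, r) \<longrightarrow> y \<in> T (Suc r, d) \<longrightarrow> y < x) \<and>
     (\<forall>r c d x y z. c < d \<longrightarrow> x \<le> y \<longrightarrow> x \<in> T (r, c) \<longrightarrow> y \<in> T (Suc r, d) \<longrightarrow> z \<in> T (Suc r, c) \<longrightarrow> z < y) \<and>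
     (\<forall>r a c x y z. a < c \<longrightarrow> y < x \<longrightarrow> x \<in> T (r, a) \<longrightarrow> z \<in> T (r, c) \<longrightarrow> y \<in> T (Suc r, c) \<longrightarrow> z \<le> x)"
    (is "_ \<longleftrightarrow> ?R")
proof
  assume av: "avoids T"
  have no: "\<not> V \<subseteq> Sigma UNIV T" if "bad_pattern V" for V using av that by (simp add: avoids_def)
  show ?R
  proof (intro conjI allI impI)
    fix r j k l x y z assume "j < k" "k < l" "x < y" "x \<in> T (r, j)" "y \<in> T (r, k)" "z \<in> T (r, l)"
    then show "y < z" using no[OF bad_pattern.row[of j k l x y z r]] by (cases "y < z") auto
  next
    fix r d x y assume "x \<in> T (r, r)" "y \<in> T (Suc r, d)"
    then show "y < x" using no[OF bad_pattern.diagonal[of x y r d]] by (cases "y < x") auto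
  next
    fix r c d x y z assume "c < d" "x \<le> y" "x \<in> T (r, c)" "y \<in> T (Suc r, d)" "z \<in> T (Suc r, c)"
    then show "z < y" using no[OF bad_pattern.lower[of c d x y z r]] by (cases "z < y") auto
  next
    fix r a c x y z assume "a < c" "y < x" "x \<in> T (r, a)" "z \<in> T (r, c)" "y \<in> T (Suc r, c)"
    then show "z \<le> x" using no[OF bad_pattern.upper[of a c y x z r]] by (cases "z \<le> x") auto
  qed
next
  assume R: ?R
  have R1: "y < z" if "j < k" "k < l" "x < y" "x \<in> T (r, j)" "y \<in> T (r, k)" "z \<in> T (r, l)"
    for j k l x y r z by (rule R[THEN conjunct1, rule_format]) (rule that)+
  have R2: "y < x" if "x \<in> T (r, r)" "y \<in> T (Suc r, d)" for x r y d
    by (rule R[THEN conjunct2, THEN conjunct1, rule_format]) (rule that)+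
  have R3: "z < y" if "c < d" "x \<le> y" "x \<in> T (r, c)" "y \<in> T (Suc r, d)" "z \<in> T (Suc r, c)"
    for c d x y r z
    by (rule R[THEN conjunct2, THEN conjunct2, THEN conjunct1, rule_format]) (rule that)+
  have R4: "z \<le> x" if "a < c" "y < x" "x \<in> T (r, a)" "z \<in> T (r, c)" "y \<in> T (Suc r, c)"
    for a c y x r z
    by (rule R[THEN conjunct2, THEN conjunct2, THEN conjunct2, rule_format]) (rule that)+
  have "\<not> V \<subseteq> Sigma UNIV T" if "bad_pattern V" for V
    using that
  proof cases
    case (row j k l x y z r)
    then show ?thesis using R1[of j k l x y r z] by auto
  next
    case (diagonal x y r d)
    then show ?thesis using R2[of x r y d] by auto
  next
    case (lower c d x y z r)
    then show ?thesis using R3[of c d x y r z] by auto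
  next
    case (upper a c y x z r)
    then show ?thesis using R4[of a c y x r z] by auto
  qed
  then show "avoids T" by (simp add: avoids_def)
qed

text \<open>A single-valued tableau is viewed as a filling by singletons, and word positions become
  columns: position \<open>i\<close> of row \<open>r\<close> is column \<open>r + i\<close>. The row
  pattern gives the hook words; the other three patterns are the conditions for the upper of two
  rows to be a longest hook subword.\<close>

lemma dec_tableau_iff:
  assumes lam: "strict_partition lam"
  shows "dec_tableau lam D \<longleftrightarrow> D \<in> SD lam \<rightarrow>\<^sub>E {0<..} \<and> avoids (\<lambda>b. if b \<in> SD lam then {D b} else {})"
proof (cases "D \<in> SD lam \<rightarrow>\<^sub>E {0<..}")
  case True
  let ?w = "row_word lam D"
  have len: "length (?w r) = lam ! (r - 1)" for r by (simp add: row_word_def)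
  have nth: "?w r ! i = D (r, r + i)" if "i < lam ! (r - 1)" for r i
    using that by (simp add: row_word_def)
  have pos: "0 < lam ! (r - 1)" if "r \<in> {1..length lam}" for r
    using that lam by (auto simp: strict_partition_def)
  have less: "lam ! r < lam ! (r - 1)" if "r \<in> {1..<length lam}" for r
    using that lam by (auto simp: strict_partition_def sorted_wrt_iff_nth_less)
  have hook: "hook_word (?w r) \<longleftrightarrow> (\<forall>j k l. (r, j) \<in> SD lam \<longrightarrow> (r, k) \<in> SD lam \<longrightarrow> (r, l) \<in> SD lam \<longrightarrow>
      j < k \<longrightarrow> k < l \<longrightarrow> D (r, j) < D (r, k) \<longrightarrow> D (r, k) < D (r, l))"
    (is "_ \<longleftrightarrow> ?H") if r: "r \<in> {1..length lam}" for r
  proof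
    assume h: "hook_word (?w r)"
    show ?H
    proof (intro allI impI)
      fix j k l assume jkl: "(r, j) \<in> SD lam" "(r, k) \<in> SD lam" "(r, l) \<in> SD lam"
        "j < k" "k < l" "D (r, j) < D (r, k)"
      then have "j - r < k - r" "k - r < l - r" "l - r < lam ! (r - 1)" "r \<le> j"
        by (auto simp: SD_iff)
      then show "D (r, k) < D (r, l)"
        using hook_word_pattern[OF h, of "j - r" "k - r" "l - r"] jkl by (simp add: len nth)
    qed
  next
    assume H: ?H
    show "hook_word (?w r)"
      unfolding hook_word_iff_pattern
    proof (intro conjI allI impI)
      show "?w r \<noteq> []" using pos[OF r] len[of r] by auto
      have "D (r, r + i) \<in> {0<..}" if "i < lam ! (r - 1)" for i
        by (rule PiE_mem[OF True]) (use that r in \<open>auto simp: SD_iff\<close>)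
      then show "\<forall>x\<in>set (?w r). 0 < x" by (auto simp: in_set_conv_nth len nth)
      fix j k l assume "j < k" "k < l" "l < length (?w r)" "?w r ! j < ?w r ! k"
      then show "?w r ! k < ?w r ! l"
        using H[rule_format, of "r + j" "r + k" "r + l"] r by (simp add: SD_iff len nth)
    qed
  qed
  have max: "max_hook_subword (?w r) (?w (r + 1) @ ?w r) \<longleftrightarrow>
      (\<forall>d. (Suc r, d) \<in> SD lam \<longrightarrow> D (Suc r, d) < D (r, r)) \<and>
      (\<forall>c d. (r, c) \<in> SD lam \<longrightarrow> (Suc r, c) \<in> SD lam \<longrightarrow> (Suc r, d) \<in> SD lam \<longrightarrow> c < d \<longrightarrow>
         \<not> (D (r, c) \<le> D (Suc r, d) \<and> D (Suc r, d) \<le> D (Suc r, c))) \<and>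
      (\<forall>a c. (r, a) \<in> SD lam \<longrightarrow> (r, c) \<in> SD lam \<longrightarrow> (Suc r, c) \<in> SD lam \<longrightarrow> a < c \<longrightarrow>
         \<not> (D (Suc r, c) < D (r, a) \<and> D (r, a) < D (r, c)))"
    (is "_ \<longleftrightarrow> ?A \<and> ?B \<and> ?C")
    if r: "r \<in> {1..<length lam}" and h: "hook_word (?w r)" "hook_word (?w (Suc r))" for r
  proof -
    let ?u = "?w r" and ?v = "?w (Suc r)"
    have lens: "length ?v < length ?u" using less[OF r] by (simp add: len)
    have q: "lam ! r < lam ! (r - 1)" using less[OF r] .
    have u0: "?u ! 0 = D (r, r)" using q nth[of 0 r] by simp
    have u: "?u ! Suc j = D (r, Suc r + j)" if "j < lam ! r" for j using that q nth[of "Suc j" r] by simp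
    have ua: "?u ! a = D (r, r + a)" if "a < lam ! r" for a using that q nth[of a r] by simp
    have v: "?v ! j = D (Suc r, Suc r + j)" if "j < lam ! r" for j using that nth[of j "Suc r"] by simp
    have SDv: "(Suc r, d) \<in> SD lam \<longleftrightarrow> Suc r \<le> d \<and> d < Suc r + lam ! r" for d
      using r by (auto simp: SD_iff)
    have SDu: "(r, d) \<in> SD lam \<longleftrightarrow> r \<le> d \<and> d < r + lam ! (r - 1)" for d
      using r by (auto simp: SD_iff)
    have lenv: "length ?v = lam ! r" by (simp add: len)
    have SDvE: "\<exists>j<lam ! r. d = Suc r + j" if "(Suc r, d) \<in> SD lam" for d
      using that unfolding SDv by (intro exI[of _ "d - Suc r"]) auto
    have SDuE: "\<exists>j<lam ! (r - 1). d = r + j" if "(r, d) \<in> SD lam" for d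
      using that unfolding SDu by (intro exI[of _ "d - r"]) auto
    have A: "(\<forall>j<length ?v. ?v ! j < ?u ! 0) \<longleftrightarrow> ?A"
    proof
      assume *: "\<forall>j<length ?v. ?v ! j < ?u ! 0"
      show ?A
      proof (intro allI impI)
        fix d assume "(Suc r, d) \<in> SD lam"
        then obtain j where "d = Suc r + j" "j < lam ! r" using SDvE by blast
        then show "D (Suc r, d) < D (r, r)"
          using *[rule_format, of j] v[of j] u0 by (simp add: lenv)
      qed
    next
      assume *: ?A
      show "\<forall>j<length ?v. ?v ! j < ?u ! 0"
      proof (intro allI impI)
        fix j assume "j < length ?v"
        then show "?v ! j < ?u ! 0"
          using *[rule_format, of "Suc r + j"] v[of j] u0 by (simp add: SDv lenv)
      qed
    qed
    have B: "(\<forall>j k. j < k \<longrightarrow> k < length ?v \<longrightarrow> \<not> (?u ! Suc j \<le> ?v ! k \<and> ?v ! k \<le> ?v ! j)) \<longleftrightarrow> ?B"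
    proof
      assume *: "\<forall>j k. j < k \<longrightarrow> k < length ?v \<longrightarrow> \<not> (?u ! Suc j \<le> ?v ! k \<and> ?v ! k \<le> ?v ! j)"
      show ?B
      proof (intro allI impI)
        fix c d assume "(r, c) \<in> SD lam" and SDs: "(Suc r, c) \<in> SD lam" "(Suc r, d) \<in> SD lam" "c < d"
        then obtain j k where "c = Suc r + j" "j < lam ! r" "d = Suc r + k" "k < lam ! r"
          using SDvE by blast
        then show "\<not> (D (r, c) \<le> D (Suc r, d) \<and> D (Suc r, d) \<le> D (Suc r, c))"
          using *[rule_format, of j k] v[of j] v[of k] u[of j] SDs(3) by (simp add: lenv)
      qed
    next
      assume *: ?B
      show "\<forall>j k. j < k \<longrightarrow> k < length ?v \<longrightarrow> \<not> (?u ! Suc j \<le> ?v ! k \<and> ?v ! k \<le> ?v ! j)"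
      proof (intro allI impI)
        fix j k assume "j < k" "k < length ?v"
        then show "\<not> (?u ! Suc j \<le> ?v ! k \<and> ?v ! k \<le> ?v ! j)"
          using *[rule_format, of "Suc r + j" "Suc r + k"] v[of j] v[of k] u[of j] q
          by (simp add: SDv SDu lenv)
      qed
    qed
    have C: "(\<forall>a j. a \<le> j \<longrightarrow> j < length ?v \<longrightarrow> \<not> (?v ! j < ?u ! a \<and> ?u ! a < ?u ! Suc j)) \<longleftrightarrow> ?C"
    proof
      assume *: "\<forall>a j. a \<le> j \<longrightarrow> j < length ?v \<longrightarrow> \<not> (?v ! j < ?u ! a \<and> ?u ! a < ?u ! Suc j)"
      show ?C
      proof (intro allI impI)
        fix a c assume SDs: "(r, a) \<in> SD lam" "(r, c) \<in> SD lam" "(Suc r, c) \<in> SD lam" "a < c"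
        then obtain i j where "a = r + i" "c = Suc r + j" "j < lam ! r"
          using SDvE SDuE by meson
        then show "\<not> (D (Suc r, c) < D (r, a) \<and> D (r, a) < D (r, c))"
          using *[rule_format, of i j] v[of j] u[of j] ua[of i] SDs(4) by (simp add: lenv)
      qed
    next
      assume *: ?C
      show "\<forall>a j. a \<le> j \<longrightarrow> j < length ?v \<longrightarrow> \<not> (?v ! j < ?u ! a \<and> ?u ! a < ?u ! Suc j)"
      proof (intro allI impI)
        fix a j assume "a \<le> j" "j < length ?v"
        then show "\<not> (?v ! j < ?u ! a \<and> ?u ! a < ?u ! Suc j)"
          using *[rule_format, of "r + a" "Suc r + j"] v[of j] u[of j] ua[of a] q
          by (simp add: SDv SDu lenv)
      qed
    qed
    show ?thesis
      using max_hook_subword_append_iff[OF h lens] unfolding A B C by simp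
  qed
  let ?T = "\<lambda>b. if b \<in> SD lam then {D b} else {}"
  have mem: "x \<in> ?T b \<longleftrightarrow> b \<in> SD lam \<and> x = D b" for x b by simp
  have row_range: "r \<in> {1..length lam}" if "(r, c) \<in> SD lam" for r c
    using that by (simp add: SD_iff)
  have rows_range: "r \<in> {1..<length lam}" if "(r, c) \<in> SD lam" "(Suc r, d) \<in> SD lam" for r c d
    using that by (simp add: SD_iff)
  have diag: "(r, r) \<in> SD lam" if "r \<in> {1..length lam}" for r
    using that pos[OF that] by (simp add: SD_iff)
  show ?thesis
  proof
    assume dec: "dec_tableau lam D"
    have h: "hook_word (?w r)" if "r \<in> {1..length lam}" for r
      using that dec by (simp add: dec_tableau_def)
    have m: "max_hook_subword (?w r) (?w (r + 1) @ ?w r)" if "r \<in> {1..<length lam}" for r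
      using that dec by (simp add: dec_tableau_def)
    have mm: "r \<in> {1..<length lam} \<Longrightarrow>
      (\<forall>d. (Suc r, d) \<in> SD lam \<longrightarrow> D (Suc r, d) < D (r, r)) \<and>
      (\<forall>c d. (r, c) \<in> SD lam \<longrightarrow> (Suc r, c) \<in> SD lam \<longrightarrow> (Suc r, d) \<in> SD lam \<longrightarrow> c < d \<longrightarrow>
         \<not> (D (r, c) \<le> D (Suc r, d) \<and> D (Suc r, d) \<le> D (Suc r, c))) \<and>
      (\<forall>a c. (r, a) \<in> SD lam \<longrightarrow> (r, c) \<in> SD lam \<longrightarrow> (Suc r, c) \<in> SD lam \<longrightarrow> a < c \<longrightarrow>
         \<not> (D (Suc r, c) < D (r, a) \<and> D (r, a) < D (r, c)))" for r
      using m[of r] max[of r] h[of r] h[of "Suc r"] by auto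
    have "avoids ?T"
      unfolding avoids_iff mem
    proof (intro conjI allI impI)
      fix r j k l x y z :: nat
      assume "j < k" "k < l" "x < y" "(r, j) \<in> SD lam \<and> x = D (r, j)"
        "(r, k) \<in> SD lam \<and> y = D (r, k)" "(r, l) \<in> SD lam \<and> z = D (r, l)"
      then show "y < z" using h[of r] hook[of r] row_range[of r j] by blast
    next
      fix r d x y :: nat
      assume "(r, r) \<in> SD lam \<and> x = D (r, r)" "(Suc r, d) \<in> SD lam \<and> y = D (Suc r, d)"
      then show "y < x" using mm[of r] rows_range[of r r d] by blast
    next
      fix r c d x y z :: nat
      assume "c < d" "x \<le> y" "(r, c) \<in> SD lam \<and> x = D (r, c)"
        "(Suc r, d) \<in> SD lam \<and> y = D (Suc r, d)" "(Suc r, c) \<in> SD lam \<and> z = D (Suc r, c)"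
      then show "z < y" using mm[of r] rows_range[of r c d] not_less by blast
    next
      fix r a c x y z :: nat
      assume "a < c" "y < x" "(r, a) \<in> SD lam \<and> x = D (r, a)"
        "(r, c) \<in> SD lam \<and> z = D (r, c)" "(Suc r, c) \<in> SD lam \<and> y = D (Suc r, c)"
      then show "z \<le> x" using mm[of r] rows_range[of r a c] not_less by blast
    qed
    then show "D \<in> SD lam \<rightarrow>\<^sub>E {0<..} \<and> avoids ?T" using True by simp
  next
    assume "D \<in> SD lam \<rightarrow>\<^sub>E {0<..} \<and> avoids ?T"
    then have av: "avoids ?T" by simp
    note av = av[unfolded avoids_iff mem]
    have h: "hook_word (?w r)" if "r \<in> {1..length lam}" for r
      unfolding hook[OF that] using av[THEN conjunct1] by blast
    moreover have "max_hook_subword (?w r) (?w (r + 1) @ ?w r)" if r: "r \<in> {1..<length lam}" for r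
    proof -
      have hr: "hook_word (?w r)" "hook_word (?w (Suc r))" using h[of r] h[of "Suc r"] r by auto
      have d: "(r, r) \<in> SD lam" using diag[of r] r by simp
      show ?thesis unfolding max[OF r hr]
      proof (intro conjI allI impI notI)
        fix e assume "(Suc r, e) \<in> SD lam"
        then show "D (Suc r, e) < D (r, r)" using av[THEN conjunct2, THEN conjunct1] d by blast
      next
        fix c e assume "(r, c) \<in> SD lam" "(Suc r, c) \<in> SD lam" "(Suc r, e) \<in> SD lam" "c < e"
          "D (r, c) \<le> D (Suc r, e) \<and> D (Suc r, e) \<le> D (Suc r, c)"
        moreover from this have "D (Suc r, c) < D (Suc r, e)"
          using av[THEN conjunct2, THEN conjunct2, THEN conjunct1] by blast
        ultimately show False by simp
      next
        fix a c assume "(r, a) \<in> SD lam" "(r, c) \<in> SD lam" "(Suc r, c) \<in> SD lam" "a < c"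
          "D (Suc r, c) < D (r, a) \<and> D (r, a) < D (r, c)"
        moreover from this have "D (r, c) \<le> D (r, a)"
          using av[THEN conjunct2, THEN conjunct2, THEN conjunct2] by blast
        ultimately show False by simp
      qed
    qed
    ultimately show "dec_tableau lam D" using True by (simp add: dec_tableau_def)
  qed
qed (simp add: dec_tableau_def)

definition filling :: "nat list \<Rightarrow> (box \<Rightarrow> nat set) \<Rightarrow> bool" where
  "filling lam T \<longleftrightarrow> (\<forall>b\<in>SD lam. finite (T b) \<and> T b \<noteq> {} \<and> T b \<subseteq> {0<..}) \<and>
     (\<forall>b. b \<notin> SD lam \<longrightarrow> T b = {})"

lemma bad_pattern_single_valued:
  "bad_pattern V \<Longrightarrow> (b, x) \<in> V \<Longrightarrow> (b, y) \<in> V \<Longrightarrow> x = y"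
  by (induction rule: bad_pattern.induct) auto

text \<open>A pattern takes at most one letter from each box, so a pattern contained in
  \<open>T\<close> is contained in some distribution of \<open>T\<close>. Quantification over
  distributions thereby disappears.\<close>

lemma setval_dec_tableau_iff:
  assumes lam: "strict_partition lam"
  shows "setval_dec_tableau lam T \<longleftrightarrow> filling lam T \<and> avoids T"
proof (cases "filling lam T")
  case True
  have "(\<forall>D \<in> Pi\<^sub>E (SD lam) T. dec_tableau lam D) \<longleftrightarrow> avoids T"
  proof
    assume dec: "\<forall>D \<in> Pi\<^sub>E (SD lam) T. dec_tableau lam D"
    show "avoids T"
      unfolding avoids_def
    proof (intro allI impI notI)
      fix V assume V: "bad_pattern V" "V \<subseteq> Sigma UNIV T"
      \<comment> \<open>The distribution takes the letters of \<open>V\<close> where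
        \<open>V\<close> prescribes one and any letter elsewhere in the diagram;
        \<open>undefined\<close> outside is what \<open>Pi\<^sub>E\<close> demands.\<close>
      define D where "D = (\<lambda>b. if b \<in> SD lam then
        (if \<exists>x. (b, x) \<in> V then THE x. (b, x) \<in> V else SOME x. x \<in> T b) else undefined)"
      have DV: "D b = x \<and> b \<in> SD lam" if "(b, x) \<in> V" for b x
      proof -
        have "(THE x. (b, x) \<in> V) = x"
          using that bad_pattern_single_valued[OF V(1)] by (intro the_equality) auto
        moreover have "x \<in> T b" using that V(2) by auto
        then have "b \<in> SD lam" using True unfolding filling_def by blast
        ultimately show ?thesis using that by (auto simp: D_def)
      qed
      have "D b \<in> T b" if "b \<in> SD lam" for b
      proof (cases "\<exists>x. (b, x) \<in> V")
        case True
        then show ?thesis using DV V(2) by fastforce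
      next
        case False
        then show ?thesis using that \<open>filling lam T\<close> by (auto simp: D_def filling_def some_in_eq)
      qed
      then have "D \<in> Pi\<^sub>E (SD lam) T" by (auto simp: D_def)
      then have "avoids (\<lambda>b. if b \<in> SD lam then {D b} else {})"
        using dec dec_tableau_iff[OF lam] by blast
      moreover have "V \<subseteq> Sigma UNIV (\<lambda>b. if b \<in> SD lam then {D b} else {})"
        using DV by auto
      ultimately show False using V(1) by (auto simp: avoids_def)
    qed
  next
    assume av: "avoids T"
    show "\<forall>D \<in> Pi\<^sub>E (SD lam) T. dec_tableau lam D"
    proof
      fix D assume D: "D \<in> Pi\<^sub>E (SD lam) T"
      then have "Sigma UNIV (\<lambda>b. if b \<in> SD lam then {D b} else {}) \<subseteq> Sigma UNIV T"
        by (auto split: if_splits)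
      then have "avoids (\<lambda>b. if b \<in> SD lam then {D b} else {})"
        using av unfolding avoids_def by blast
      moreover have "D \<in> SD lam \<rightarrow>\<^sub>E {0<..}"
        using D True by (auto simp: filling_def PiE_iff)
      ultimately show "dec_tableau lam D" by (simp add: dec_tableau_iff[OF lam])
    qed
  qed
  then show ?thesis using True unfolding setval_dec_tableau_def filling_def by blast
next
  case False
  then show ?thesis unfolding setval_dec_tableau_def filling_def by blast
qed

section \<open>Patterns created by changing one letter\<close>

definition before :: "box \<Rightarrow> box \<Rightarrow> bool" where
  "before b c \<longleftrightarrow> fst b < fst c \<or> fst b = fst c \<and> snd c < snd b"

lemma before_Pair [simp]: "before (r, c) (r', c') \<longleftrightarrow> r < r' \<or> r = r' \<and> c' < c"
  by (simp add: before_def)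

lemma before_irrefl: "\<not> before b b"
  by (simp add: before_def)

lemma before_trans: "before a b \<Longrightarrow> before b c \<Longrightarrow> before a c"
  by (auto simp: before_def)

lemma before_asym: "before a b \<Longrightarrow> \<not> before b a"
  by (auto simp: before_def)

lemma before_total: "a = b \<or> before a b \<or> before b a"
  by (auto simp: before_def prod_eq_iff)

lemma sorted_wrt_concat_map:
  assumes "sorted_wrt R rs" "\<And>r. r \<in> set rs \<Longrightarrow> sorted_wrt Q (F r)"
    "\<And>r s x y. R r s \<Longrightarrow> x \<in> set (F r) \<Longrightarrow> y \<in> set (F s) \<Longrightarrow> Q x y"
  shows "sorted_wrt Q (concat (map F rs))"
  using assms(1,2)
  by (induction rs) (auto simp: sorted_wrt_append intro: assms(3))

lemma revrow_boxes_sorted: "sorted_wrt before (revrow_boxes lam)"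
  unfolding revrow_boxes_def
  by (rule sorted_wrt_concat_map[where R = "(<)", OF sorted_wrt_upt])
    (auto simp: sorted_wrt_rev sorted_wrt_map)

lemma set_revrow_boxes: "set (revrow_boxes lam) = SD lam"
  by (auto simp: revrow_boxes_def SD_iff)

lemma distinct_revrow_boxes: "distinct (revrow_boxes lam)"
proof -
  have "sorted_wrt before bs \<Longrightarrow> distinct bs" for bs
    by (induction bs) (auto simp: before_irrefl)
  then show ?thesis using revrow_boxes_sorted by blast
qed

lemma finite_SD: "finite (SD lam)"
  using set_revrow_boxes[of lam, symmetric] by simp

text \<open>Each cancellation removes one letter of either kind, so the difference of the two counts
  survives reduction; a box with both letters adds one to each count.\<close>

lemma box_sig_count:
  "int (snd (box_sig i T bs)) - int (fst (box_sig i T bs)) =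
     int (length (filter (\<lambda>b. Suc i \<in> T b) bs)) - int (length (filter (\<lambda>b. i \<in> T b) bs))"
  by (induction bs) (auto simp: bmul_def box_paren_def)

locale pattern_avoiding =
  fixes lam :: "nat list" and T :: "box \<Rightarrow> nat set"
  assumes lam: "strict_partition lam"
    and fill: "filling lam T"
    and avoids: "avoids T"
begin

lemma mem_SD: "x \<in> T b \<Longrightarrow> b \<in> SD lam"
  using fill unfolding filling_def by blast

lemma ex_value: "b \<in> SD lam \<Longrightarrow> \<exists>x. x \<in> T b"
  using fill by (auto simp: filling_def)

lemma row_rule: "x \<in> T (r, j) \<Longrightarrow> y \<in> T (r, k) \<Longrightarrow> z \<in> T (r, l) \<Longrightarrow> j < k \<Longrightarrow> k < l \<Longrightarrow> x < y \<Longrightarrow> y < z"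
  using avoids[unfolded avoids_iff, THEN conjunct1] by blast

lemma diag_rule: "x \<in> T (r, r) \<Longrightarrow> y \<in> T (Suc r, d) \<Longrightarrow> y < x"
  using avoids[unfolded avoids_iff, THEN conjunct2, THEN conjunct1] by blast

lemma lower_rule:
  "x \<in> T (r, c) \<Longrightarrow> y \<in> T (Suc r, d) \<Longrightarrow> z \<in> T (Suc r, c) \<Longrightarrow> c < d \<Longrightarrow> x \<le> y \<Longrightarrow> z < y"
  using avoids[unfolded avoids_iff, THEN conjunct2, THEN conjunct2, THEN conjunct1] by blast

lemma upper_rule:
  "x \<in> T (r, a) \<Longrightarrow> z \<in> T (r, c) \<Longrightarrow> y \<in> T (Suc r, c) \<Longrightarrow> a < c \<Longrightarrow> y < x \<Longrightarrow> z \<le> x"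
  using avoids[unfolded avoids_iff, THEN conjunct2, THEN conjunct2, THEN conjunct2] by blast

lemma SD_row: "(r, c) \<in> SD lam \<Longrightarrow> r \<le> a \<Longrightarrow> a \<le> c \<Longrightarrow> (r, a) \<in> SD lam"
  by (auto simp: SD_iff)

lemma SD_col: "(r, c) \<in> SD lam \<Longrightarrow> r \<le> c"
  by (auto simp: SD_iff)

lemma SD_up: "(r, a) \<in> SD lam \<Longrightarrow> (Suc r, c) \<in> SD lam \<Longrightarrow> (r, c) \<in> SD lam"
  using SD_above[OF lam] by (auto simp: SD_iff)

lemma finite_cols: "finite {k. P k \<and> x \<in> T (r, k)}"
proof (rule finite_subset)
  show "{k. P k \<and> x \<in> T (r, k)} \<subseteq> snd ` SD lam" using mem_SD by force
qed (simp add: finite_SD)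

lemma finite_boxes: "finite {b. P b \<and> x \<in> T b}"
  by (rule finite_subset[OF _ finite_SD[of lam]]) (auto dest: mem_SD)

lemma card_boxes_segment:
  assumes "\<And>b. b \<in> set R \<longleftrightarrow> b \<in> SD lam \<and> P b" "distinct R"
  shows "card {b. P b \<and> x \<in> T b} = length (filter (\<lambda>b. x \<in> T b) R)"
proof -
  have "{b. P b \<and> x \<in> T b} = set (filter (\<lambda>b. x \<in> T b) R)"
    using assms(1) mem_SD by auto
  then show ?thesis using assms(2) by (metis distinct_card distinct_filter)
qed

end

text \<open>Only the pivot property is assumed, which the boxes of \<open>e_op\<close> and
  \<open>f_op\<close> share; each lemma adds the letters of \<open>X\<close> that it uses.\<close>

locale pivot_box = pattern_avoiding lam T
  for lam :: "nat list" and T :: "box \<Rightarrow> nat set" +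
  fixes i :: nat and X :: box
  assumes pivot: "pivot i lam T X"
begin

lemma pivot_SD: "X \<in> SD lam"
  using pivot unfolding pivot_def set_revrow_boxes[symmetric] by fastforce

text \<open>No closing letter survives in the word after \<open>X\<close>, hence none in a prefix of
  it. The segment includes \<open>Y\<close>, so that a box with both letters can answer for itself.
  \<open>card_before\<close> is the mirror image.\<close>

lemma card_after:
  assumes "Y \<in> SD lam" "before X Y"
  shows "card {b. (before X b \<and> (b = Y \<or> before b Y)) \<and> i \<in> T b}
    \<le> card {b. (before X b \<and> (b = Y \<or> before b Y)) \<and> Suc i \<in> T b}"
proof -
  obtain P Q where PQ: "revrow_boxes lam = P @ X # Q" "fst (box_sig i T Q) = 0"
    using pivot by (auto simp: pivot_def)
  have srt: "sorted_wrt before (P @ X # Q)" and dst: "distinct (P @ X # Q)"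
    using revrow_boxes_sorted[of lam] distinct_revrow_boxes[of lam] PQ(1) by simp_all
  have SD: "SD lam = set (P @ X # Q)" using set_revrow_boxes[of lam] PQ(1) by simp
  have "Y \<in> set Q"
    using assms srt SD by (auto simp: sorted_wrt_append before_irrefl dest: before_asym)
  then obtain Q1 Q2 where Q: "Q = (Q1 @ [Y]) @ Q2" by (auto simp: in_set_conv_decomp)
  define R where "R = Q1 @ [Y]"
  have R: "b \<in> set R \<longleftrightarrow> b \<in> SD lam \<and> (before X b \<and> (b = Y \<or> before b Y))" for b
    using srt by (auto simp: SD Q R_def sorted_wrt_append before_irrefl dest: before_asym)
  have dR: "distinct R" using dst by (simp add: Q R_def)
  have "fst (box_sig i T R) = 0"
    using PQ(2) unfolding Q R_def[symmetric] by (simp add: sig_append bmul_def)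
  then have "length (filter (\<lambda>b. i \<in> T b) R) \<le> length (filter (\<lambda>b. Suc i \<in> T b) R)"
    using box_sig_count[of i T R] by simp
  then show ?thesis using R dR by (subst (1 2) card_boxes_segment[where R = R]) auto
qed

lemma card_before:
  assumes "Y \<in> SD lam" "before Y X"
  shows "card {b. ((b = Y \<or> before Y b) \<and> before b X) \<and> Suc i \<in> T b}
    \<le> card {b. ((b = Y \<or> before Y b) \<and> before b X) \<and> i \<in> T b}"
proof -
  obtain P Q where PQ: "revrow_boxes lam = P @ X # Q" "snd (box_sig i T P) = 0"
    using pivot by (auto simp: pivot_def)
  have srt: "sorted_wrt before (P @ X # Q)" and dst: "distinct (P @ X # Q)"
    using revrow_boxes_sorted[of lam] distinct_revrow_boxes[of lam] PQ(1) by simp_all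
  have SD: "SD lam = set (P @ X # Q)" using set_revrow_boxes[of lam] PQ(1) by simp
  have "Y \<in> set P"
    using assms srt SD by (auto simp: sorted_wrt_append before_irrefl dest: before_asym)
  then obtain P1 P2 where P: "P = P1 @ (Y # P2)" by (auto simp: in_set_conv_decomp)
  define R where "R = Y # P2"
  have R: "b \<in> set R \<longleftrightarrow> b \<in> SD lam \<and> ((b = Y \<or> before Y b) \<and> before b X)" for b
    using srt by (auto simp: SD P R_def sorted_wrt_append before_irrefl dest: before_asym)
  have dR: "distinct R" using dst by (simp add: P R_def)
  have "snd (box_sig i T R) = 0"
    using PQ(2) unfolding P R_def[symmetric] by (simp add: sig_append bmul_def)
  then have "length (filter (\<lambda>b. Suc i \<in> T b) R) \<le> length (filter (\<lambda>b. i \<in> T b) R)"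
    using box_sig_count[of i T R] by simp
  then show ?thesis using R dR by (subst (1 2) card_boxes_segment[where R = R]) auto
qed

text \<open>The usual form in which the pivot property is applied: an \<open>i\<close> after
  \<open>X\<close> yields an \<open>i + 1\<close> between \<open>X\<close> and it, to which the
  pattern rules are then applied.\<close>

lemma after_ex:
  assumes "i \<in> T Y" "before X Y"
  obtains Z where "Suc i \<in> T Z" "before X Z" "Z = Y \<or> before Z Y"
proof -
  let ?S = "\<lambda>x. {b. (before X b \<and> (b = Y \<or> before b Y)) \<and> x \<in> T b}"
  have "Y \<in> ?S (i)" using assms by simp
  moreover have "finite (?S (i))" by (rule finite_boxes)
  ultimately have "0 < card (?S (i))" by (metis card_gt_0_iff empty_iff)
  also have "card (?S (i)) \<le> card (?S (Suc i))"
    by (rule card_after[OF mem_SD[OF assms(1)] assms(2)])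
  finally have "?S (Suc i) \<noteq> {}" by (metis card_gt_0_iff)
  then show thesis using that by blast
qed

lemma before_ex:
  assumes "Suc i \<in> T Y" "before Y X"
  obtains Z where "i \<in> T Z" "before Z X" "Z = Y \<or> before Y Z"
proof -
  let ?S = "\<lambda>x. {b. ((b = Y \<or> before Y b) \<and> before b X) \<and> x \<in> T b}"
  have "Y \<in> ?S (Suc i)" using assms by simp
  moreover have "finite (?S (Suc i))" by (rule finite_boxes)
  ultimately have "0 < card (?S (Suc i))" by (metis card_gt_0_iff empty_iff)
  also have "card (?S (Suc i)) \<le> card (?S (i))"
    by (rule card_before[OF mem_SD[OF assms(1)] assms(2)])
  finally have "?S (i) \<noteq> {}" by (metis card_gt_0_iff)
  then show thesis using that by blast
qed

section \<open>Patterns created by lowering a letter\<close>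

definition e_partner :: "box \<Rightarrow> bool" where
  "e_partner A \<longleftrightarrow> i \<in> T A \<and> Suc i \<in> T A \<and> before A X \<and>
     (\<forall>m. before A m \<longrightarrow> before m X \<longrightarrow> i \<notin> T m \<and> Suc i \<notin> T m)"

definition f_partner :: "box \<Rightarrow> bool" where
  "f_partner A \<longleftrightarrow> i \<in> T A \<and> Suc i \<in> T A \<and> before X A \<and>
     (\<forall>m. before X m \<longrightarrow> before m A \<longrightarrow> i \<notin> T m \<and> Suc i \<notin> T m)"

text \<open>The row rule excludes \<open>i\<close> from all columns left of \<open>k\<close>. An
  \<open>i + 1\<close> right of \<open>X\<close> and not beyond column \<open>k\<close> must be
  closed before \<open>X\<close> is read, which is then possible only inside column \<open>k\<close>
  itself.\<close>

lemma e_row_first: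
  assumes X: "X = (r, j)" and jkl: "j < k" "k < l" and k: "Suc i \<in> T (r, k)"
    and z: "z \<in> T (r, l)" "z \<le> Suc i"
  shows "e_partner (r, k)"
proof -
  have no_i: "i \<notin> T (r, m)" if "m < k" for m
    using row_rule[of i r m "Suc i" k z l] that jkl k z by auto
  have only_k: "m = k \<and> i \<in> T (r, k)" if m: "Suc i \<in> T (r, m)" "j < m" "m \<le> k" for m
  proof -
    obtain Z where Z: "i \<in> T Z" "before Z X" "Z = (r, m) \<or> before (r, m) Z"
      using before_ex[of "(r, m)"] m X by auto
    then obtain c where "Z = (r, c)" "j < c" "c \<le> m" using X by (cases Z) auto
    then show ?thesis using no_i[of c] Z(1) m(3) by (cases "c = k") auto
  qed
  show ?thesis
    unfolding e_partner_def
  proof (intro conjI allI impI)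
    show "i \<in> T (r, k)" using only_k[of k] k jkl by auto
    fix m assume "before (r, k) m" "before m X"
    then obtain c where m: "m = (r, c)" "j < c" "c < k" using X by (cases m) auto
    show "i \<notin> T m" using no_i m by simp
    show "Suc i \<notin> T m" using only_k[of c] m by auto
  qed (use X jkl k in auto)
qed

text \<open>The \<open>i\<close> in column \<open>k\<close> is opened by an \<open>i + 1\<close>
  left of \<open>X\<close> in a column not before \<open>k\<close>. After the smaller letter
  \<open>x\<close>, this \<open>i + 1\<close> and the one in \<open>X\<close> form a row
  pattern.\<close>

lemma e_row_last:
  assumes X: "X = (r, l)" "Suc i \<in> T X" and jkl: "j < k" "k < l" and x: "x \<in> T (r, j)" "x < i"
    and k: "i \<in> T (r, k)"
  shows False
proof -
  obtain Z where Z: "Suc i \<in> T Z" "before X Z" "Z = (r, k) \<or> before Z (r, k)"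
    using after_ex[of "(r, k)"] k X jkl by auto
  then obtain c where "Z = (r, c)" "k \<le> c" "c < l" using X by (cases Z) auto
  then show False using row_rule[of x r j "Suc i" c "Suc i" l] X x Z(1) jkl by auto
qed

text \<open>Row \<open>r\<close> has no box left of \<open>X\<close>, so the \<open>i + 1\<close>
  that opens the given \<open>i\<close> lies in row \<open>r + 1\<close>, where the diagonal rule
  with the \<open>i + 1\<close> of \<open>X\<close> excludes it.\<close>

lemma e_diagonal:
  assumes X: "X = (r, r)" "Suc i \<in> T X" and d: "i \<in> T (Suc r, d)"
  shows False
proof -
  obtain Z where Z: "Suc i \<in> T Z" "before X Z" "Z = (Suc r, d) \<or> before Z (Suc r, d)"
    using after_ex[of "(Suc r, d)"] d X by auto
  then consider c where "Z = (r, c)" "c < r" | c where "Z = (Suc r, c)" "d \<le> c"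
    using X by (cases Z) auto
  then show False
  proof cases
    case 1
    then show False using mem_SD[OF Z(1)] SD_col by fastforce
  next
    case 2
    then show False using diag_rule[of "Suc i" r "Suc i" c] X Z(1) by auto
  qed
qed

text \<open>
  The contradiction is a count of parentheses. Let \<open>C\<close> be the columns left of \<open>X\<close> with a letter
  \<open>i + 1\<close> in row \<open>r\<close>. Except for at most one of them (\<open>B\<close>) they have an \<open>i\<close> directly below, and if
  there is an exception then no \<open>i + 1\<close> occurs in row \<open>r + 1\<close> from column \<open>d\<close> on (\<open>E\<close>). With the
  letters \<open>i\<close> in columns \<open>c\<close> and \<open>d\<close> of row \<open>r + 1\<close>, the word after \<open>X\<close> closes too often.
\<close>

lemma e_lower_upper_left:
  assumes X: "X = (r, c)" "Suc i \<in> T X" and cd: "c < d" and d: "i \<in> T (Suc r, d)"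
    and z: "z \<in> T (Suc r, c)" "i \<le> z"
  shows False
proof -
  have rc: "r < c" using SD_col[OF mem_SD[OF z(1)]] by simp
  have below: "(Suc r, m) \<in> SD lam" if "r < m" "m \<le> c" for m
    using SD_row[OF mem_SD[OF z(1)], of m] that by simp
  \<comment> \<open>A larger letter under \<open>X\<close> would conflict with the
    \<open>i + 1\<close> that opens the \<open>i\<close> in column \<open>d\<close>: by the diagonal
    rule, or the row and lower rules, if that lies in row \<open>r\<close>, and by the lower rule at
    \<open>X\<close> if it lies in row \<open>r + 1\<close>.\<close>
  have c_le: "y \<le> i" if y: "y \<in> T (Suc r, c)" for y
  proof (rule ccontr)
    assume "\<not> y \<le> i"
    then have yi: "Suc i \<le> y" by simp
    obtain Z where Z: "Suc i \<in> T Z" "before X Z" "Z = (Suc r, d) \<or> before Z (Suc r, d)"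
      using after_ex[of "(Suc r, d)"] d X by auto
    then consider e where "Z = (r, e)" "e < c" | e where "Z = (Suc r, e)" "d \<le> e"
      using X by (cases Z) auto
    then show False
    proof cases
      case 1
      show False
      proof (cases "e = r")
        case True
        then show False using diag_rule[of "Suc i" r y c] 1 Z(1) y yi by auto
      next
        case False
        then have "r < e" using SD_col mem_SD[OF Z(1)] 1 by fastforce
        then obtain a where a: "a \<in> T (Suc r, e)" using below[of e] 1 ex_value by fastforce
        have "y \<le> a" using row_rule[OF a y d] 1 cd yi by fastforce
        then show False using lower_rule[of "Suc i" r e y c a] 1 Z(1) y a yi by auto
      qed
    next
      case 2
      then show False using lower_rule[of "Suc i" r c "Suc i" e y] X Z(1) y yi cd by auto
    qed
  qed
  have ic: "i \<in> T (Suc r, c)" using c_le[OF z(1)] z by simp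
  define C where "C = {e. e < c \<and> Suc i \<in> T (r, e)}"
  define B where "B = {e \<in> C. e = r \<or> (\<exists>a\<in>T (Suc r, e). i < a)}"
  define G where "G = C - B"
  define E where "E = {e. d \<le> e \<and> Suc i \<in> T (Suc r, e)}"
  have finC: "finite C" and finE: "finite E" unfolding C_def E_def by (rule finite_cols)+
  have C_ge: "r \<le> e" if "e \<in> C" for e using that SD_col[OF mem_SD] by (auto simp: C_def)
  have B_lt: "\<not> e1 < e2" if e_B: "e1 \<in> B" "e2 \<in> B" for e1 e2
  proof
    assume e12: "e1 < e2"
    have e: "e1 < c" "e2 < c" "Suc i \<in> T (r, e1)" "r \<le> e1"
      using e_B C_ge by (auto simp: B_def C_def)
    then obtain a2 where a2: "a2 \<in> T (Suc r, e2)" "i < a2" using e_B(2) e12 by (auto simp: B_def)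
    show False
    proof (cases "e1 = r")
      case True
      then show False using diag_rule[of "Suc i" r a2 e2] e a2 by auto
    next
      case False
      then obtain a1 where a1: "a1 \<in> T (Suc r, e1)" using e_B(1) by (auto simp: B_def)
      have "a2 \<le> a1" using row_rule[OF a1 a2(1) ic] e12 e a2(2) by fastforce
      then show False using lower_rule[of "Suc i" r e1 a2 e2 a1] e a1 a2 e12 by auto
    qed
  qed
  have BE: False if eB: "e \<in> B" "e' \<in> E" for e e'
  proof (cases "e = r")
    case True
    then show False using diag_rule[of "Suc i" r "Suc i" e'] eB by (auto simp: B_def C_def E_def)
  next
    case False
    then obtain a where "a \<in> T (Suc r, e)" "i < a" using eB(1) by (auto simp: B_def)
    then show False
      using lower_rule[of "Suc i" r e "Suc i" e' a] eB cd by (auto simp: B_def C_def E_def)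
  qed
  have E_lt: "\<not> e1 < e2" if "e1 \<in> E" "e2 \<in> E" for e1 e2
    using row_rule[of i "Suc r" c "Suc i" e1 "Suc i" e2] that ic cd by (auto simp: E_def)
  have one: "card A \<le> 1" if "\<And>a b. a \<in> A \<Longrightarrow> b \<in> A \<Longrightarrow> \<not> a < b" for A :: "nat set"
  proof (cases "A = {}")
    case False
    then obtain a where "a \<in> A" by blast
    then have "A = {a}" using that by (auto simp: set_eq_iff) (meson nat_neq_iff)
    then show ?thesis by simp
  qed simp
  have BE_card: "card B + card E \<le> 1"
  proof (cases "B = {}")
    case True
    then show ?thesis using one[of E] E_lt by auto
  next
    case False
    then have "E = {}" using BE by blast
    then show ?thesis using one[of B] B_lt by auto
  qed
  have G: "r < g" "g < c" "i \<in> T (Suc r, g)" "Suc i \<notin> T (Suc r, g)" if g: "g \<in> G" for g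
  proof -
    show gr: "r < g" using C_ge[of g] g by (cases "g = r") (auto simp: G_def B_def)
    show gc: "g < c" using g by (auto simp: G_def C_def)
    obtain a where a: "a \<in> T (Suc r, g)" using below[of g] gr gc ex_value by fastforce
    have le: "b \<le> i" if "b \<in> T (Suc r, g)" for b using g that by (auto simp: G_def B_def)
    have "i \<le> a" using row_rule[OF a ic d] gc cd by fastforce
    then show "i \<in> T (Suc r, g)" using a le[OF a] by simp
    show "Suc i \<notin> T (Suc r, g)" using le[of "Suc i"] by auto
  qed
  have finG: "finite G" using finC by (simp add: G_def)
  \<comment> \<open>The count stops at the leftmost of the columns \<open>c\<close> and
    \<open>G\<close>. All the letters \<open>i\<close> to be counted are then inside the segment,
    while row \<open>r + 1\<close> contributes \<open>i + 1\<close> only from column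
    \<open>d\<close> on.\<close>
  define c1 where "c1 = Min (insert c G)"
  have c1: "c1 \<in> insert c G" unfolding c1_def using finG by (intro Min_in) auto
  have c1_le: "c1 \<le> g" if "g \<in> insert c G" for g unfolding c1_def using finG that by (intro Min_le) auto
  let ?Y = "(Suc r, c1)"
  let ?P = "\<lambda>b. before X b \<and> (b = ?Y \<or> before b ?Y)"
  have "{b. ?P b \<and> Suc i \<in> T b} \<subseteq> Pair r ` C \<union> Pair (Suc r) ` E"
  proof
    fix b assume b: "b \<in> {b. ?P b \<and> Suc i \<in> T b}"
    then consider e where "b = (r, e)" "e < c" | m where "b = (Suc r, m)" "c1 \<le> m"
      using X by (cases b) auto
    then show "b \<in> Pair r ` C \<union> Pair (Suc r) ` E"
    proof cases
      case 1
      then show ?thesis using b by (auto simp: C_def)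
    next
      case 2
      have m: "Suc i \<in> T (Suc r, m)" using b 2 by simp
      have "d \<le> m"
      proof (rule ccontr)
        assume md: "\<not> d \<le> m"
        consider "c < m" | "m = c" | "m < c" "c1 = m" | "m < c" "c1 < m" using 2 by linarith
        then show False
        proof cases
          case 1
          then show False using row_rule[OF ic m d] md by simp
        next
          case 2
          then show False using c_le m by fastforce
        next
          case 3
          then show False using G(4)[of m] c1 m by auto
        next
          case 4
          then show False using row_rule[OF G(3)[of c1] m ic] c1 by auto
        qed
      qed
      then show ?thesis using 2 m by (auto simp: E_def)
    qed
  qed
  then have "card {b. ?P b \<and> Suc i \<in> T b} \<le> card (Pair r ` C \<union> Pair (Suc r) ` E)"
    using finC finE by (intro card_mono) auto
  also have "\<dots> \<le> card C + card E"
    by (rule order_trans[OF card_Un_le]) (intro add_mono card_image_le finC finE)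
  also have "card C = card G + card B"
    unfolding G_def using finC by (subst card_Diff_subset) (auto simp: B_def card_mono finite_subset)
  finally have up: "card {b. ?P b \<and> Suc i \<in> T b} \<le> card G + 1" using BE_card by simp
  have "Pair (Suc r) ` (insert c (insert d G)) \<subseteq> {b. ?P b \<and> i \<in> T b}"
    using c1_le ic d G cd X by (force intro: order.strict_trans1)
  then have "card (Pair (Suc r) ` (insert c (insert d G))) \<le> card {b. ?P b \<and> i \<in> T b}"
    using finite_boxes by (intro card_mono) auto
  moreover have "card (Pair (Suc r) ` (insert c (insert d G))) = card G + 2"
  proof -
    have "c \<notin> insert d G" "d \<notin> G" using cd G(2)[of c] G(2)[of d] by auto
    then have "card (insert c (insert d G)) = card G + 2" using finG by simp
    then show ?thesis by (subst card_image) (simp_all add: inj_on_def)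
  qed
  moreover have "?Y \<in> SD lam" using c1 ic G(3) mem_SD by auto
  ultimately show False using card_after[of ?Y] up X by auto
qed

text \<open>The \<open>i + 1\<close> that opens the \<open>i\<close> of column \<open>c\<close>
  forms a pattern with the \<open>i + 1\<close> of \<open>X\<close>: a \<open>lower\<close> one if
  it lies in column \<open>c\<close>, and otherwise a row pattern starting with that
  \<open>i\<close>.\<close>

lemma e_lower_right:
  assumes X: "X = (Suc r, d)" "Suc i \<in> T X" and cd: "c < d" and x: "x \<in> T (r, c)" "x \<le> i"
    and c: "i \<in> T (Suc r, c)"
  shows False
proof -
  obtain Z where Z: "Suc i \<in> T Z" "before X Z" "Z = (Suc r, c) \<or> before Z (Suc r, c)"
    using after_ex[of "(Suc r, c)"] c X cd by auto
  then obtain m where m: "Z = (Suc r, m)" "c \<le> m" "m < d" using X by (cases Z) auto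
  show False
  proof (cases "m = c")
    case True
    then show False using lower_rule[of x r c "Suc i" d "Suc i"] X x cd Z(1) m by auto
  next
    case False
    then show False using row_rule[of i "Suc r" c "Suc i" m "Suc i" d] c X Z(1) m by auto
  qed
qed

text \<open>The partner lies in the row above \<open>X\<close>, so the gap consists of row
  \<open>r\<close> left of column \<open>a\<close> and row \<open>r + 1\<close> right of column
  \<open>c\<close>. Both pieces are first cleared of \<open>i\<close>. An \<open>i + 1\<close> there
  would need a closing \<open>i\<close> before \<open>X\<close>, and this excludes it as
  well.\<close>

lemma e_upper_below:
  assumes X: "X = (Suc r, c)" "Suc i \<in> T X" and ac: "a < c" and a: "Suc i \<in> T (r, a)"
    and z: "z \<in> T (r, c)" "Suc i < z"
  shows "e_partner (r, a)"
proof -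
  have ra: "r \<le> a" if "Suc i \<in> T (r, a)" for a using SD_col[OF mem_SD[OF that]] .
  have no_i_below: "i \<notin> T (Suc r, d)" if cd: "c < d" for d
  proof
    assume d: "i \<in> T (Suc r, d)"
    obtain w where w: "w \<in> T (r, d)"
      using SD_up[OF mem_SD[OF a] mem_SD[OF d]] ex_value by blast
    have "z < w" using row_rule[OF a z(1) w] ac cd z(2) by simp
    moreover have "w \<le> Suc i" using upper_rule[OF a w d] ac cd by simp
    ultimately show False using z(2) by simp
  qed
  \<comment> \<open>The column \<open>a\<close> is rebound because the claim is needed for every
    \<open>i + 1\<close> of row \<open>r\<close> left of column \<open>c\<close>. A letter under it
    is forced to equal \<open>i\<close>, and the \<open>i + 1\<close> opening that letter completes
    a pattern in row \<open>r + 1\<close>.\<close>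
  have no_i_left: "i \<notin> T (r, e)" if e: "e < a" and a: "Suc i \<in> T (r, a)" and ac: "a < c" for e a
  proof
    assume ie: "i \<in> T (r, e)"
    have re: "r \<le> e" using SD_col[OF mem_SD[OF ie]] .
    have below: "(Suc r, m) \<in> SD lam" if "r < m" "m \<le> c" for m
      using SD_row[of "Suc r" c m] pivot_SD X that by simp
    have "(Suc r, a) \<in> SD lam" using below[of a] re e ac by simp
    then obtain b where b: "b \<in> T (Suc r, a)" using ex_value by blast
    have ib: "i \<le> b" using upper_rule[OF ie a b e] by fastforce
    have er: "e \<noteq> r" using diag_rule[of i r "Suc i" c] ie X by auto
    then have "(Suc r, e) \<in> SD lam" using below[of e] re e ac by simp
    then obtain h where h: "h \<in> T (Suc r, e)" using ex_value by blast
    have "h < b" using lower_rule[OF ie b h e ib] .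
    then have "b < Suc i" using row_rule[OF h b, of "Suc i" c] X e ac by simp
    then have "i \<in> T (Suc r, a)" using ib b by (simp add: less_Suc_eq_le)
    then obtain Z where Z: "Suc i \<in> T Z" "before X Z" "Z = (Suc r, a) \<or> before Z (Suc r, a)"
      using after_ex[of "(Suc r, a)"] X ac by auto
    then obtain m where m: "Z = (Suc r, m)" "a \<le> m" "m < c" using X by (cases Z) auto
    show False
    proof (cases "m = a")
      case True
      then have s: "Suc i \<in> T (Suc r, a)" using Z m by simp
      have "h < Suc i" using lower_rule[OF ie s h e] by simp
      then show False using row_rule[OF h s, of "Suc i" c] X e ac by simp
    next
      case False
      then show False
        using row_rule[OF \<open>i \<in> T (Suc r, a)\<close>, of "Suc i" m "Suc i" c] X m Z(1) by simp
    qed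
  qed
  have both: "i \<in> T (r, a)" if a: "Suc i \<in> T (r, a)" "a < c" for a
  proof -
    obtain Z where Z: "i \<in> T Z" "before Z X" "Z = (r, a) \<or> before (r, a) Z"
      using before_ex[of "(r, a)"] a X by auto
    then consider e where "Z = (r, e)" "e \<le> a" | e where "Z = (Suc r, e)" "c < e"
      using X by (cases Z) auto
    then show ?thesis
    proof cases
      case 1
      then show ?thesis using no_i_left[of e a] a Z(1) by (cases "e = a") auto
    next
      case 2
      then show ?thesis using no_i_below Z(1) by auto
    qed
  qed
  show ?thesis
    unfolding e_partner_def
  proof (intro conjI allI impI)
    show "i \<in> T (r, a)" using both a ac .
    fix m assume "before (r, a) m" "before m X"
    then consider e where "m = (r, e)" "e < a" | e where "m = (Suc r, e)" "c < e"
      using X by (cases m) auto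
    then have "i \<notin> T m \<and> Suc i \<notin> T m"
    proof cases
      case 1
      then show ?thesis using no_i_left[of e a] both[of e] a ac by auto
    next
      case 2
      have "Suc i \<notin> T (Suc r, e)"
      proof
        assume "Suc i \<in> T (Suc r, e)"
        then obtain Z where Z: "i \<in> T Z" "before Z X" "Z = (Suc r, e) \<or> before (Suc r, e) Z"
          using before_ex[of "(Suc r, e)"] 2 X by auto
        then obtain h where "Z = (Suc r, h)" "c < h" using X by (cases Z) auto
        then show False using no_i_below Z(1) by auto
      qed
      then show ?thesis using no_i_below 2 by auto
    qed
    then show "i \<notin> T m" "Suc i \<notin> T m" by auto
  qed (use X a in auto)
qed

text \<open>The mechanism of \<open>e_row_first\<close>, with the upper rule excluding
  \<open>i\<close> from the columns left of \<open>c\<close>.\<close>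

lemma e_upper_left:
  assumes X: "X = (r, a)" and ac: "a < c" and c: "Suc i \<in> T (r, c)"
    and y: "y \<in> T (Suc r, c)" "y < i"
  shows "e_partner (r, c)"
proof -
  have no_i: "i \<notin> T (r, m)" if "m < c" for m
    using upper_rule[of i r m "Suc i" c y] that c y by auto
  have only_c: "m = c \<and> i \<in> T (r, c)" if m: "Suc i \<in> T (r, m)" "a < m" "m \<le> c" for m
  proof -
    obtain Z where Z: "i \<in> T Z" "before Z X" "Z = (r, m) \<or> before (r, m) Z"
      using before_ex[of "(r, m)"] m X by auto
    then obtain e where "Z = (r, e)" "a < e" "e \<le> m" using X by (cases Z) auto
    then show ?thesis using no_i[of e] Z(1) m(3) by (cases "e = c") auto
  qed
  show ?thesis
    unfolding e_partner_def
  proof (intro conjI allI impI)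
    show "i \<in> T (r, c)" using only_c[of c] c ac by auto
    fix m assume "before (r, c) m" "before m X"
    then obtain e where m: "m = (r, e)" "a < e" "e < c" using X by (cases m) auto
    show "i \<notin> T m" using no_i m by simp
    show "Suc i \<notin> T m" using only_c[of e] m by auto
  qed (use X ac c in auto)
qed

section \<open>Patterns created by raising a letter\<close>

lemma f_row_left:
  assumes X: "X = (r, k)" "i \<in> T X" and jk: "j < k" and j: "i \<in> T (r, j)"
  shows "f_partner (r, j)"
proof -
  \<comment> \<open>Between two letters \<open>i\<close> of a row, an \<open>i + 1\<close> is an
    ascent followed by a descent. Hence an \<open>i\<close> from column \<open>j\<close> up to
    before \<open>k\<close> can be opened only inside column \<open>j\<close>.\<close>
  have no_Suc: "Suc i \<notin> T (r, m)" if "j < m" "m < k" for m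
    using row_rule[of i r j "Suc i" m i k] that j X by auto
  have only_j: "m = j \<and> Suc i \<in> T (r, j)" if m: "i \<in> T (r, m)" "j \<le> m" "m < k" for m
  proof -
    obtain Z where Z: "Suc i \<in> T Z" "before X Z" "Z = (r, m) \<or> before Z (r, m)"
      using after_ex[of "(r, m)"] m X by auto
    then obtain c where "Z = (r, c)" "m \<le> c" "c < k" using X by (cases Z) auto
    then show ?thesis using no_Suc[of c] Z(1) m(2) by (cases "c = j") auto
  qed
  show ?thesis
    unfolding f_partner_def
  proof (intro conjI allI impI)
    show "Suc i \<in> T (r, j)" using only_j[of j] j jk by auto
    fix m assume "before X m" "before m (r, j)"
    then obtain c where m: "m = (r, c)" "j < c" "c < k" using X by (cases m) auto
    show "Suc i \<notin> T m" using no_Suc m by simp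
    show "i \<notin> T m" using only_j[of c] m by auto
  qed (use X jk j in auto)
qed

text \<open>The \<open>i\<close> closing the \<open>i + 1\<close> of column \<open>l\<close> lies
  right of \<open>X\<close>, so it repeats the \<open>i\<close> of \<open>X\<close> after the
  smaller letter \<open>x\<close>, which is a row pattern.\<close>

lemma f_row_middle:
  assumes X: "X = (r, k)" "i \<in> T X" and jkl: "j < k" "k < l" and x: "x \<in> T (r, j)" "x < i"
    and l: "Suc i \<in> T (r, l)"
  shows False
proof -
  obtain Z where Z: "i \<in> T Z" "before Z X" "Z = (r, l) \<or> before (r, l) Z"
    using before_ex[of "(r, l)"] l X jkl by auto
  then obtain m where "Z = (r, m)" "k < m" "m \<le> l" using X by (cases Z) auto
  then show False using row_rule[of x r j i k i m] X x Z(1) jkl by auto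
qed

text \<open>
  Again a count of parentheses: above each \<open>i\<close> of row \<open>r + 1\<close> from column \<open>x\<close> on, except for the
  rightmost one, there is an \<open>i + 1\<close> and no \<open>i\<close>.
\<close>

lemma f_count:
  assumes X: "X = (Suc r, x)" "i \<in> T X" and c: "Suc i \<in> T (r, c)" "i \<notin> T (r, c)"
    and cx: "c < x \<or> c = x \<and> (\<exists>d>x. Suc i \<in> T (Suc r, d))"
  shows False
proof -
  define K where "K = {k. x \<le> k \<and> i \<in> T (Suc r, k)}"
  define M where "M = Max K"
  have finK: "finite K" unfolding K_def by (rule finite_cols)
  have xK: "x \<in> K" using X by (simp add: K_def)
  have MK: "M \<in> K" unfolding M_def using finK xK by (intro Max_in) auto
  have K_le: "k \<le> M" if "k \<in> K" for k unfolding M_def using finK that by simp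
  have cM: "c < M"
  proof (cases "c < x")
    case True
    then show ?thesis using K_le[OF xK] by simp
  next
    case False
    then obtain d where d: "c = x" "x < d" "Suc i \<in> T (Suc r, d)" using cx by blast
    then obtain Z where Z: "i \<in> T Z" "before Z X" "Z = (Suc r, d) \<or> before (Suc r, d) Z"
      using before_ex[of "(Suc r, d)"] X by auto
    then obtain m where "Z = (Suc r, m)" "x < m" using X by (cases Z) auto
    then show ?thesis using K_le[of m] Z(1) d(1) by (auto simp: K_def)
  qed
  \<comment> \<open>The column \<open>c\<close> stands in for \<open>M\<close>. If
    \<open>c < x\<close>, then \<open>C\<close> is as large as \<open>K\<close>; if
    \<open>c = x\<close>, then \<open>c\<close> is already in \<open>K\<close> and the missing
    letter \<open>i + 1\<close> is supplied by row \<open>r + 1\<close> right of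
    \<open>X\<close>.\<close>
  define C where "C = insert c (K - {M})"
  have finC: "finite C" using finK by (simp add: C_def)
  have above_le: "w \<le> Suc i" if "w \<in> T (r, k)" "k \<in> K" "c < k" for w k
    using upper_rule[OF c(1), of w k i] that by (simp add: K_def)
  have SDK: "(r, k) \<in> SD lam" if "k \<in> K" for k
    using that SD_up[OF mem_SD[OF c(1)] mem_SD[of i "(Suc r, k)"]] by (simp add: K_def)
  have C: "k < M" "Suc i \<in> T (r, k)" "i \<notin> T (r, k)" if k: "k \<in> C" for k
  proof -
    show kM: "k < M" using k cM K_le by (auto simp: C_def less_le)
    have "Suc i \<in> T (r, k) \<and> i \<notin> T (r, k)"
    proof (cases "k = c")
      case False
      then have kK: "k \<in> K" "c < k" using k cx by (auto simp: C_def K_def)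
      have "w = Suc i" if w: "w \<in> T (r, k)" for w
      proof -
        have "\<not> w \<le> i"
          using lower_rule[OF w, of i M i] MK kK kM by (auto simp: K_def)
        then show ?thesis using above_le[OF w kK] by simp
      qed
      moreover obtain w where "w \<in> T (r, k)" using ex_value[OF SDK[OF kK(1)]] by blast
      ultimately show ?thesis by fastforce
    qed (use c in simp)
    then show "Suc i \<in> T (r, k)" "i \<notin> T (r, k)" by auto
  qed
  \<comment> \<open>The count starts at the rightmost column of \<open>C\<close>, whose box in row
    \<open>r\<close> is read first among them; from there to the left, row \<open>r\<close> contains
    no \<open>i\<close>.\<close>
  define k0 where "k0 = Max C"
  have k0: "k0 \<in> C" unfolding k0_def using finC by (intro Max_in) (auto simp: C_def)
  have C_le: "k \<le> k0" if "k \<in> C" for k unfolding k0_def using finC that by simp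
  have no_i: "i \<notin> T (r, m)" if "m \<le> k0" for m
  proof
    assume m: "i \<in> T (r, m)"
    then have mk: "m < k0" using C(3)[OF k0] that by (cases "m = k0") auto
    obtain w where w: "w \<in> T (r, M)" using ex_value[OF SDK[OF MK]] by blast
    have "Suc i < w" using row_rule[OF m C(2)[OF k0] w mk C(1)[OF k0]] by simp
    then show False using above_le[OF w MK cM] by simp
  qed
  let ?Y = "(r, k0)"
  let ?P = "\<lambda>b. (b = ?Y \<or> before ?Y b) \<and> before b X"
  have YSD: "?Y \<in> SD lam" using mem_SD[OF C(2)[OF k0]] .
  have "{b. ?P b \<and> i \<in> T b} \<subseteq> Pair (Suc r) ` (K - {x})"
  proof
    fix b assume b: "b \<in> {b. ?P b \<and> i \<in> T b}"
    then consider m where "b = (r, m)" "m \<le> k0" | m where "b = (Suc r, m)" "x < m"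
      using X by (cases b) auto
    then show "b \<in> Pair (Suc r) ` (K - {x})"
      using b no_i by cases (auto simp: K_def)
  qed
  then have "card {b. ?P b \<and> i \<in> T b} \<le> card (Pair (Suc r) ` (K - {x}))"
    using finK by (intro card_mono) auto
  also have "\<dots> < card K"
    using card_Diff1_less[OF finK xK] by (simp add: card_image inj_on_def)
  finally have up: "card {b. ?P b \<and> i \<in> T b} < card K" .
  have C_sub: "Pair r ` C \<subseteq> {b. ?P b \<and> Suc i \<in> T b}"
  proof
    fix b assume "b \<in> Pair r ` C"
    then obtain k where k: "b = (r, k)" "k \<in> C" by blast
    then show "b \<in> {b. ?P b \<and> Suc i \<in> T b}"
      using C_le[OF k(2)] C(2)[OF k(2)] X by (cases "k = k0") auto
  qed
  have "card K \<le> card {b. ?P b \<and> Suc i \<in> T b}"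
  proof (cases "c < x")
    case True
    then have "c \<notin> K - {M}" by (simp add: K_def)
    then have "card C = Suc (card (K - {M}))" using finK by (simp add: C_def)
    then have "card C = card K" using card_Suc_Diff1[OF finK MK] by simp
    then have "card (Pair r ` C) = card K" by (simp add: card_image inj_on_def)
    then show ?thesis using card_mono[OF finite_boxes C_sub] by simp
  next
    case False
    then obtain d where d: "c = x" "x < d" "Suc i \<in> T (Suc r, d)" using cx by blast
    then have "C = K - {M}" using xK cM by (auto simp: C_def)
    then have "Suc (card C) = card K" using card_Suc_Diff1[OF finK MK] by simp
    moreover have "card (insert (Suc r, d) (Pair r ` C)) = Suc (card C)"
      using finC by (subst card_insert_disjoint) (auto simp: card_image inj_on_def)
    moreover have "insert (Suc r, d) (Pair r ` C) \<subseteq> {b. ?P b \<and> Suc i \<in> T b}"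
      using C_sub d X by auto
    ultimately have "card K \<le> card (insert (Suc r, d) (Pair r ` C))" and
      sub: "insert (Suc r, d) (Pair r ` C) \<subseteq> {b. ?P b \<and> Suc i \<in> T b}" by simp_all
    then show ?thesis using card_mono[OF finite_boxes sub] by simp
  qed
  then show False using card_before[OF YSD] up X by simp
qed

text \<open>Serves two patterns: for the diagonal one, \<open>c = r\<close> and there is no third
  box, so \<open>z\<close> is arbitrary subject to \<open>i \<le> z\<close>; otherwise
  \<open>z\<close> is the letter below column \<open>c\<close> in the \<open>lower\<close> pattern.
  In both, a rule of the old filling excludes \<open>i\<close> from the box holding
  \<open>i + 1\<close>, as the count requires.\<close>

lemma f_lower_right:
  assumes X: "X = (Suc r, d)" "i \<in> T X" and c: "Suc i \<in> T (r, c)" "c = r \<or> c < d \<and> z \<in> T (Suc r, c)" "i \<le> z"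
  shows False
proof -
  have rd: "r < d" using pivot_SD SD_col X by fastforce
  have "i \<notin> T (r, c)"
    using c diag_rule[of i r i d] lower_rule[of i r c i d z] X by auto
  then show False using f_count[OF X c(1)] c(2) rd by auto
qed

text \<open>The \<open>i + 1\<close> of column \<open>d\<close> is closed by an \<open>i\<close>
  right of \<open>X\<close>. The lower rule with this \<open>i\<close> and the one of
  \<open>X\<close> makes every letter above \<open>X\<close> larger than \<open>i\<close>, so
  \<open>x\<close> equals \<open>i + 1\<close> and the second alternative of \<open>f_count\<close>
  applies.\<close>

lemma f_lower_left:
  assumes X: "X = (Suc r, c)" "i \<in> T X" and cd: "c < d" and x: "x \<in> T (r, c)" "x \<le> Suc i"
    and d: "Suc i \<in> T (Suc r, d)"
  shows False
proof -
  obtain Z where Z: "i \<in> T Z" "before Z X" "Z = (Suc r, d) \<or> before (Suc r, d) Z"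
    using before_ex[of "(Suc r, d)"] d X cd by auto
  then obtain m where m: "Z = (Suc r, m)" "c < m" using X by (cases Z) auto
  have gt: "i < w" if "w \<in> T (r, c)" for w
    using lower_rule[OF that, of i m i] Z(1) m X by fastforce
  have "x = Suc i" using gt[OF x(1)] x(2) by simp
  then show False using f_count[OF X, of c] gt[of i] x(1) cd d by auto
qed

text \<open>The large letter \<open>z\<close> above the partner clears the gap: it leaves no letter
  up to \<open>i + 1\<close> right of the partner and no \<open>i + 1\<close> left of
  \<open>X\<close>. An opening letter in the segment can thus lie only in the partner, which comes
  last and opens nothing before it.\<close>

lemma f_upper_left:
  assumes X: "X = (r, a)" "i \<in> T X" and ac: "a < c" and c: "i \<in> T (Suc r, c)"
    and z: "z \<in> T (r, c)" "Suc i < z"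
  shows "f_partner (Suc r, c)"
proof -
  have right: False if d: "w \<in> T (Suc r, d)" "c < d" "w \<le> Suc i" for w d
  proof -
    obtain h where h: "h \<in> T (r, d)" using SD_up[OF mem_SD[OF z(1)] mem_SD[OF d(1)]] ex_value by blast
    have "z < h" using row_rule[of i r a z c h d] X z h ac d by auto
    moreover have "h \<le> z" using upper_rule[OF z(1) h d(1)] d z(2) by simp
    ultimately show False by simp
  qed
  have left: "Suc i \<notin> T (r, e)" if "e < a" for e
    using upper_rule[of "Suc i" r e z c i] z c that ac by auto
  have only_c: "m = (Suc r, c) \<and> Suc i \<in> T (Suc r, c)"
    if m: "i \<in> T m" "before X m" "m = (Suc r, c) \<or> before m (Suc r, c)" for m
  proof -
    obtain Z where Z: "Suc i \<in> T Z" "before X Z" "Z = m \<or> before Z m"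
      using after_ex[OF m(1,2)] .
    then have "Z = (Suc r, c) \<or> before Z (Suc r, c)" using m(3) before_trans by blast
    then consider e where "Z = (r, e)" "e < a" | e where "Z = (Suc r, e)" "c \<le> e"
      using X Z by (cases Z) auto
    then show ?thesis
    proof cases
      case 1
      then show ?thesis using left Z(1) by auto
    next
      case 2
      then have "e = c" using right[of "Suc i" e] Z(1) by (cases "e = c") auto
      then have "Z = (Suc r, c)" using 2 by simp
      then show ?thesis using Z m(3) before_asym by blast
    qed
  qed
  show ?thesis
    unfolding f_partner_def
  proof (intro conjI allI impI)
    show "Suc i \<in> T (Suc r, c)" using only_c[of "(Suc r, c)"] c X by auto
    fix m assume m: "before X m" "before m (Suc r, c)"
    then show "i \<notin> T m" using only_c[of m] before_irrefl by auto
    consider e where "m = (r, e)" "e < a" | e where "m = (Suc r, e)" "c < e"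
      using X m by (cases m) auto
    then show "Suc i \<notin> T m" using left right[of "Suc i"] by cases auto
  qed (use X c in auto)
qed

text \<open>\<open>X\<close> keeps \<open>i + 1\<close> beside the new \<open>i\<close>, so one
  statement covers both the plain replacement and the slid filling. The cases distinguish the place
  of the new \<open>i\<close> in the pattern. Using \<open>i + 1\<close> there instead must not give
  a pattern, which is contradictory or pins another letter to \<open>i\<close> or
  \<open>i + 1\<close>.\<close>

lemma bad_pattern_after_e:
  assumes "Suc i \<in> T X" "bad_pattern V" "V \<subseteq> Sigma UNIV (T(X := insert i (T X)))"
  obtains A where "(A, Suc i) \<in> V" "e_partner A"
proof -
  have "\<exists>A. (A, Suc i) \<in> V \<and> e_partner A"
    using assms(2)
  proof cases
    case (row j k l x y z r)
    have in': "x \<in> T (r, j) \<or> X = (r, j) \<and> x = i" "y \<in> T (r, k) \<or> X = (r, k) \<and> y = i"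
      "z \<in> T (r, l) \<or> X = (r, l) \<and> z = i"
      using assms(3) row by (auto split: if_splits)
    consider "x \<in> T (r, j)" "y \<in> T (r, k)" "z \<in> T (r, l)" | "X = (r, j)" "x = i" "y \<in> T (r, k)" "z \<in> T (r, l)"
      | "X = (r, k)" "y = i" "x \<in> T (r, j)" "z \<in> T (r, l)" | "X = (r, l)" "z = i" "x \<in> T (r, j)" "y \<in> T (r, k)"
      using in' row by auto
    then show ?thesis
    proof cases
      case 1
      then show ?thesis using row_rule[OF 1] row by simp
    next
      case 2
      have "\<not> Suc i < y" using row_rule[of "Suc i" r j y k z l] 2 assms(1) row by auto
      then have "y = Suc i" using row 2 by simp
      then show ?thesis using e_row_first[OF 2(1), of k l z] 2 row by auto
    next
      case 3
      then show ?thesis using row_rule[of x r j "Suc i" k z l] assms(1) row by auto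
    next
      case 4
      have "\<not> Suc i \<le> y" using row_rule[of x r j y k "Suc i" l] 4 assms(1) row by auto
      then have "y = i" using row 4 by simp
      then show ?thesis using e_row_last[OF 4(1) assms(1), of j k x] 4 row by auto
    qed
  next
    case (diagonal x y r d)
    have in': "x \<in> T (r, r) \<or> X = (r, r) \<and> x = i" "y \<in> T (Suc r, d) \<or> X = (Suc r, d) \<and> y = i"
      using assms(3) diagonal by (auto split: if_splits)
    consider "x \<in> T (r, r)" "y \<in> T (Suc r, d)" | "X = (r, r)" "x = i" "y \<in> T (Suc r, d)"
      | "X = (Suc r, d)" "y = i" "x \<in> T (r, r)"
      using in' by auto
    then show ?thesis
    proof cases
      case 1
      then show ?thesis using diag_rule[OF 1] diagonal by simp
    next
      case 2
      have "y < Suc i" using diag_rule[of "Suc i" r y d] 2 assms(1) by simp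
      then have "y = i" using diagonal 2 by simp
      then show ?thesis using e_diagonal[OF 2(1) assms(1), of d] 2 by simp
    next
      case 3
      then show ?thesis using diag_rule[of x r "Suc i" d] assms(1) diagonal by auto
    qed
  next
    case (lower c d x y z r)
    have in': "x \<in> T (r, c) \<or> X = (r, c) \<and> x = i" "y \<in> T (Suc r, d) \<or> X = (Suc r, d) \<and> y = i"
      "z \<in> T (Suc r, c) \<or> X = (Suc r, c) \<and> z = i"
      using assms(3) lower by (auto split: if_splits)
    consider "x \<in> T (r, c)" "y \<in> T (Suc r, d)" "z \<in> T (Suc r, c)"
      | "X = (r, c)" "x = i" "y \<in> T (Suc r, d)" "z \<in> T (Suc r, c)"
      | "X = (Suc r, d)" "y = i" "x \<in> T (r, c)" "z \<in> T (Suc r, c)"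
      | "X = (Suc r, c)" "z = i" "x \<in> T (r, c)" "y \<in> T (Suc r, d)"
      using in' lower by auto
    then show ?thesis
    proof cases
      case 1
      then show ?thesis using lower_rule[OF 1] lower by simp
    next
      case 2
      have "\<not> Suc i \<le> y" using lower_rule[of "Suc i" r c y d z] 2 assms(1) lower by auto
      then have "y = i" using lower 2 by simp
      then show ?thesis using e_lower_upper_left[OF 2(1) assms(1), of d z] 2 lower by simp
    next
      case 3
      have "z < Suc i" using lower_rule[of x r c "Suc i" d z] 3 assms(1) lower by auto
      then have "z = i" using lower 3 by simp
      then show ?thesis using e_lower_right[OF 3(1) assms(1), of c x] 3 lower by simp
    next
      case 4
      then show ?thesis using lower_rule[of x r c y d "Suc i"] assms(1) lower by auto
    qed
  next
    case (upper a c y x z r)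
    have in': "x \<in> T (r, a) \<or> X = (r, a) \<and> x = i" "z \<in> T (r, c) \<or> X = (r, c) \<and> z = i"
      "y \<in> T (Suc r, c) \<or> X = (Suc r, c) \<and> y = i"
      using assms(3) upper by (auto split: if_splits)
    consider "x \<in> T (r, a)" "z \<in> T (r, c)" "y \<in> T (Suc r, c)"
      | "X = (r, a)" "x = i" "z \<in> T (r, c)" "y \<in> T (Suc r, c)"
      | "X = (r, c)" "z = i" "x \<in> T (r, a)" "y \<in> T (Suc r, c)"
      | "X = (Suc r, c)" "y = i" "x \<in> T (r, a)" "z \<in> T (r, c)"
      using in' upper by auto
    then show ?thesis
    proof cases
      case 1
      then show ?thesis using upper_rule[OF 1] upper by simp
    next
      case 2
      have "z \<le> Suc i" using upper_rule[of "Suc i" r a z c y] 2 assms(1) upper by auto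
      then have "z = Suc i" using upper 2 by simp
      then show ?thesis using e_upper_left[OF 2(1), of c y] 2 upper by auto
    next
      case 3
      then show ?thesis using upper_rule[of x r a "Suc i" c y] assms(1) upper by auto
    next
      case 4
      have "\<not> Suc i < x" using upper_rule[of x r a z c "Suc i"] 4 assms(1) upper by auto
      then have "x = Suc i" using upper 4 by simp
      then show ?thesis using e_upper_below[OF 4(1) assms(1), of a z] 4 upper by auto
    qed
  qed
  then show thesis using that by blast
qed

text \<open>Again the new letter is added without removing the old one. Wherever
  \<open>i + 1\<close> appears in the pattern, the same pattern with the old \<open>i\<close> of
  \<open>X\<close> must be absent, and this fixes the remaining critical letter.\<close>

lemma bad_pattern_after_f:
  assumes "i \<in> T X" "bad_pattern V" "V \<subseteq> Sigma UNIV (T(X := insert (Suc i) (T X)))"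
  obtains A where "(A, i) \<in> V" "f_partner A"
proof -
  have "\<exists>A. (A, i) \<in> V \<and> f_partner A"
    using assms(2)
  proof cases
    case (row j k l x y z r)
    have in': "x \<in> T (r, j) \<or> X = (r, j) \<and> x = Suc i" "y \<in> T (r, k) \<or> X = (r, k) \<and> y = Suc i"
      "z \<in> T (r, l) \<or> X = (r, l) \<and> z = Suc i"
      using assms(3) row by (auto split: if_splits)
    consider "x \<in> T (r, j)" "y \<in> T (r, k)" "z \<in> T (r, l)" | "X = (r, j)" "x = Suc i" "y \<in> T (r, k)" "z \<in> T (r, l)"
      | "X = (r, k)" "y = Suc i" "x \<in> T (r, j)" "z \<in> T (r, l)" | "X = (r, l)" "z = Suc i" "x \<in> T (r, j)" "y \<in> T (r, k)"
      using in' row by auto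
    then show ?thesis
    proof cases
      case 1
      then show ?thesis using row_rule[OF 1] row by simp
    next
      case 2
      then show ?thesis using row_rule[of i r j y k z l] assms(1) row by auto
    next
      case 3
      show ?thesis
      proof (cases "x = i")
        case True
        then show ?thesis using f_row_left[OF 3(1) assms(1), of j] 3 row by auto
      next
        case False
        then have "x < i" using row 3 by simp
        then have "i < z" using row_rule[of x r j i k z l] 3 assms(1) row by auto
        then have "z = Suc i" using row 3 by simp
        then show ?thesis using f_row_middle[OF 3(1) assms(1), of j l x] 3 row \<open>x < i\<close> by simp
      qed
    next
      case 4
      then show ?thesis using row_rule[of x r j y k i l] assms(1) row by auto
    qed
  next
    case (diagonal x y r d)
    have in': "x \<in> T (r, r) \<or> X = (r, r) \<and> x = Suc i" "y \<in> T (Suc r, d) \<or> X = (Suc r, d) \<and> y = Suc i"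
      using assms(3) diagonal by (auto split: if_splits)
    consider "x \<in> T (r, r)" "y \<in> T (Suc r, d)" | "X = (r, r)" "x = Suc i" "y \<in> T (Suc r, d)"
      | "X = (Suc r, d)" "y = Suc i" "x \<in> T (r, r)"
      using in' by auto
    then show ?thesis
    proof cases
      case 1
      then show ?thesis using diag_rule[OF 1] diagonal by simp
    next
      case 2
      then show ?thesis using diag_rule[of i r y d] assms(1) diagonal by auto
    next
      case 3
      have "i < x" using diag_rule[of x r i d] 3 assms(1) by simp
      then have "x = Suc i" using diagonal 3 by simp
      then show ?thesis using f_lower_right[OF 3(1) assms(1), of r i] 3 by simp
    qed
  next
    case (lower c d x y z r)
    have in': "x \<in> T (r, c) \<or> X = (r, c) \<and> x = Suc i" "y \<in> T (Suc r, d) \<or> X = (Suc r, d) \<and> y = Suc i"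
      "z \<in> T (Suc r, c) \<or> X = (Suc r, c) \<and> z = Suc i"
      using assms(3) lower by (auto split: if_splits)
    consider "x \<in> T (r, c)" "y \<in> T (Suc r, d)" "z \<in> T (Suc r, c)"
      | "X = (r, c)" "x = Suc i" "y \<in> T (Suc r, d)" "z \<in> T (Suc r, c)"
      | "X = (Suc r, d)" "y = Suc i" "x \<in> T (r, c)" "z \<in> T (Suc r, c)"
      | "X = (Suc r, c)" "z = Suc i" "x \<in> T (r, c)" "y \<in> T (Suc r, d)"
      using in' lower by auto
    then show ?thesis
    proof cases
      case 1
      then show ?thesis using lower_rule[OF 1] lower by simp
    next
      case 2
      then show ?thesis using lower_rule[of i r c y d z] assms(1) lower by auto
    next
      case 3
      have "\<not> x \<le> i" using lower_rule[of x r c i d z] 3 assms(1) lower by auto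
      then have "x = Suc i" using lower 3 by simp
      then show ?thesis using f_lower_right[OF 3(1) assms(1), of c z] 3 lower by simp
    next
      case 4
      have "i < y" using lower_rule[of x r c y d i] 4 assms(1) lower by auto
      then have "y = Suc i" using lower 4 by simp
      then show ?thesis using f_lower_left[OF 4(1) assms(1), of d x] 4 lower by simp
    qed
  next
    case (upper a c y x z r)
    have in': "x \<in> T (r, a) \<or> X = (r, a) \<and> x = Suc i" "z \<in> T (r, c) \<or> X = (r, c) \<and> z = Suc i"
      "y \<in> T (Suc r, c) \<or> X = (Suc r, c) \<and> y = Suc i"
      using assms(3) upper by (auto split: if_splits)
    consider "x \<in> T (r, a)" "z \<in> T (r, c)" "y \<in> T (Suc r, c)"
      | "X = (r, a)" "x = Suc i" "z \<in> T (r, c)" "y \<in> T (Suc r, c)"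
      | "X = (r, c)" "z = Suc i" "x \<in> T (r, a)" "y \<in> T (Suc r, c)"
      | "X = (Suc r, c)" "y = Suc i" "x \<in> T (r, a)" "z \<in> T (r, c)"
      using in' upper by auto
    then show ?thesis
    proof cases
      case 1
      then show ?thesis using upper_rule[OF 1] upper by simp
    next
      case 2
      have "\<not> y < i" using upper_rule[of i r a z c y] 2 assms(1) upper by auto
      then have "y = i" using upper 2 by simp
      then show ?thesis using f_upper_left[OF 2(1) assms(1), of c z] 2 upper by auto
    next
      case 3
      have "i \<le> x" using upper_rule[of x r a i c y] 3 assms(1) upper by auto
      then have "x = i" using upper 3 by simp
      then show ?thesis using f_row_left[OF 3(1) assms(1), of a] 3 upper by auto
    next
      case 4
      then show ?thesis using upper_rule[of x r a z c i] assms(1) upper by auto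
    qed
  qed
  then show thesis using that by blast
qed

end

section \<open>The operators as mutually inverse steps\<close>

definition repl :: "nat \<Rightarrow> nat \<Rightarrow> box \<Rightarrow> (box \<Rightarrow> nat set) \<Rightarrow> box \<Rightarrow> nat set" where
  "repl s t X T = T(X := insert t (T X - {s}))"

definition slide :: "nat \<Rightarrow> nat \<Rightarrow> box \<Rightarrow> box \<Rightarrow> (box \<Rightarrow> nat set) \<Rightarrow> box \<Rightarrow> nat set" where
  "slide s t A X T = T(A := T A - {s}, X := insert t (T X))"

lemma e_op_eq:
  "e_op lam i T = (if \<not> e_active lam i T then None
     else if setval_dec_tableau lam (repl (Suc i) i (e_box lam i T) T)
       then Some (repl (Suc i) i (e_box lam i T) T)
     else Some (slide (Suc i) i (last (e_partners lam i T)) (e_box lam i T) T))"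
  by (simp add: e_op_def e_replace_def repl_def slide_def Let_def)

lemma f_op_eq:
  "f_op lam i T = (if \<not> f_active lam i T then None
     else if setval_dec_tableau lam (repl i (Suc i) (f_box lam i T) T)
       then Some (repl i (Suc i) (f_box lam i T) T)
     else Some (slide i (Suc i) (hd (f_partners lam i T)) (f_box lam i T) T))"
  by (simp add: f_op_def f_replace_def repl_def slide_def Let_def)

text \<open>
  The last conjunct makes the relation symmetric: in case (b) it also rules out case (a) for \<open>f\<^sub>i\<close>
  on the result, so that \<open>e_step\<close> is at the same time the graph of \<open>e\<^sub>i\<close> and the converse of the
  graph of \<open>f\<^sub>i\<close>.
\<close>

definition e_step :: "nat list \<Rightarrow> nat \<Rightarrow> (box \<Rightarrow> nat set) \<Rightarrow> (box \<Rightarrow> nat set) \<Rightarrow> bool" where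
  "e_step lam i T T' \<longleftrightarrow> setval_dec_tableau lam T \<and> setval_dec_tableau lam T' \<and>
     ((\<exists>X. opens i lam T X \<and> T' = repl (Suc i) i X T) \<or>
      (\<exists>P A S X Q. revrow_boxes lam = P @ A # S @ X # Q \<and> opens i lam T X \<and>
         i \<in> T A \<and> Suc i \<in> T A \<and> (\<forall>m\<in>set S. i \<notin> T m \<and> Suc i \<notin> T m) \<and>
         T' = slide (Suc i) i A X T \<and>
         \<not> setval_dec_tableau lam (repl (Suc i) i X T) \<and>
         \<not> setval_dec_tableau lam (repl i (Suc i) A T')))"

lemma filling_finite: "filling lam T \<Longrightarrow> finite (T b)"
  unfolding filling_def by (metis finite.emptyI)

lemma filling_update:
  "filling lam T \<Longrightarrow> b \<in> SD lam \<Longrightarrow> finite S \<Longrightarrow> S \<noteq> {} \<Longrightarrow> S \<subseteq> {0<..} \<Longrightarrow> filling lam (T(b := S))"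
  unfolding filling_def by (auto simp del: split_paired_All)

lemma filling_pos: "filling lam T \<Longrightarrow> x \<in> T b \<Longrightarrow> 0 < x"
  unfolding filling_def by (metis empty_iff greaterThan_iff subsetD)

lemma filling_repl:
  assumes "filling lam T" "X \<in> SD lam" "0 < t" shows "filling lam (repl s t X T)"
  unfolding repl_def
  using assms by (intro filling_update) (auto simp: filling_finite dest: filling_pos)

text \<open>The letter \<open>t\<close> stays behind in \<open>A\<close>, so the removal of
  \<open>s\<close> empties no box.\<close>

lemma filling_slide:
  assumes "filling lam T" "X \<in> SD lam" "0 < t" "A \<in> SD lam" "t \<in> T A" "s \<noteq> t" "A \<noteq> X"
  shows "filling lam (slide s t A X T)"
proof -
  have "filling lam (T(A := T A - {s}))"
    using assms by (intro filling_update) (auto simp: filling_finite dest: filling_pos)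
  then show ?thesis unfolding slide_def
    using assms by (intro filling_update) (auto simp: filling_finite dest: filling_pos)
qed

lemma before_split:
  assumes "before A X" "A \<in> SD lam" "X \<in> SD lam"
  obtains P S Q where "revrow_boxes lam = P @ A # S @ X # Q"
    "\<forall>m\<in>set S. before A m \<and> before m X"
proof -
  obtain P R where R: "revrow_boxes lam = P @ A # R"
    using assms(2) unfolding set_revrow_boxes[symmetric] by (auto simp: in_set_conv_decomp)
  have srt: "sorted_wrt before (P @ A # R)" using revrow_boxes_sorted[of lam] R by simp
  have "X \<in> set (P @ A # R)" using assms(3) R set_revrow_boxes[of lam] by metis
  moreover have "X \<notin> set P" "X \<noteq> A"
    using srt before_asym[OF assms(1)] assms(1) before_irrefl[of A] unfolding sorted_wrt_append by fastforce+
  ultimately have "X \<in> set R" by simp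
  then obtain S Q where S: "R = S @ X # Q" by (auto simp: in_set_conv_decomp)
  show thesis
    by (rule that[of P S Q]) (use R S srt in \<open>auto simp: sorted_wrt_append\<close>)
qed

text \<open>No box occurs twice in the reading order, so every factorization at \<open>X\<close> is
  the one hidden in the definition of \<open>pivot\<close>.\<close>

lemma pivot_split:
  assumes "revrow_boxes lam = P @ X # Q"
  shows "pivot i lam T X \<longleftrightarrow> snd (box_sig i T P) = 0 \<and> fst (box_sig i T Q) = 0"
proof
  assume "pivot i lam T X"
  then obtain P' Q' where PQ: "P @ X # Q = P' @ X # Q'" "snd (box_sig i T P') = 0"
    "fst (box_sig i T Q') = 0"
    using assms by (auto simp: pivot_def)
  have dist: "distinct (P @ X # Q)" "distinct (P' @ X # Q')"
    using distinct_revrow_boxes[of lam] assms PQ(1) by simp_all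
  show "snd (box_sig i T P) = 0 \<and> fst (box_sig i T Q) = 0"
    using PQ(1) by (cases rule: append_Cons_eq_cases) (use PQ dist in auto)
qed (use assms in \<open>auto simp: pivot_def\<close>)

lemma opens_pivot: "opens i lam T X \<Longrightarrow> pivot i lam T X" "opens i lam T X \<Longrightarrow> Suc i \<in> T X"
  "opens i lam T X \<Longrightarrow> i \<notin> T X"
  by (simp_all add: opens_def)

lemma closes_pivot: "closes i lam T X \<Longrightarrow> pivot i lam T X" "closes i lam T X \<Longrightarrow> i \<in> T X"
  "closes i lam T X \<Longrightarrow> Suc i \<notin> T X"
  by (simp_all add: closes_def)

section \<open>The reduced word before and after a step\<close>

lemma box_sig_update: "X \<notin> set l \<Longrightarrow> box_sig i (T(X := S)) l = box_sig i T l"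
  by (rule sig_cong) (auto simp: box_paren_def)

lemma box_sig_gap: "(\<And>m. m \<in> set l \<Longrightarrow> i \<notin> T m \<and> Suc i \<notin> T m) \<Longrightarrow> box_sig i T l = (0, 0)"
  by (rule sig_zero) (auto simp: box_paren_def)

text \<open>Since no opening letter survives before \<open>X\<close> and no closing one after it,
  turning the letter of \<open>X\<close> around changes the reduced word just at its break, from
  \<open>(a, b + 1)\<close> to \<open>(a + 1, b)\<close>.\<close>

lemma e_step_repl:
  assumes "opens i lam T X"
  shows "closes i lam (repl (Suc i) i X T) X"
    "fst (box_sig i (repl (Suc i) i X T) (revrow_boxes lam)) = Suc (fst (box_sig i T (revrow_boxes lam)))"
    "snd (box_sig i T (revrow_boxes lam)) = Suc (snd (box_sig i (repl (Suc i) i X T) (revrow_boxes lam)))"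
proof -
  obtain P Q where PQ: "revrow_boxes lam = P @ X # Q" "snd (box_sig i T P) = 0" "fst (box_sig i T Q) = 0"
    using assms by (auto simp: opens_def pivot_def)
  have "distinct (P @ X # Q)" using distinct_revrow_boxes[of lam] PQ(1) by simp
  then have same: "box_sig i (repl (Suc i) i X T) P = box_sig i T P"
    "box_sig i (repl (Suc i) i X T) Q = box_sig i T Q"
    by (auto simp: repl_def box_sig_update)
  have X: "box_paren i (repl (Suc i) i X T) X = (1, 0)" "box_paren i T X = (0, 1)"
    using assms by (auto simp: box_paren_def repl_def opens_def)
  show "closes i lam (repl (Suc i) i X T) X"
    unfolding closes_def pivot_split[OF PQ(1)] using PQ same by (simp add: repl_def)
  show "fst (box_sig i (repl (Suc i) i X T) (revrow_boxes lam)) = Suc (fst (box_sig i T (revrow_boxes lam)))"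
    "snd (box_sig i T (revrow_boxes lam)) = Suc (snd (box_sig i (repl (Suc i) i X T) (revrow_boxes lam)))"
    unfolding PQ(1) using PQ(2,3) X same by (simp_all add: sig_append bmul_def)
qed

lemma f_step_repl:
  assumes "closes i lam T X"
  shows "opens i lam (repl i (Suc i) X T) X"
proof -
  obtain P Q where PQ: "revrow_boxes lam = P @ X # Q" "snd (box_sig i T P) = 0" "fst (box_sig i T Q) = 0"
    using assms by (auto simp: closes_def pivot_def)
  have "distinct (P @ X # Q)" using distinct_revrow_boxes[of lam] PQ(1) by simp
  then have same: "box_sig i (repl i (Suc i) X T) P = box_sig i T P"
    "box_sig i (repl i (Suc i) X T) Q = box_sig i T Q"
    by (auto simp: repl_def box_sig_update)
  show "opens i lam (repl i (Suc i) X T) X"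
    unfolding opens_def pivot_split[OF PQ(1)] using PQ same by (simp add: repl_def)
qed

text \<open>\<open>A\<close> changes from a unit to a closing letter and \<open>X\<close> from an
  opening letter to a unit, with nothing in between. The reduced word changes as under a plain
  replacement, but the acting box moves from \<open>X\<close> to \<open>A\<close>.\<close>

lemma e_step_slide:
  assumes bs: "revrow_boxes lam = P @ A # S @ X # Q" and X: "opens i lam T X"
    and A: "i \<in> T A" "Suc i \<in> T A" and S: "\<forall>m\<in>set S. i \<notin> T m \<and> Suc i \<notin> T m"
  defines "T' \<equiv> slide (Suc i) i A X T"
  shows "closes i lam T' A"
    "fst (box_sig i T' (revrow_boxes lam)) = Suc (fst (box_sig i T (revrow_boxes lam)))"
    "snd (box_sig i T (revrow_boxes lam)) = Suc (snd (box_sig i T' (revrow_boxes lam)))"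
proof -
  have dist: "distinct (P @ A # S @ X # Q)" using distinct_revrow_boxes[of lam] bs by simp
  then have same: "box_sig i T' P = box_sig i T P" "box_sig i T' Q = box_sig i T Q"
    "box_sig i T' S = box_sig i T S" and AX: "A \<noteq> X"
    by (auto simp: T'_def slide_def box_sig_update)
  have S0: "box_sig i T S = (0, 0)" using S by (intro box_sig_gap) auto
  have bs': "revrow_boxes lam = (P @ A # S) @ X # Q" using bs by simp
  have bx: "box_paren i T A = (0, 0)" "box_paren i T X = (0, 1)" "box_paren i T' A = (1, 0)"
    "box_paren i T' X = (0, 0)"
    using A X AX by (auto simp: box_paren_def opens_def T'_def slide_def)
  have PQ: "snd (box_sig i T P) = 0" "fst (box_sig i T Q) = 0"
    using opens_pivot(1)[OF X] unfolding pivot_split[OF bs'] by (simp_all add: sig_append S0 bx)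
  have "pivot i lam T' A"
    unfolding pivot_split[OF bs] using PQ by (simp add: sig_append same S0 bx)
  moreover have "i \<in> T' A" "Suc i \<notin> T' A" using A AX by (auto simp: T'_def slide_def)
  ultimately show "closes i lam T' A" by (simp add: closes_def)
  show "fst (box_sig i T' (revrow_boxes lam)) = Suc (fst (box_sig i T (revrow_boxes lam)))"
    "snd (box_sig i T (revrow_boxes lam)) = Suc (snd (box_sig i T' (revrow_boxes lam)))"
    unfolding bs using PQ by (simp_all add: sig_append same S0 bx bmul_def)
qed

lemma e_partners_split:
  assumes bs: "revrow_boxes lam = P @ A # S @ X # Q" and X: "e_box lam i T = X"
    and A: "i \<in> T A" "Suc i \<in> T A" and S: "\<forall>m\<in>set S. i \<notin> T m \<and> Suc i \<notin> T m"
  shows "e_partners lam i T \<noteq> [] \<and> last (e_partners lam i T) = A"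
proof -
  have dist: "distinct (P @ A # S @ X # Q)" using distinct_revrow_boxes[of lam] bs by simp
  have "takeWhile (\<lambda>b. b \<noteq> X) ((P @ A # S) @ X # Q) = P @ A # S"
    using dist by (subst takeWhile_append2) auto
  moreover have "filter (\<lambda>b. {i, i + 1} \<subseteq> T b) S = []" using S by (auto simp: filter_empty_conv)
  ultimately show ?thesis using A by (simp add: e_partners_def X bs)
qed

lemma f_partners_split:
  assumes bs: "revrow_boxes lam = P @ X # S @ A # Q" and X: "f_box lam i T = X"
    and A: "i \<in> T A" "Suc i \<in> T A" and S: "\<forall>m\<in>set S. i \<notin> T m \<and> Suc i \<notin> T m"
  shows "f_partners lam i T \<noteq> [] \<and> hd (f_partners lam i T) = A"
proof -
  have dist: "distinct (P @ X # S @ A # Q)" using distinct_revrow_boxes[of lam] bs by simp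
  have "dropWhile (\<lambda>b. b \<noteq> X) (P @ X # S @ A # Q) = X # S @ A # Q"
    using dist by (subst dropWhile_append2) auto
  moreover have "filter (\<lambda>b. {i, i + 1} \<subseteq> T b) S = []" using S by (auto simp: filter_empty_conv)
  ultimately show ?thesis using A by (simp add: f_partners_def X bs)
qed

section \<open>Existence of steps and agreement with the operators\<close>

context
  fixes lam :: "nat list"
  assumes lam: "strict_partition lam"
begin

lemma setval_filling: "setval_dec_tableau lam T \<Longrightarrow> filling lam T"
  and setval_avoids: "setval_dec_tableau lam T \<Longrightarrow> avoids T"
  by (simp_all add: setval_dec_tableau_iff[OF lam])

lemma setval_finite: "setval_dec_tableau lam T \<Longrightarrow> \<forall>b. finite (T b)"
  using setval_filling filling_finite by blast

lemma ex_bad_pattern: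
  assumes "filling lam T" "\<not> setval_dec_tableau lam T"
  obtains V where "bad_pattern V" "V \<subseteq> Sigma UNIV T"
  using assms by (auto simp: setval_dec_tableau_iff[OF lam] avoids_def)

lemma not_setval_bad_pattern:
  "bad_pattern V \<Longrightarrow> V \<subseteq> Sigma UNIV T \<Longrightarrow> \<not> setval_dec_tableau lam T"
  by (auto simp: setval_dec_tableau_iff[OF lam] avoids_def)

context
  fixes i :: nat
  assumes i: "0 < i"
begin

lemma e_step_imp_e_op:
  assumes "e_step lam i T T'" shows "e_op lam i T = Some T'"
  using assms unfolding e_step_def
proof (elim conjE disjE exE)
  fix X assume T: "setval_dec_tableau lam T" "setval_dec_tableau lam T'"
    and X: "opens i lam T X" "T' = repl (Suc i) i X T"
  then show ?thesis using e_box_eqI[OF setval_finite[OF T(1)] X(1)] by (simp add: e_op_eq)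
next
  fix P A S X Q
  assume T: "setval_dec_tableau lam T" and step: "revrow_boxes lam = P @ A # S @ X # Q"
    "opens i lam T X" "i \<in> T A" "Suc i \<in> T A" "\<forall>m\<in>set S. i \<notin> T m \<and> Suc i \<notin> T m"
    "T' = slide (Suc i) i A X T" "\<not> setval_dec_tableau lam (repl (Suc i) i X T)"
  note X = e_box_eqI[OF setval_finite[OF T] step(2)]
  show ?thesis
    using X e_partners_split[OF step(1) X(2) step(3-5)] step(6,7) by (simp add: e_op_eq)
qed

lemma e_step_imp_f_op:
  assumes "e_step lam i T T'" shows "f_op lam i T' = Some T"
  using assms unfolding e_step_def
proof (elim conjE disjE exE)
  fix X assume T: "setval_dec_tableau lam T" "setval_dec_tableau lam T'"
    and X: "opens i lam T X" "T' = repl (Suc i) i X T"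
  have "repl i (Suc i) X T' = T"
    using X by (auto simp: repl_def fun_eq_iff opens_def)
  then show ?thesis
    using f_box_eqI[OF setval_finite[OF T(2)] e_step_repl(1)[OF X(1), folded X(2)]] T(1)
    by (simp add: f_op_eq)
next
  fix P A S X Q
  assume T: "setval_dec_tableau lam T'" and step: "revrow_boxes lam = P @ A # S @ X # Q"
    "opens i lam T X" "i \<in> T A" "Suc i \<in> T A" "\<forall>m\<in>set S. i \<notin> T m \<and> Suc i \<notin> T m"
    "T' = slide (Suc i) i A X T" "\<not> setval_dec_tableau lam (repl i (Suc i) A T')"
  have dist: "distinct (P @ A # S @ X # Q)" using distinct_revrow_boxes[of lam] step(1) by simp
  then have AX: "A \<noteq> X" "A \<notin> set S" "X \<notin> set S" by auto
  note A = f_box_eqI[OF setval_finite[OF T] e_step_slide(1)[OF step(1-5), folded step(6)]]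
  have S: "\<forall>m\<in>set S. i \<notin> T' m \<and> Suc i \<notin> T' m" using step(5,6) AX by (auto simp: slide_def)
  have X: "i \<in> T' X" "Suc i \<in> T' X" using step(2,6) by (auto simp: slide_def opens_def)
  have "slide i (Suc i) X A T' = T"
    using step AX by (auto simp: slide_def fun_eq_iff opens_def)
  then show ?thesis
    using A f_partners_split[OF step(1) A(2) X S] step(7) by (simp add: f_op_eq)
qed

lemma ex_e_step:
  assumes T: "setval_dec_tableau lam T" and act: "e_active lam i T"
  shows "\<exists>T'. e_step lam i T T'"
    "\<not> setval_dec_tableau lam (e_replace lam i T) \<Longrightarrow> e_partners lam i T \<noteq> []"
proof -
  note fill = setval_filling[OF T]
  define X where "X = e_box lam i T"
  have X: "opens i lam T X" using e_box_opens[OF setval_finite[OF T] act] by (simp add: X_def)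
  interpret pivot_box lam T i X
    using lam fill setval_avoids[OF T] opens_pivot(1)[OF X] by unfold_locales
  have rep: "e_replace lam i T = repl (Suc i) i X T"
    by (simp add: e_replace_def repl_def X_def Let_def)
  have "(\<exists>T'. e_step lam i T T') \<and>
    (\<not> setval_dec_tableau lam (e_replace lam i T) \<longrightarrow> e_partners lam i T \<noteq> [])"
  proof (cases "setval_dec_tableau lam (repl (Suc i) i X T)")
    case True
    then have "e_step lam i T (repl (Suc i) i X T)" unfolding e_step_def using T X by blast
    then show ?thesis using True rep by auto
  next
    case False
    let ?T = "T(X := insert i (T X))"
    \<comment> \<open>This pattern serves twice: it yields the partner \<open>A\<close>, and it
      later shows that the plain raising at \<open>A\<close> fails too.\<close>
    obtain V where V: "bad_pattern V" "V \<subseteq> Sigma UNIV (repl (Suc i) i X T)"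
      by (rule ex_bad_pattern[OF filling_repl[OF fill pivot_SD i] False])
    have "Sigma UNIV (repl (Suc i) i X T) \<subseteq> Sigma UNIV ?T"
      by (intro Sigma_mono) (auto simp: repl_def)
    then obtain A where A: "(A, Suc i) \<in> V" "e_partner A"
      using bad_pattern_after_e[OF opens_pivot(2)[OF X] V(1)] V(2) by blast
    have A': "i \<in> T A" "Suc i \<in> T A" "before A X" using A(2) by (auto simp: e_partner_def)
    have AX: "A \<noteq> X" using A'(3) before_irrefl by metis
    have ASD: "A \<in> SD lam" using mem_SD A'(1) .
    obtain P S Q where bs: "revrow_boxes lam = P @ A # S @ X # Q"
      "\<forall>m\<in>set S. before A m \<and> before m X"
      by (rule before_split[OF A'(3) ASD pivot_SD])
    have S: "\<forall>m\<in>set S. i \<notin> T m \<and> Suc i \<notin> T m" using bs(2) A(2) by (auto simp: e_partner_def)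
    define T' where "T' = slide (Suc i) i A X T"
    have "avoids T'"
      unfolding avoids_def
    proof (intro allI impI notI)
      fix V' assume V': "bad_pattern V'" "V' \<subseteq> Sigma UNIV T'"
      have "Sigma UNIV T' \<subseteq> Sigma UNIV ?T"
        by (intro Sigma_mono) (auto simp: T'_def slide_def)
      then obtain B where B: "(B, Suc i) \<in> V'" "e_partner B"
        using bad_pattern_after_e[OF opens_pivot(2)[OF X] V'(1)] V'(2) by blast
      have "B = A" using before_total[of A B] A(2) B(2) unfolding e_partner_def by blast
      then show False using B(1) V'(2) AX by (auto simp: T'_def slide_def)
    qed
    moreover have "filling lam T'"
      unfolding T'_def using fill pivot_SD i ASD A'(1) AX by (intro filling_slide) auto
    ultimately have T': "setval_dec_tableau lam T'" by (simp add: setval_dec_tableau_iff[OF lam])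
    \<comment> \<open>In \<open>A\<close> the pattern uses only \<open>i + 1\<close>, which is
      exactly what raising at \<open>A\<close> restores; the \<open>i\<close> removed there is not
      part of it.\<close>
    have "V \<subseteq> Sigma UNIV (repl i (Suc i) A T')"
    proof
      fix p assume p: "p \<in> V"
      obtain b v where bv: "p = (b, v)" by (cases p)
      have v: "v \<in> repl (Suc i) i X T b" using V(2) p bv by auto
      have "v \<in> repl i (Suc i) A T' b"
      proof (cases "b = A")
        case True
        then have "v = Suc i" using bad_pattern_single_valued[OF V(1), of b v "Suc i"] p bv A(1) by simp
        then show ?thesis using True by (simp add: repl_def)
      next
        case False
        then show ?thesis using v by (auto simp: repl_def T'_def slide_def split: if_splits)
      qed
      then show "p \<in> Sigma UNIV (repl i (Suc i) A T')" using bv by auto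
    qed
    then have "\<not> setval_dec_tableau lam (repl i (Suc i) A T')" using V(1) not_setval_bad_pattern by blast
    then have "e_step lam i T T'"
      unfolding e_step_def using T T' bs(1) X A' S False T'_def by blast
    then show ?thesis using e_partners_split[OF bs(1) X_def[symmetric] A'(1,2) S] by blast
  qed
  then show "\<exists>T'. e_step lam i T T'"
    "\<not> setval_dec_tableau lam (e_replace lam i T) \<Longrightarrow> e_partners lam i T \<noteq> []"
    by auto
qed

lemma ex_f_step:
  assumes T: "setval_dec_tableau lam T" and act: "f_active lam i T"
  shows "\<exists>T'. e_step lam i T' T"
    "\<not> setval_dec_tableau lam (f_replace lam i T) \<Longrightarrow> f_partners lam i T \<noteq> []"
proof -
  note fill = setval_filling[OF T]
  define X where "X = f_box lam i T"
  have X: "closes i lam T X" using f_box_closes[OF setval_finite[OF T] act] by (simp add: X_def)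
  interpret pivot_box lam T i X
    using lam fill setval_avoids[OF T] closes_pivot(1)[OF X] by unfold_locales
  have rep: "f_replace lam i T = repl i (Suc i) X T"
    by (simp add: f_replace_def repl_def X_def Let_def)
  have "(\<exists>T'. e_step lam i T' T) \<and>
    (\<not> setval_dec_tableau lam (f_replace lam i T) \<longrightarrow> f_partners lam i T \<noteq> [])"
  proof (cases "setval_dec_tableau lam (repl i (Suc i) X T)")
    case True
    have "T = repl (Suc i) i X (repl i (Suc i) X T)"
      using X by (auto simp: repl_def fun_eq_iff closes_def)
    then have "e_step lam i (repl i (Suc i) X T) T"
      unfolding e_step_def using T True f_step_repl[OF X] by blast
    then show ?thesis using True rep by auto
  next
    case False
    let ?T = "T(X := insert (Suc i) (T X))"
    obtain V where V: "bad_pattern V" "V \<subseteq> Sigma UNIV (repl i (Suc i) X T)"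
      using ex_bad_pattern[OF filling_repl[OF fill pivot_SD] False] i by blast
    have "Sigma UNIV (repl i (Suc i) X T) \<subseteq> Sigma UNIV ?T"
      by (intro Sigma_mono) (auto simp: repl_def)
    then obtain A where A: "(A, i) \<in> V" "f_partner A"
      using bad_pattern_after_f[OF closes_pivot(2)[OF X] V(1)] V(2) by blast
    have A': "i \<in> T A" "Suc i \<in> T A" "before X A" using A(2) by (auto simp: f_partner_def)
    have AX: "A \<noteq> X" using A'(3) before_irrefl by metis
    have ASD: "A \<in> SD lam" using mem_SD A'(1) .
    obtain P S Q where bs: "revrow_boxes lam = P @ X # S @ A # Q"
      "\<forall>m\<in>set S. before X m \<and> before m A"
      by (rule before_split[OF A'(3) pivot_SD ASD])
    have S: "\<forall>m\<in>set S. i \<notin> T m \<and> Suc i \<notin> T m" using bs(2) A(2) by (auto simp: f_partner_def)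
    define T' where "T' = slide i (Suc i) A X T"
    have "avoids T'"
      unfolding avoids_def
    proof (intro allI impI notI)
      fix V' assume V': "bad_pattern V'" "V' \<subseteq> Sigma UNIV T'"
      have "Sigma UNIV T' \<subseteq> Sigma UNIV ?T"
        by (intro Sigma_mono) (auto simp: T'_def slide_def)
      then obtain B where B: "(B, i) \<in> V'" "f_partner B"
        using bad_pattern_after_f[OF closes_pivot(2)[OF X] V'(1)] V'(2) by blast
      have "B = A" using before_total[of A B] A(2) B(2) unfolding f_partner_def by blast
      then show False using B(1) V'(2) AX by (auto simp: T'_def slide_def)
    qed
    moreover have "filling lam T'"
      unfolding T'_def using fill pivot_SD i ASD A'(2) AX by (intro filling_slide) auto
    ultimately have T': "setval_dec_tableau lam T'" by (simp add: setval_dec_tableau_iff[OF lam])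
    have "V \<subseteq> Sigma UNIV (repl (Suc i) i A T')"
    proof
      fix p assume p: "p \<in> V"
      obtain b v where bv: "p = (b, v)" by (cases p)
      have v: "v \<in> repl i (Suc i) X T b" using V(2) p bv by auto
      have "v \<in> repl (Suc i) i A T' b"
      proof (cases "b = A")
        case True
        then have "v = i" using bad_pattern_single_valued[OF V(1), of b v i] p bv A(1) by simp
        then show ?thesis using True by (simp add: repl_def)
      next
        case False
        then show ?thesis using v by (auto simp: repl_def T'_def slide_def split: if_splits)
      qed
      then show "p \<in> Sigma UNIV (repl (Suc i) i A T')" using bv by auto
    qed
    then have inv: "\<not> setval_dec_tableau lam (repl (Suc i) i A T')" using V(1) not_setval_bad_pattern by blast
    have T_eq: "T = slide (Suc i) i X A T'"
      using X A' AX by (auto simp: T'_def slide_def fun_eq_iff closes_def)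
    have dist: "distinct (P @ X # S @ A # Q)" using distinct_revrow_boxes[of lam] bs(1) by simp
    have same: "box_sig i T' P = box_sig i T P" "box_sig i T' Q = box_sig i T Q"
      "box_sig i T' S = box_sig i T S"
      using dist by (auto simp: T'_def slide_def box_sig_update)
    have S0: "box_sig i T S = (0, 0)" using S by (intro box_sig_gap) auto
    have bs': "revrow_boxes lam = (P @ X # S) @ A # Q" using bs(1) by simp
    have bx: "box_paren i T A = (0, 0)" "box_paren i T' X = (0, 0)"
      using A' X AX by (auto simp: box_paren_def closes_def T'_def slide_def)
    \<comment> \<open>A step is directed from its opening end, which is here the new filling. Its
      pivot is \<open>A\<close>: the old \<open>A\<close>, the new \<open>X\<close> and the gap are
      all units, so the conditions for \<open>X\<close> and \<open>A\<close> coincide.\<close>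
    have "pivot i lam T' A"
      using pivot unfolding pivot_split[OF bs'] pivot_split[OF bs(1)]
      by (simp add: sig_append same S0 bx)
    then have "opens i lam T' A"
      using A' AX by (auto simp: opens_def T'_def slide_def)
    moreover have "i \<in> T' X" "Suc i \<in> T' X"
      using X AX by (auto simp: T'_def slide_def closes_def)
    moreover have "\<forall>m\<in>set S. i \<notin> T' m \<and> Suc i \<notin> T' m"
      using S dist by (auto simp: T'_def slide_def)
    ultimately have "e_step lam i T' T"
      unfolding e_step_def using T T' bs(1) inv False T_eq by blast
    then show ?thesis using f_partners_split[OF bs(1) X_def[symmetric] A'(1,2) S] by blast
  qed
  then show "\<exists>T'. e_step lam i T' T"
    "\<not> setval_dec_tableau lam (f_replace lam i T) \<Longrightarrow> f_partners lam i T \<noteq> []"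
    by auto
qed

text \<open>A defined value implies an active filling, hence a step; every step is the value of the
  operator, and an operator has one value only.\<close>

lemma e_op_iff_e_step:
  assumes "setval_dec_tableau lam T"
  shows "e_op lam i T = Some T' \<longleftrightarrow> e_step lam i T T'"
proof
  assume e: "e_op lam i T = Some T'"
  then have "e_active lam i T" by (auto simp: e_op_eq split: if_splits)
  then obtain T'' where "e_step lam i T T''" using ex_e_step(1)[OF assms] by blast
  then show "e_step lam i T T'" using e_step_imp_e_op e by fastforce
qed (rule e_step_imp_e_op)

lemma f_op_iff_e_step:
  assumes "setval_dec_tableau lam T"
  shows "f_op lam i T = Some T' \<longleftrightarrow> e_step lam i T' T"
proof
  assume f: "f_op lam i T = Some T'"
  then have "f_active lam i T" by (auto simp: f_op_eq split: if_splits)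
  then obtain T'' where "e_step lam i T'' T" using ex_f_step(1)[OF assms] by blast
  then show "e_step lam i T' T" using e_step_imp_f_op f by fastforce
qed (rule e_step_imp_f_op)

end

end

section \<open>Weights and string lengths\<close>

lemma e_step_sig:
  assumes "e_step lam i T T'"
  shows "fst (box_sig i T' (revrow_boxes lam)) = Suc (fst (box_sig i T (revrow_boxes lam))) \<and>
    snd (box_sig i T (revrow_boxes lam)) = Suc (snd (box_sig i T' (revrow_boxes lam)))"
  using assms unfolding e_step_def
proof (elim conjE disjE exE)
  fix X assume "opens i lam T X" "T' = repl (Suc i) i X T"
  then show ?thesis using e_step_repl(2,3) by blast
next
  fix P A S X Q
  assume "revrow_boxes lam = P @ A # S @ X # Q" "opens i lam T X" "i \<in> T A" "Suc i \<in> T A"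
    "\<forall>m\<in>set S. i \<notin> T m \<and> Suc i \<notin> T m" "T' = slide (Suc i) i A X T"
  then show ?thesis using e_step_slide(2,3)[of lam P A S X Q i T] by simp
qed

lemma e_step_setval:
  "e_step lam i T T' \<Longrightarrow> setval_dec_tableau lam T" "e_step lam i T T' \<Longrightarrow> setval_dec_tableau lam T'"
  by (auto simp: e_step_def)

lemma e_step_other: "e_step lam i T T' \<Longrightarrow> k \<noteq> i \<Longrightarrow> k \<noteq> Suc i \<Longrightarrow> k \<in> T' b \<longleftrightarrow> k \<in> T b"
  by (auto simp: e_step_def repl_def slide_def split: if_splits)

lemma e_step_card:
  assumes "e_step lam i T T'"
  shows "card {b \<in> SD lam. i \<in> T' b} = Suc (card {b \<in> SD lam. i \<in> T b})"
    "card {b \<in> SD lam. Suc i \<in> T b} = Suc (card {b \<in> SD lam. Suc i \<in> T' b})"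
proof -
  \<comment> \<open>Both kinds of step are treated at once: \<open>X\<close> gains \<open>i\<close>
    and \<open>A\<close> loses \<open>i + 1\<close>, with \<open>A = X\<close> for a plain
    replacement.\<close>
  obtain X A where XA: "X \<in> SD lam" "A \<in> SD lam" "Suc i \<in> T X" "i \<notin> T X" "Suc i \<in> T A" "i \<in> T A \<or> A = X"
    and T': "\<And>b. i \<in> T' b \<longleftrightarrow> i \<in> T b \<or> b = X" "\<And>b. Suc i \<in> T' b \<longleftrightarrow> Suc i \<in> T b \<and> b \<noteq> A"
  proof -
    note SD = set_revrow_boxes[of lam, symmetric]
    show thesis
      using assms unfolding e_step_def
    proof (elim conjE disjE exE)
      fix X assume "opens i lam T X" "T' = repl (Suc i) i X T"
      then show thesis by (intro that[of X X]) (auto simp: opens_def pivot_def SD repl_def)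
    next
      fix P A S X Q
      assume *: "revrow_boxes lam = P @ A # S @ X # Q" "opens i lam T X" "i \<in> T A" "Suc i \<in> T A"
        "T' = slide (Suc i) i A X T"
      have "A \<noteq> X" using * by (auto simp: opens_def)
      then show thesis using * by (intro that[of X A]) (auto simp: opens_def SD slide_def)
    qed
  qed
  have fin: "finite {b \<in> SD lam. P b}" for P using finite_SD by simp
  have "{b \<in> SD lam. i \<in> T' b} = insert X {b \<in> SD lam. i \<in> T b}" using XA T'(1) by auto
  then show "card {b \<in> SD lam. i \<in> T' b} = Suc (card {b \<in> SD lam. i \<in> T b})"
    using XA fin by simp
  have "{b \<in> SD lam. Suc i \<in> T b} = insert A {b \<in> SD lam. Suc i \<in> T' b}" using XA T'(2) by auto
  then show "card {b \<in> SD lam. Suc i \<in> T b} = Suc (card {b \<in> SD lam. Suc i \<in> T' b})"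
    using T'(2) fin by simp
qed

lemma e_step_wt:
  assumes "e_step lam i T T'" "i \<in> {1..<n}"
  shows "tab_wt n lam T' = (\<lambda>k. tab_wt n lam T k + basis_vec i k - basis_vec (i + 1) k)"
proof
  fix k
  consider "k = i" | "k = Suc i" | "k \<noteq> i" "k \<noteq> Suc i" by blast
  then show "tab_wt n lam T' k = tab_wt n lam T k + basis_vec i k - basis_vec (i + 1) k"
    using e_step_card[OF assms(1)] e_step_other[OF assms(1)] assms(2)
    by cases (auto simp: tab_wt_def basis_vec_def)
qed

text \<open>\<open>m\<close> is a countdown that drops by one along \<open>g\<close> and is zero
  where \<open>g\<close> stops. It will be the number of surviving opening or closing
  letters.\<close>

lemma string_len_eq:
  assumes step: "\<And>b c. b \<in> B \<Longrightarrow> g b = Some c \<Longrightarrow> c \<in> B \<and> m b = Suc (m c)"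
    and stop: "\<And>b. b \<in> B \<Longrightarrow> g b = None \<Longrightarrow> m b = 0" and b: "b \<in> B"
  shows "string_len g b = enat (m b)"
proof -
  have None_iter: "((\<lambda>x. Option.bind x g) ^^ k) None = None" for k by (induction k) auto
  have "iterate_op g k b \<noteq> None \<longleftrightarrow> k \<le> m b" for k
    using b
  proof (induction k arbitrary: b)
    case 0
    then show ?case by (simp add: iterate_op_def)
  next
    case (Suc k)
    show ?case
    proof (cases "g b")
      case None
      then have "iterate_op g (Suc k) b = None"
        using None_iter by (simp add: iterate_op_def funpow_Suc_right del: funpow.simps)
      then show ?thesis using stop[OF Suc.prems None] by simp
    next
      case (Some c)
      have "iterate_op g (Suc k) b = iterate_op g k c"
        by (simp add: iterate_op_def funpow_Suc_right Some del: funpow.simps)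
      then show ?thesis using step[OF Suc.prems Some] Suc.IH[of c] by simp
    qed
  qed
  then have "string_len g b = (SUP k\<in>{..m b}. enat k)"
    by (simp add: string_len_def atMost_def)
  also have "\<dots> = enat (m b)"
    by (intro antisym SUP_least SUP_upper) auto
  finally show ?thesis .
qed

section \<open>The odd operators and the crystal axioms\<close>

text \<open>Both odd operators in one: \<open>p\<close> and \<open>q\<close> are 1 and 2 in either
  order, and exchanging them inverts the operator.\<close>

definition bar_op :: "nat \<Rightarrow> nat \<Rightarrow> nat list \<Rightarrow> (box \<Rightarrow> nat set) \<Rightarrow> (box \<Rightarrow> nat set) option" where
  "bar_op p q lam T =
     (case List.find (\<lambda>b. 1 \<in> T b \<or> 2 \<in> T b) (revrow_boxes lam) of
        None \<Rightarrow> None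
      | Some Y \<Rightarrow> if p \<in> T Y \<and> q \<notin> T Y then Some (repl p q Y T) else None)"

lemma ebar_op_eq: "ebar_op lam = bar_op 2 1 lam"
  by (intro ext, unfold ebar_op_def bar_op_def repl_def) (rule refl)

lemma fbar_op_eq: "fbar_op lam = bar_op 1 2 lam"
  by (intro ext, unfold fbar_op_def bar_op_def repl_def) (rule refl)

definition first_box :: "nat list \<Rightarrow> (box \<Rightarrow> nat set) \<Rightarrow> box \<Rightarrow> bool" where
  "first_box lam T Y \<longleftrightarrow> List.find (\<lambda>b. 1 \<in> T b \<or> 2 \<in> T b) (revrow_boxes lam) = Some Y"

lemma bar_op_Some_iff:
  "bar_op p q lam T = Some U \<longleftrightarrow> (\<exists>Y. first_box lam T Y \<and> p \<in> T Y \<and> q \<notin> T Y \<and> U = repl p q Y T)"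
  by (auto simp: bar_op_def first_box_def split: option.splits)

lemma bar_opI:
  "first_box lam T Y \<Longrightarrow> p \<in> T Y \<Longrightarrow> q \<notin> T Y \<Longrightarrow> bar_op p q lam T = Some (repl p q Y T)"
  by (simp add: bar_op_def first_box_def)

lemma first_box_cong:
  assumes "\<And>b. 1 \<in> T' b \<or> 2 \<in> T' b \<longleftrightarrow> 1 \<in> T b \<or> 2 \<in> T b"
  shows "first_box lam T' Y \<longleftrightarrow> first_box lam T Y"
  using assms by (simp add: first_box_def)

lemma first_box_before:
  assumes "filling lam T" "first_box lam T Y" "before b Y"
  shows "1 \<notin> T b" "2 \<notin> T b"
proof -
  let ?bs = "revrow_boxes lam"
  obtain k where k: "k < length ?bs" "?bs ! k = Y" "\<forall>j<k. \<not> (1 \<in> T (?bs ! j) \<or> 2 \<in> T (?bs ! j))"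
    using assms(2) by (auto simp: first_box_def find_Some_iff)
  have "\<not> (1 \<in> T b \<or> 2 \<in> T b)"
  proof (cases "b \<in> SD lam")
    case True
    then obtain j where j: "j < length ?bs" "?bs ! j = b"
      unfolding set_revrow_boxes[symmetric] in_set_conv_nth by blast
    have "\<not> k < j"
      using sorted_wrt_nth_less[OF revrow_boxes_sorted, of k j lam] j k before_asym[OF assms(3)] by auto
    moreover have "k \<noteq> j" using j k assms(3) before_irrefl by blast
    ultimately show ?thesis using k(3) j by (metis linorder_neqE_nat)
  next
    case False
    then have "T b = {}" using assms(1) unfolding filling_def by blast
    then show ?thesis by simp
  qed
  then show "1 \<notin> T b" "2 \<notin> T b" by auto
qed

lemma first_box_SD: "first_box lam T Y \<Longrightarrow> Y \<in> SD lam"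
  unfolding first_box_def set_revrow_boxes[symmetric] by (auto simp: find_Some_iff)

section \<open>Exchanging 1 and 2 in the first possible box\<close>

context pattern_avoiding
begin

context
  fixes Y :: box
  assumes first: "first_box lam T Y"
begin

lemma early: "x \<in> T b \<Longrightarrow> before b Y \<Longrightarrow> 3 \<le> x"
  using first_box_before[OF fill first, of b] filling_pos[OF fill, of x b]
  by (cases "x = 1"; cases "x = 2") auto

lemma pos: "x \<in> T b \<Longrightarrow> 1 \<le> x"
  using filling_pos[OF fill] by fastforce

text \<open>In most positions the new 1 would require a letter below 3 in a box read before
  \<open>Y\<close>, or a letter below 1, or the pattern persists with the old 2. The two positions
  left over, with \<open>Y\<close> in the upper row of a \<open>diagonal\<close> or
  \<open>lower\<close> pattern, are excluded by an \<open>upper\<close> pattern of the old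
  filling.\<close>

lemma avoids_repl_2_1:
  assumes Y: "2 \<in> T Y"
  shows "avoids (repl 2 1 Y T)"
  unfolding avoids_def
proof (intro allI impI notI)
  fix V assume V: "bad_pattern V" "V \<subseteq> Sigma UNIV (repl 2 1 Y T)"
  have mem: "x \<in> T b \<or> Y = b \<and> x = 1" if "(b, x) \<in> V" for b x
    using that V(2) by (auto simp: repl_def split: if_splits)
  show False
    using V(1)
  proof cases
    case (row j k l x y z r)
    consider "x \<in> T (r, j)" "y \<in> T (r, k)" "z \<in> T (r, l)" | "Y = (r, j)" "x = 1" "y \<in> T (r, k)" "z \<in> T (r, l)"
      | "y = 1" "x \<in> T (r, j)" | "Y = (r, l)" "z = 1" "x \<in> T (r, j)" "y \<in> T (r, k)"
      using mem[of "(r, j)" x] mem[of "(r, k)" y] mem[of "(r, l)" z] row by auto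
    then show False
    proof cases
      case 1
      then show False using row_rule[OF 1] row by simp
    next
      case 2
      then show False using early[OF 2(3)] row_rule[of 2 r j y k z l] Y row by simp
    next
      case 3
      then show False using pos[OF 3(2)] row by simp
    next
      case 4
      then show False using pos[OF 4(3)] row_rule[of x r j y k 2 l] Y row by simp
    qed
  next
    case (diagonal x y r d)
    consider "x \<in> T (r, r)" "y \<in> T (Suc r, d)" | "Y = (r, r)" "x = 1" "y \<in> T (Suc r, d)"
      | "Y = (Suc r, d)" "y = 1" "x \<in> T (r, r)"
      using mem[of "(r, r)" x] mem[of "(Suc r, d)" y] diagonal by auto
    then show False
    proof cases
      case 1
      then show False using diag_rule[OF 1] diagonal by simp
    next
      case 2
      \<comment> \<open>The first box of row \<open>r + 1\<close> holds a letter below 2 by the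
        diagonal rule, and the box above it lies right of \<open>Y\<close>, so it holds at least 3.
        With the 2 of \<open>Y\<close> between these values, they form an \<open>upper\<close>
        pattern.\<close>
      have SDr: "(Suc r, d) \<in> SD lam" using mem_SD[OF 2(3)] .
      then have d: "Suc r \<le> d" using SD_col by blast
      have b: "(Suc r, Suc r) \<in> SD lam" using SD_row[OF SDr _ d] by simp
      then obtain v where v: "v \<in> T (Suc r, Suc r)" using ex_value by blast
      have "(r, Suc r) \<in> SD lam" using SD_up[OF mem_SD b] Y 2 by auto
      then obtain w where w: "w \<in> T (r, Suc r)" using ex_value by blast
      have "3 \<le> w" using early[OF w] 2 by simp
      moreover have "v < 2" using diag_rule[of 2 r v "Suc r"] Y 2 v by simp
      ultimately show False using upper_rule[of 2 r r w "Suc r" v] Y 2 v w by auto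
    next
      case 3
      then show False using early[OF 3(3)] diagonal by simp
    qed
  next
    case (lower c d x y z r)
    consider "x \<in> T (r, c)" "y \<in> T (Suc r, d)" "z \<in> T (Suc r, c)"
      | "Y = (r, c)" "x = 1" "y \<in> T (Suc r, d)" "z \<in> T (Suc r, c)"
      | "Y = (Suc r, d)" "y = 1" "x \<in> T (r, c)"
      | "Y = (Suc r, c)" "z = 1" "y \<in> T (Suc r, d)"
      using mem[of "(r, c)" x] mem[of "(Suc r, d)" y] mem[of "(Suc r, c)" z] lower by auto
    then show False
    proof cases
      case 1
      then show False using lower_rule[OF 1] lower by simp
    next
      case 2
      \<comment> \<open>Only \<open>y = 1\<close> is left. The box above it is read before
        \<open>Y\<close> and holds at least 3, so \<open>1 < 2 < w\<close> is an
        \<open>upper\<close> pattern.\<close>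
      have "\<not> 2 \<le> y" using lower_rule[of 2 r c y d z] Y 2 lower by auto
      then have y: "y = 1" using pos[OF 2(3)] by simp
      have "(r, d) \<in> SD lam" using SD_up[OF mem_SD mem_SD[OF 2(3)]] Y 2 by auto
      then obtain w where w: "w \<in> T (r, d)" using ex_value by blast
      have "3 \<le> w" using early[OF w] 2 lower by simp
      then show False using upper_rule[of 2 r c w d y] Y 2 w y lower by auto
    next
      case 3
      then show False using early[OF 3(3)] lower by simp
    next
      case 4
      then show False using early[OF 4(3)] lower by simp
    qed
  next
    case (upper a c y x z r)
    consider "x \<in> T (r, a)" "z \<in> T (r, c)" "y \<in> T (Suc r, c)"
      | "x = 1" "y \<in> T (Suc r, c)" | "z = 1" "x \<in> T (r, a)"
      | "Y = (Suc r, c)" "y = 1" "x \<in> T (r, a)" "z \<in> T (r, c)"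
      using mem[of "(r, a)" x] mem[of "(r, c)" z] mem[of "(Suc r, c)" y] upper by auto
    then show False
    proof cases
      case 1
      then show False using upper_rule[OF 1] upper by simp
    next
      case 2
      then show False using pos[OF 2(2)] upper by simp
    next
      case 3
      then show False using pos[OF 3(2)] upper by simp
    next
      case 4
      then show False using early[OF 4(3)] upper_rule[of x r a z c 2] Y upper by simp
    qed
  qed
qed

lemma avoids_repl_1_2:
  assumes Y: "1 \<in> T Y"
  shows "avoids (repl 1 2 Y T)"
  unfolding avoids_def
proof (intro allI impI notI)
  fix V assume V: "bad_pattern V" "V \<subseteq> Sigma UNIV (repl 1 2 Y T)"
  have mem: "x \<in> T b \<or> Y = b \<and> x = 2" if "(b, x) \<in> V" for b x
    using that V(2) by (auto simp: repl_def split: if_splits)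
  show False
    using V(1)
  proof cases
    case (row j k l x y z r)
    consider "x \<in> T (r, j)" "y \<in> T (r, k)" "z \<in> T (r, l)" | "Y = (r, j)" "x = 2" "y \<in> T (r, k)" "z \<in> T (r, l)"
      | "Y = (r, k)" "y = 2" "z \<in> T (r, l)" | "Y = (r, l)" "z = 2" "x \<in> T (r, j)" "y \<in> T (r, k)"
      using mem[of "(r, j)" x] mem[of "(r, k)" y] mem[of "(r, l)" z] row by auto
    then show False
    proof cases
      case 1
      then show False using row_rule[OF 1] row by simp
    next
      case 2
      then show False using row_rule[of 1 r j y k z l] Y row by simp
    next
      case 3
      then show False using early[OF 3(3)] row by simp
    next
      case 4
      then show False using row_rule[of x r j y k 1 l] Y row by simp
    qed
  next
    case (diagonal x y r d)
    consider "x \<in> T (r, r)" "y \<in> T (Suc r, d)" | "Y = (r, r)" "x = 2" "y \<in> T (Suc r, d)"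
      | "Y = (Suc r, d)" "y = 2" "x \<in> T (r, r)"
      using mem[of "(r, r)" x] mem[of "(Suc r, d)" y] diagonal by auto
    then show False
    proof cases
      case 1
      then show False using diag_rule[OF 1] diagonal by simp
    next
      case 2
      then show False using diag_rule[of 1 r y d] Y diagonal by simp
    next
      case 3
      then show False using early[OF 3(3)] diagonal by simp
    qed
  next
    case (lower c d x y z r)
    consider "x \<in> T (r, c)" "y \<in> T (Suc r, d)" "z \<in> T (Suc r, c)"
      | "Y = (r, c)" "x = 2" "y \<in> T (Suc r, d)" "z \<in> T (Suc r, c)"
      | "Y = (Suc r, d)" "y = 2" "x \<in> T (r, c)"
      | "Y = (Suc r, c)" "z = 2" "y \<in> T (Suc r, d)"
      using mem[of "(r, c)" x] mem[of "(Suc r, d)" y] mem[of "(Suc r, c)" z] lower by auto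
    then show False
    proof cases
      case 1
      then show False using lower_rule[OF 1] lower by simp
    next
      case 2
      then show False using lower_rule[of 1 r c y d z] Y lower by simp
    next
      case 3
      then show False using early[OF 3(3)] lower by simp
    next
      case 4
      then show False using early[OF 4(3)] lower by simp
    qed
  next
    case (upper a c y x z r)
    consider "x \<in> T (r, a)" "z \<in> T (r, c)" "y \<in> T (Suc r, c)"
      | "Y = (r, a)" "x = 2" "z \<in> T (r, c)" "y \<in> T (Suc r, c)"
      | "z = 2" "x \<in> T (r, a)" "y \<in> T (Suc r, c)"
      | "Y = (Suc r, c)" "y = 2" "x \<in> T (r, a)" "z \<in> T (r, c)"
      using mem[of "(r, a)" x] mem[of "(r, c)" z] mem[of "(Suc r, c)" y] upper by auto
    then show False
    proof cases
      case 1
      then show False using upper_rule[OF 1] upper by simp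
    next
      case 2
      then have y: "y = 1" using pos[OF 2(4)] upper by simp
      have one: "1 \<in> T (r, a)" using Y 2 by simp
      \<comment> \<open>Off the diagonal there is a box directly under \<open>Y\<close>. Whatever
        letter it holds is at least 1 and forms a \<open>lower\<close> pattern with the 1 of
        \<open>Y\<close> and the letter \<open>y = 1\<close>.\<close>
      have ra: "r \<noteq> a" using diag_rule[of 1 r y c] one 2 y by auto
      then have "r < a" using SD_col[OF mem_SD[OF one]] by simp
      then have "(Suc r, a) \<in> SD lam"
        using SD_row[OF mem_SD[OF 2(4)], of a] upper by simp
      then obtain v where v: "v \<in> T (Suc r, a)" using ex_value by blast
      show False using lower_rule[OF one 2(4) v] upper y pos[OF v] by simp
    next
      case 3
      then show False using pos[OF 3(3)] upper by simp
    next
      case 4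
      then show False using upper_rule[of x r a z c 1] Y upper by simp
    qed
  qed
qed

end

end

section \<open>Compatibility of the odd operators with steps\<close>

definition bar_letters :: "nat \<Rightarrow> nat \<Rightarrow> bool" where
  "bar_letters p q \<longleftrightarrow> p = 1 \<and> q = 2 \<or> p = 2 \<and> q = 1"

lemma bar_letters_swap: "bar_letters p q \<Longrightarrow> bar_letters q p"
  by (auto simp: bar_letters_def)

text \<open>\<open>Y\<close> contains 1 or 2 both before and after the exchange and no other box
  changes, so the same box is selected again. This is why the odd operators are mutually
  inverse.\<close>

lemma first_box_repl:
  assumes "bar_letters p q" "p \<in> T Y"
  shows "first_box lam (repl p q Y T) Z \<longleftrightarrow> first_box lam T Z"
  using assms by (intro first_box_cong) (auto simp: bar_letters_def repl_def)

lemma repl_inverse: "p \<in> T Y \<Longrightarrow> q \<notin> T Y \<Longrightarrow> repl q p Y (repl p q Y T) = T"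
  by (auto simp: repl_def fun_eq_iff)

lemma bar_op_inverse:
  assumes "bar_letters p q" "bar_op p q lam T = Some U"
  shows "bar_op q p lam U = Some T"
proof -
  obtain Y where Y: "first_box lam T Y" "p \<in> T Y" "q \<notin> T Y" "U = repl p q Y T"
    using assms(2) by (auto simp: bar_op_Some_iff)
  have "p \<noteq> q" using assms(1) by (auto simp: bar_letters_def)
  then have "first_box lam U Y \<and> q \<in> U Y \<and> p \<notin> U Y \<and> T = repl q p Y U"
    using Y first_box_repl[of p q T Y lam, OF assms(1) Y(2)] repl_inverse[of p T Y q, OF Y(2,3)] by (simp add: repl_def)
  then show ?thesis unfolding bar_op_Some_iff by blast
qed

lemma bar_op_iff: "bar_letters p q \<Longrightarrow> bar_op p q lam T = Some U \<longleftrightarrow> bar_op q p lam U = Some T"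
  using bar_op_inverse bar_letters_swap by blast

lemma bar_op_setval:
  assumes lam: "strict_partition lam" and pq: "bar_letters p q" and T: "setval_dec_tableau lam T"
    and U: "bar_op p q lam T = Some U"
  shows "setval_dec_tableau lam U"
proof -
  obtain Y where Y: "first_box lam T Y" "p \<in> T Y" "q \<notin> T Y" "U = repl p q Y T"
    using U by (auto simp: bar_op_Some_iff)
  have fill: "filling lam T" and "avoids T" using T by (simp_all add: setval_dec_tableau_iff[OF lam])
  then interpret pattern_avoiding lam T using lam by unfold_locales
  have "avoids U"
    using pq avoids_repl_1_2[OF Y(1)] avoids_repl_2_1[OF Y(1)] Y(2,4) by (auto simp: bar_letters_def)
  moreover have "filling lam U"
    unfolding Y(4) using filling_repl[OF fill first_box_SD[OF Y(1)]] pq by (auto simp: bar_letters_def)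
  ultimately show ?thesis by (simp add: setval_dec_tableau_iff[OF lam])
qed

text \<open>The opposite exchange undoes this one, and both preserve tableaux.\<close>

lemma setval_repl_iff:
  assumes lam: "strict_partition lam" and pq: "bar_letters p q"
    and Y: "first_box lam W Y" "p \<in> W Y" "q \<notin> W Y"
  shows "setval_dec_tableau lam (repl p q Y W) \<longleftrightarrow> setval_dec_tableau lam W"
proof -
  have "bar_op p q lam W = Some (repl p q Y W)" using Y by (rule bar_opI)
  then show ?thesis
    using bar_op_setval[OF lam pq] bar_op_inverse[OF pq] bar_op_setval[OF lam bar_letters_swap[OF pq]]
    by blast
qed

lemma repl_commute:
  assumes "{p, q} \<inter> {s, t} = {}"
  shows "repl s t X (repl p q Y T) = repl p q Y (repl s t X T)"
    "slide s t A X (repl p q Y T) = repl p q Y (slide s t A X T)"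
  using assms by (auto simp: repl_def slide_def fun_eq_iff)

lemma opens_repl:
  assumes "{p, q} \<inter> {i, Suc i} = {}"
  shows "opens i lam (repl p q Y T) X \<longleftrightarrow> opens i lam T X"
proof -
  have "k \<in> repl p q Y T b \<longleftrightarrow> k \<in> T b" if "k \<in> {i, Suc i}" for k b
    using assms that by (auto simp: repl_def)
  then show ?thesis by (simp add: opens_def pivot_cong[of i "repl p q Y T" T])
qed

text \<open>The choice between cases (a) and (b) depends on whether plain replacements are tableaux,
  so this must not be affected by the exchange of 1 and 2. All fillings involved agree with
  \<open>T\<close> on letters below 3; hence \<open>Y\<close> is the selected box of each, and
  \<open>setval_repl_iff\<close> applies to all of them.\<close>

lemma e_step_repl_commute:
  assumes lam: "strict_partition lam" and pq: "bar_letters p q" and i: "3 \<le> i"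
    and step: "e_step lam i T U" and Y: "first_box lam T Y" "p \<in> T Y" "q \<notin> T Y"
  shows "e_step lam i (repl p q Y T) (repl p q Y U)"
proof -
  have disj: "{p, q} \<inter> {i, Suc i} = {}" "{p, q} \<inter> {Suc i, i} = {}"
    using pq i by (auto simp: bar_letters_def)
  have valid: "setval_dec_tableau lam (repl p q Y W) \<longleftrightarrow> setval_dec_tableau lam W"
    if "\<And>b k. k < 3 \<Longrightarrow> k \<in> W b \<longleftrightarrow> k \<in> T b" for W
  proof (rule setval_repl_iff[OF lam pq])
    show "first_box lam W Y" using Y(1) that by (subst first_box_cong[of W T]) auto
    have "p < 3" "q < 3" using pq by (auto simp: bar_letters_def)
    then show "p \<in> W Y" "q \<notin> W Y" using that Y by simp_all
  qed
  have small: "k \<in> repl (Suc i) i X T b \<longleftrightarrow> k \<in> T b" "k \<in> slide (Suc i) i A X T b \<longleftrightarrow> k \<in> T b"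
    "k \<in> repl i (Suc i) A (slide (Suc i) i A X T) b \<longleftrightarrow> k \<in> T b" if "k < 3" for k A X b
    using that i by (auto simp: repl_def slide_def)
  have val: "setval_dec_tableau lam T" "setval_dec_tableau lam U" using step by (auto simp: e_step_def)
  have vT: "setval_dec_tableau lam (repl p q Y T)" using valid[of T] val by simp
  show ?thesis
    using step unfolding e_step_def
  proof (elim conjE disjE exE)
    fix X assume X: "opens i lam T X" "U = repl (Suc i) i X T"
    have "repl p q Y U = repl (Suc i) i X (repl p q Y T)"
      using repl_commute(1)[OF disj(2)] X by simp
    moreover have "setval_dec_tableau lam (repl p q Y U)"
      using valid[of U] val small(1) X by simp
    ultimately show "setval_dec_tableau lam (repl p q Y T) \<and> setval_dec_tableau lam (repl p q Y U) \<and>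
     ((\<exists>X. opens i lam (repl p q Y T) X \<and> repl p q Y U = repl (Suc i) i X (repl p q Y T)) \<or>
      (\<exists>P A S X Q. revrow_boxes lam = P @ A # S @ X # Q \<and> opens i lam (repl p q Y T) X \<and>
         i \<in> repl p q Y T A \<and> Suc i \<in> repl p q Y T A \<and>
         (\<forall>m\<in>set S. i \<notin> repl p q Y T m \<and> Suc i \<notin> repl p q Y T m) \<and>
         repl p q Y U = slide (Suc i) i A X (repl p q Y T) \<and>
         \<not> setval_dec_tableau lam (repl (Suc i) i X (repl p q Y T)) \<and>
         \<not> setval_dec_tableau lam (repl i (Suc i) A (repl p q Y U))))"
      using vT X(1) opens_repl[OF disj(1)] by blast
  next
    fix P A S X Q
    assume *: "revrow_boxes lam = P @ A # S @ X # Q" "opens i lam T X" "i \<in> T A" "Suc i \<in> T A"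
      "\<forall>m\<in>set S. i \<notin> T m \<and> Suc i \<notin> T m" "U = slide (Suc i) i A X T"
      "\<not> setval_dec_tableau lam (repl (Suc i) i X T)" "\<not> setval_dec_tableau lam (repl i (Suc i) A U)"
    have "repl p q Y U = slide (Suc i) i A X (repl p q Y T)"
      using repl_commute(2)[OF disj(2)] * by simp
    moreover have "setval_dec_tableau lam (repl p q Y U)"
      using valid[of U] val small(2) * by simp
    moreover have "\<not> setval_dec_tableau lam (repl (Suc i) i X (repl p q Y T))"
      unfolding repl_commute(1)[OF disj(2)] using valid[of "repl (Suc i) i X T"] small(1) *(7) by simp
    moreover have "\<not> setval_dec_tableau lam (repl i (Suc i) A (repl p q Y U))"
      unfolding repl_commute(1)[OF disj(1)]
      using valid[of "repl i (Suc i) A U"] small(3) *(6,8) by simp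
    moreover have "k \<in> repl p q Y T b \<longleftrightarrow> k \<in> T b" if "k \<in> {i, Suc i}" for k b
      using disj that by (auto simp: repl_def)
    ultimately show "setval_dec_tableau lam (repl p q Y T) \<and> setval_dec_tableau lam (repl p q Y U) \<and>
     ((\<exists>X. opens i lam (repl p q Y T) X \<and> repl p q Y U = repl (Suc i) i X (repl p q Y T)) \<or>
      (\<exists>P A S X Q. revrow_boxes lam = P @ A # S @ X # Q \<and> opens i lam (repl p q Y T) X \<and>
         i \<in> repl p q Y T A \<and> Suc i \<in> repl p q Y T A \<and>
         (\<forall>m\<in>set S. i \<notin> repl p q Y T m \<and> Suc i \<notin> repl p q Y T m) \<and>
         repl p q Y U = slide (Suc i) i A X (repl p q Y T) \<and>
         \<not> setval_dec_tableau lam (repl (Suc i) i X (repl p q Y T)) \<and>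
         \<not> setval_dec_tableau lam (repl i (Suc i) A (repl p q Y U))))"
      using vT * opens_repl[OF disj(1)]
      by (intro conjI disjI2 exI[of _ P] exI[of _ A] exI[of _ S] exI[of _ X] exI[of _ Q]) simp_all
  qed
qed

text \<open>The two ends of the step have the same letters below 3, so the odd operator selects the
  same box at both ends and is defined at both or at neither.\<close>

lemma bar_op_e_step:
  assumes lam: "strict_partition lam" and pq: "bar_letters p q" and i: "3 \<le> i"
    and step: "e_step lam i T U"
  shows "bar_op p q lam T = None \<and> bar_op p q lam U = None \<or>
    (\<exists>T' U'. bar_op p q lam T = Some T' \<and> bar_op p q lam U = Some U' \<and> e_step lam i T' U')"
proof -
  have small: "k \<in> U b \<longleftrightarrow> k \<in> T b" if "k < 3" for k b
    using e_step_other[OF step, of k b] that i by simp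
  have pq3: "p < 3" "q < 3" using pq by (auto simp: bar_letters_def)
  have first: "first_box lam U Y \<longleftrightarrow> first_box lam T Y" for Y
    by (rule first_box_cong) (simp add: small)
  show ?thesis
  proof (cases "bar_op p q lam T")
    case None
    have "bar_op p q lam U = None"
    proof (rule ccontr)
      assume "bar_op p q lam U \<noteq> None"
      then obtain Y where "first_box lam U Y" "p \<in> U Y" "q \<notin> U Y"
        by (auto simp: bar_op_Some_iff)
      then have "bar_op p q lam T = Some (repl p q Y T)"
        using first small pq3 by (intro bar_opI) auto
      then show False using None by simp
    qed
    then show ?thesis using None by simp
  next
    case (Some T')
    then obtain Y where Y: "first_box lam T Y" "p \<in> T Y" "q \<notin> T Y" "T' = repl p q Y T"
      by (auto simp: bar_op_Some_iff)
    then have "bar_op p q lam U = Some (repl p q Y U)"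
      using first small pq3 by (intro bar_opI) auto
    then show ?thesis using Some Y e_step_repl_commute[OF lam pq i step Y(1-3)] by blast
  qed
qed

lemma bar_op_sig:
  assumes "bar_letters p q" "3 \<le> i" "bar_op p q lam T = Some U"
  shows "box_sig i U bs = box_sig i T bs"
proof (rule sig_cong)
  obtain Y where "U = repl p q Y T" using assms(3) by (auto simp: bar_op_Some_iff)
  then show "box_paren i U b = box_paren i T b" for b
    using assms(1,2) by (auto simp: bar_letters_def box_paren_def repl_def)
qed

lemma bar_op_wt:
  assumes "bar_letters p q" "2 \<le> n" "bar_op p q lam T = Some U"
  shows "tab_wt n lam U = (\<lambda>k. tab_wt n lam T k + basis_vec q k - basis_vec p k)"
proof
  fix k
  obtain Y where Y: "first_box lam T Y" "p \<in> T Y" "q \<notin> T Y" "U = repl p q Y T"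
    using assms(3) by (auto simp: bar_op_Some_iff)
  have YS: "Y \<in> SD lam" using first_box_SD[OF Y(1)] .
  have pq: "p \<noteq> q" "p \<in> {1..n}" "q \<in> {1..n}" using assms(1,2) by (auto simp: bar_letters_def)
  have fin: "finite {b \<in> SD lam. P b}" for P using finite_SD by simp
  have "{b \<in> SD lam. q \<in> U b} = insert Y {b \<in> SD lam. q \<in> T b}"
    using Y YS by (auto simp: repl_def split: if_splits)
  then have 1: "card {b \<in> SD lam. q \<in> U b} = Suc (card {b \<in> SD lam. q \<in> T b})"
    using fin Y by simp
  have "{b \<in> SD lam. p \<in> T b} = insert Y {b \<in> SD lam. p \<in> U b}"
    using Y YS pq by (auto simp: repl_def split: if_splits)
  then have 2: "card {b \<in> SD lam. p \<in> T b} = Suc (card {b \<in> SD lam. p \<in> U b})"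
    using fin Y pq by (simp add: repl_def)
  have 3: "k \<in> U b \<longleftrightarrow> k \<in> T b" if "k \<noteq> p" "k \<noteq> q" for b
    using that Y by (auto simp: repl_def)
  consider "k = q" | "k = p" | "k \<noteq> p" "k \<noteq> q" by blast
  then show "tab_wt n lam U k = tab_wt n lam T k + basis_vec q k - basis_vec p k"
    using 1 2 3 pq by cases (auto simp: tab_wt_def basis_vec_def)
qed

section \<open>The crystal axioms for set-valued decomposition tableaux\<close>

context
  fixes n :: nat and lam :: "nat list"
  assumes lam: "strict_partition lam"
begin

lemma SetDecTab_setval: "T \<in> SetDecTab n lam \<Longrightarrow> setval_dec_tableau lam T"
  by (simp add: SetDecTab_def)

lemma e_step_SetDecTab:
  assumes "i \<in> {1..<n}" "e_step lam i T U"
  shows "T \<in> SetDecTab n lam \<longleftrightarrow> U \<in> SetDecTab n lam"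
proof -
  have "T b \<subseteq> {1..n} \<longleftrightarrow> U b \<subseteq> {1..n}" for b
  proof -
    have "k \<in> T b \<longleftrightarrow> k \<in> U b" if "k \<notin> {1..n}" for k
      using e_step_other[OF assms(2), of k b] that assms(1) by auto
    then show ?thesis by blast
  qed
  then show ?thesis using e_step_setval[OF assms(2)] by (simp add: SetDecTab_def)
qed

lemma e_op_SetDecTab:
  assumes "i \<in> {1..<n}" "T \<in> SetDecTab n lam"
  shows "e_op lam i T = Some U \<longleftrightarrow> U \<in> SetDecTab n lam \<and> e_step lam i T U"
  using assms e_op_iff_e_step[OF lam _ SetDecTab_setval[OF assms(2)], of i U] e_step_SetDecTab[OF assms(1)]
  by auto

lemma f_op_SetDecTab:
  assumes "i \<in> {1..<n}" "T \<in> SetDecTab n lam"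
  shows "f_op lam i T = Some U \<longleftrightarrow> U \<in> SetDecTab n lam \<and> e_step lam i U T"
  using assms f_op_iff_e_step[OF lam _ SetDecTab_setval[OF assms(2)], of i U] e_step_SetDecTab[OF assms(1)]
  by auto

lemma bar_op_SetDecTab:
  assumes "bar_letters p q" "2 \<le> n" "T \<in> SetDecTab n lam" "bar_op p q lam T = Some U"
  shows "U \<in> SetDecTab n lam"
proof -
  obtain Y where Y: "U = repl p q Y T" using assms(4) by (auto simp: bar_op_Some_iff)
  have "U b \<subseteq> {1..n}" if "b \<in> SD lam" for b
  proof -
    have "T b \<subseteq> {1..n}" using assms(3) that by (simp add: SetDecTab_def)
    moreover have "q \<in> {1..n}" using assms(1,2) by (auto simp: bar_letters_def)
    ultimately show ?thesis by (auto simp: Y repl_def)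
  qed
  then show ?thesis
    using bar_op_setval[OF lam assms(1) SetDecTab_setval[OF assms(3)] assms(4)] by (simp add: SetDecTab_def)
qed

lemma string_len_e:
  assumes "i \<in> {1..<n}" "T \<in> SetDecTab n lam"
  shows "string_len (e_op lam i) T = enat (snd (box_sig i T (revrow_boxes lam)))"
proof (rule string_len_eq[where B = "SetDecTab n lam"])
  fix T U assume T: "T \<in> SetDecTab n lam" "e_op lam i T = Some U"
  then have "U \<in> SetDecTab n lam" "e_step lam i T U" using e_op_SetDecTab[OF assms(1)] by auto
  then show "U \<in> SetDecTab n lam \<and> snd (box_sig i T (revrow_boxes lam)) =
      Suc (snd (box_sig i U (revrow_boxes lam)))"
    using e_step_sig by blast
next
  fix T assume T: "T \<in> SetDecTab n lam" "e_op lam i T = None"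
  then have "\<not> e_active lam i T" by (auto simp: e_op_eq split: if_splits)
  then show "snd (box_sig i T (revrow_boxes lam)) = 0"
    using e_active_iff[OF setval_finite[OF lam SetDecTab_setval[OF T(1)]]] by simp
qed (rule assms)

lemma string_len_f:
  assumes "i \<in> {1..<n}" "T \<in> SetDecTab n lam"
  shows "string_len (f_op lam i) T = enat (fst (box_sig i T (revrow_boxes lam)))"
proof (rule string_len_eq[where B = "SetDecTab n lam"])
  fix T U assume T: "T \<in> SetDecTab n lam" "f_op lam i T = Some U"
  then have "U \<in> SetDecTab n lam" "e_step lam i U T" using f_op_SetDecTab[OF assms(1)] by auto
  then show "U \<in> SetDecTab n lam \<and> fst (box_sig i T (revrow_boxes lam)) =
      Suc (fst (box_sig i U (revrow_boxes lam)))"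
    using e_step_sig by blast
next
  fix T assume T: "T \<in> SetDecTab n lam" "f_op lam i T = None"
  then have "\<not> f_active lam i T" by (auto simp: f_op_eq split: if_splits)
  then show "fst (box_sig i T (revrow_boxes lam)) = 0"
    using f_active_iff[OF setval_finite[OF lam SetDecTab_setval[OF T(1)]]] by simp
qed (rule assms)

lemma box_sig_wt:
  assumes "i \<in> {1..<n}"
  shows "int (fst (box_sig i T (revrow_boxes lam))) - int (snd (box_sig i T (revrow_boxes lam)))
    = tab_wt n lam T i - tab_wt n lam T (i + 1)"
proof -
  have "length (filter (\<lambda>b. k \<in> T b) (revrow_boxes lam)) = card {b \<in> SD lam. k \<in> T b}" for k
  proof -
    have "set (filter (\<lambda>b. k \<in> T b) (revrow_boxes lam)) = {b \<in> SD lam. k \<in> T b}"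
      using set_revrow_boxes by auto
    then show ?thesis using distinct_card[of "filter (\<lambda>b. k \<in> T b) (revrow_boxes lam)"]
      by (simp add: distinct_revrow_boxes)
  qed
  then show ?thesis using box_sig_count[of i T "revrow_boxes lam"] assms by (simp add: tab_wt_def)
qed

lemma seminormal_SetDecTab:
  "seminormal_gl_crystal n (SetDecTab n lam) (tab_wt n lam) (e_op lam) (f_op lam)"
proof
  show "tab_wt n lam \<in> SetDecTab n lam \<rightarrow> int_vectors n"
    by (auto simp: int_vectors_def tab_wt_def)
  fix i assume i: "i \<in> {1..<n}"
  show "e_op lam i \<in> SetDecTab n lam \<rightarrow> with_zero (SetDecTab n lam)"
  proof
    fix T assume T: "T \<in> SetDecTab n lam"
    show "e_op lam i T \<in> with_zero (SetDecTab n lam)"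
      using e_op_SetDecTab[OF i T] by (cases "e_op lam i T") (auto simp: with_zero_def)
  qed
  show "f_op lam i \<in> SetDecTab n lam \<rightarrow> with_zero (SetDecTab n lam)"
  proof
    fix T assume T: "T \<in> SetDecTab n lam"
    show "f_op lam i T \<in> with_zero (SetDecTab n lam)"
      using f_op_SetDecTab[OF i T] by (cases "f_op lam i T") (auto simp: with_zero_def)
  qed
  fix T assume T: "T \<in> SetDecTab n lam"
  show "string_len (e_op lam i) T \<noteq> \<infinity>" "string_len (f_op lam i) T \<noteq> \<infinity>"
    by (simp_all add: string_len_e[OF i T] string_len_f[OF i T])
  show "int (the_enat (string_len (f_op lam i) T)) - int (the_enat (string_len (e_op lam i) T))
      = tab_wt n lam T i - tab_wt n lam T (i + 1)"
    using box_sig_wt[OF i] by (simp add: string_len_e[OF i T] string_len_f[OF i T])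
  fix U assume U: "U \<in> SetDecTab n lam"
  show "e_op lam i T = Some U \<longleftrightarrow> f_op lam i U = Some T"
    using e_op_SetDecTab[OF i T] f_op_SetDecTab[OF i U] T U by blast
  show "tab_wt n lam U = (\<lambda>k. tab_wt n lam T k + basis_vec i k - basis_vec (i + 1) k)"
    if "e_op lam i T = Some U"
    using e_step_wt[OF _ i] e_op_SetDecTab[OF i T] that by blast
qed

lemma bar_op_commute:
  assumes pq: "bar_letters p q" and n: "2 \<le> n" and i: "3 \<le> i" "i \<le> n - 1"
  shows "commute_on (SetDecTab n lam) (bar_op p q lam) (e_op lam i)"
    "commute_on (SetDecTab n lam) (bar_op p q lam) (f_op lam i)"
proof -
  have i': "i \<in> {1..<n}" "0 < i" using i by auto
  note qp = bar_letters_swap[OF pq]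
  show "commute_on (SetDecTab n lam) (bar_op p q lam) (e_op lam i)"
    unfolding commute_on_def
  proof
    fix T assume T: "T \<in> SetDecTab n lam"
    show "Option.bind (bar_op p q lam T) (e_op lam i) = Option.bind (e_op lam i T) (bar_op p q lam)"
    proof (cases "e_op lam i T")
      case None
      \<comment> \<open>A step starting at \<open>T'\<close> could be carried back along the inverse
        odd operator to a step starting at \<open>T\<close>.\<close>
      have "e_op lam i T' = None" if T': "bar_op p q lam T = Some T'" for T'
      proof (rule ccontr)
        assume "e_op lam i T' \<noteq> None"
        then obtain U' where "e_step lam i T' U'"
          using e_op_SetDecTab[OF i'(1) bar_op_SetDecTab[OF pq n T T']] by blast
        then obtain U where "e_step lam i T U"
          using bar_op_e_step[OF lam qp i(1)] bar_op_inverse[OF pq T'] by fastforce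
        then show False using e_step_imp_e_op[OF lam i'(2)] None by simp
      qed
      then show ?thesis using None by (cases "bar_op p q lam T") auto
    next
      case (Some U)
      then have "e_step lam i T U" using e_op_SetDecTab[OF i'(1) T] by blast
      then show ?thesis
        using bar_op_e_step[OF lam pq i(1)] e_step_imp_e_op[OF lam i'(2)] Some by fastforce
    qed
  qed
  show "commute_on (SetDecTab n lam) (bar_op p q lam) (f_op lam i)"
    unfolding commute_on_def
  proof
    fix T assume T: "T \<in> SetDecTab n lam"
    show "Option.bind (bar_op p q lam T) (f_op lam i) = Option.bind (f_op lam i T) (bar_op p q lam)"
    proof (cases "f_op lam i T")
      case None
      have "f_op lam i T' = None" if T': "bar_op p q lam T = Some T'" for T'
      proof (rule ccontr)
        assume "f_op lam i T' \<noteq> None"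
        then obtain U' where "e_step lam i U' T'"
          using f_op_SetDecTab[OF i'(1) bar_op_SetDecTab[OF pq n T T']] by blast
        then obtain U where "e_step lam i U T"
          using bar_op_e_step[OF lam qp i(1)] bar_op_inverse[OF pq T'] by fastforce
        then show False using e_step_imp_f_op[OF lam i'(2)] None by simp
      qed
      then show ?thesis using None by (cases "bar_op p q lam T") auto
    next
      case (Some U)
      then have "e_step lam i U T" using f_op_SetDecTab[OF i'(1) T] by blast
      then show ?thesis
        using bar_op_e_step[OF lam pq i(1)] e_step_imp_f_op[OF lam i'(2)] Some by fastforce
    qed
  qed
qed

lemma bar_op_preserves:
  assumes pq: "bar_letters p q" and n: "2 \<le> n" and i: "3 \<le> i" "i \<le> n - 1"
  shows "preserves_on (SetDecTab n lam) (bar_op p q lam) (string_len (e_op lam i))"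
    "preserves_on (SetDecTab n lam) (bar_op p q lam) (string_len (f_op lam i))"
  using i string_len_e string_len_f bar_op_SetDecTab[OF pq n] bar_op_sig[OF pq i(1)]
  by (auto simp: preserves_on_def)

lemma bar_op_closed:
  assumes "bar_letters p q" "2 \<le> n"
  shows "bar_op p q lam \<in> SetDecTab n lam \<rightarrow> with_zero (SetDecTab n lam)"
proof
  fix T assume "T \<in> SetDecTab n lam"
  then show "bar_op p q lam T \<in> with_zero (SetDecTab n lam)"
    using bar_op_SetDecTab[OF assms] by (cases "bar_op p q lam T") (auto simp: with_zero_def)
qed

lemma q_crystal_SetDecTab:
  assumes n: "2 \<le> n"
  shows "q_crystal n (SetDecTab n lam) (tab_wt n lam) (e_op lam) (f_op lam) (ebar_op lam) (fbar_op lam)"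
proof -
  interpret seminormal_gl_crystal n "SetDecTab n lam" "tab_wt n lam" "e_op lam" "f_op lam"
    by (rule seminormal_SetDecTab)
  have l: "bar_letters 2 1" "bar_letters 1 2" by (auto simp: bar_letters_def)
  show ?thesis
    unfolding ebar_op_eq fbar_op_eq
  proof unfold_locales
    show "bar_op 2 1 lam \<in> SetDecTab n lam \<rightarrow> with_zero (SetDecTab n lam)"
      "bar_op 1 2 lam \<in> SetDecTab n lam \<rightarrow> with_zero (SetDecTab n lam)"
      using bar_op_closed l n by blast+
  next
    fix i assume i: "3 \<le> i" "i \<le> n - 1"
    show "commute_on (SetDecTab n lam) (bar_op 2 1 lam) (e_op lam i) \<and>
        commute_on (SetDecTab n lam) (bar_op 2 1 lam) (f_op lam i)"
      "commute_on (SetDecTab n lam) (bar_op 1 2 lam) (e_op lam i) \<and>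
        commute_on (SetDecTab n lam) (bar_op 1 2 lam) (f_op lam i)"
      using bar_op_commute[OF _ n i] l by blast+
    show "preserves_on (SetDecTab n lam) (bar_op 2 1 lam) (string_len (e_op lam i)) \<and>
        preserves_on (SetDecTab n lam) (bar_op 2 1 lam) (string_len (f_op lam i))"
      "preserves_on (SetDecTab n lam) (bar_op 1 2 lam) (string_len (e_op lam i)) \<and>
        preserves_on (SetDecTab n lam) (bar_op 1 2 lam) (string_len (f_op lam i))"
      using bar_op_preserves[OF _ n i] l by blast+
  next
    fix T U
    show "bar_op 2 1 lam T = Some U \<longleftrightarrow> bar_op 1 2 lam U = Some T"
      using bar_op_iff l(1) .
    show "tab_wt n lam U = (\<lambda>k. tab_wt n lam T k + basis_vec 1 k - basis_vec 2 k)"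
      if "bar_op 2 1 lam T = Some U"
      using bar_op_wt[OF l(1) n that] .
  qed
qed

end

theorem theorem3p6:
  fixes n :: nat and lam :: "nat list"
  assumes "n \<ge> 2"
    and "strict_partition lam"
    and "length lam \<le> n"
  shows "(\<forall>i\<in>{1..<n}. \<forall>T\<in>SetDecTab n lam.
            (e_active lam i T \<and> \<not> setval_dec_tableau lam (e_replace lam i T)
               \<longrightarrow> e_partners lam i T \<noteq> []) \<and>
            (f_active lam i T \<and> \<not> setval_dec_tableau lam (f_replace lam i T)
               \<longrightarrow> f_partners lam i T \<noteq> [])) \<and>
         (\<forall>i\<in>{1..<n}.
            e_op lam i \<in> SetDecTab n lam \<rightarrow> with_zero (SetDecTab n lam) \<and>
            f_op lam i \<in> SetDecTab n lam \<rightarrow> with_zero (SetDecTab n lam)) \<and>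
         ebar_op lam \<in> SetDecTab n lam \<rightarrow> with_zero (SetDecTab n lam) \<and>
         fbar_op lam \<in> SetDecTab n lam \<rightarrow> with_zero (SetDecTab n lam) \<and>
         q_crystal n (SetDecTab n lam) (tab_wt n lam) (e_op lam) (f_op lam)
           (ebar_op lam) (fbar_op lam) \<and>
         seminormal_gl_crystal n (SetDecTab n lam) (tab_wt n lam) (e_op lam) (f_op lam)"
proof -
  interpret q_crystal n "SetDecTab n lam" "tab_wt n lam" "e_op lam" "f_op lam" "ebar_op lam" "fbar_op lam"
    using q_crystal_SetDecTab[OF assms(2,1)] .
  have "e_active lam i T \<and> \<not> setval_dec_tableau lam (e_replace lam i T) \<longrightarrow> e_partners lam i T \<noteq> []"
    "f_active lam i T \<and> \<not> setval_dec_tableau lam (f_replace lam i T) \<longrightarrow> f_partners lam i T \<noteq> []"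
    if "i \<in> {1..<n}" "T \<in> SetDecTab n lam" for i T
    using ex_e_step(2)[OF assms(2), of i T] ex_f_step(2)[OF assms(2), of i T] that
      SetDecTab_setval[OF assms(2) that(2)] by auto
  then show ?thesis
    using e_closed f_closed ebar_closed fbar_closed q_crystal_axioms seminormal_SetDecTab[OF assms(2)]
      q_crystal_SetDecTab[OF assms(2,1)]
    by blast
qed

end
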